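(* Let $t \ge 0$ be a fixed integer. The torus $T(\mathrm{SO}(2n))$ has a $(2t+1)$-design with $O(n^t)$ points. More precisely, as $n \to \infty$, $T(\mathrm{SO}(2n))$ has a $2t$-design with $(2n)^t(1+o(1))$ points, and a $(2t+1)$-design with twice as many points. The torus $T(\mathrm{PSU}(n+1))$ has a $t$-design with $n^t(1+o(1))$ points as $n \to \infty$.
   Context: A torus group $T\cong (S^1)^m$ acting faithfully and linearly on a real vector space $V$ is identified with a faithful orbit of $T$ in $V$, and so becomes a real algebraic variety; polynomials on $T$ of degree at most $d$ are the restrictions to the orbit of polynomials of degree at most $d$ on $V$. $T$ carries its normalized Haar measure. A $d$-design on $T$ is a finite set $F\subset T$ such that $\int_T P = \frac{1}{|F|}\sum_{p\in F}P(p)$ for every polynomial $P$ on $T$ of degree at most $d$. $T(\mathrm{SO}(2n))$ is the torus $(S^1)^n$ acting on $\mathbb{R}^{2n}=\mathbb{C}^n$ by separate rotations in $n$ orthogonal planes. Equivalently, the complex-valued polynomials of degree at most $d$ on it are spanned by the characters $(z_1,\ldots,z_n)\mapsto z_1^{k_1}\cdots z_n^{k_n}$ with $k\in\mathbb{Z}^n$, $\sum_i|k_i|\le d$. $T(\mathrm{PSU}(n+1))$ is the group of diagonal unitary $(n+1)\times(n+1)$ matrices of determinant $1$, modulo the center of $\mathrm{SU}(n+1)$, acting by conjugation on the space of $(n+1)\times(n+1)$ complex matrices (regarded as a real vector space). Equivalently, the complex-valued polynomials of degree at most $d$ on it are spanned by products of at most $d$ of the functions $z_j\overline{z_k}$,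 where $z_0,\ldots,z_n$ are the diagonal entries. *)

theory Defs
  imports "HOL-Probability.Probability" "HOL-Library.Landau_Symbols"
begin

section \<open>Designs on an orbit of a torus\<close>

text \<open>
  A torus acting faithfully and linearly on a real vector space is given by its image in the general
  linear group, i.e. as a set \<open>T\<close> of transformations. The vector spaces below are spaces of functions
  that vanish outside a finite index set, with the topology induced from the product topology, which
  on them is the Euclidean one.
\<close>

definition orbit_of :: "('v \<Rightarrow> 'v) set \<Rightarrow> 'v \<Rightarrow> 'v set" where
  "orbit_of T v = (\<lambda>g. g v) ` T"

text \<open>
  If \<open>g \<mapsto> g v\<close> is injective on \<open>T\<close> (a faithful orbit), it identifies \<open>T\<close> with the orbit and translation
  by \<open>g\<close> with the action of \<open>g\<close>. So Haar measure becomes the Borel probability measure on the orbit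
  that is invariant under \<open>T\<close>.
\<close>

definition is_haar :: "('v \<Rightarrow> 'v) set \<Rightarrow> 'v \<Rightarrow> 'v::topological_space measure \<Rightarrow> bool" where
  "is_haar T v M \<longleftrightarrow>
     prob_space M \<and> sets M = sets (restrict_space borel (orbit_of T v)) \<and>
     (\<forall>g\<in>T. g \<in> M \<rightarrow>\<^sub>M M \<and> distr M M g = M)"

definition haar_measure :: "('v \<Rightarrow> 'v) set \<Rightarrow> 'v \<Rightarrow> 'v::topological_space measure" where
  "haar_measure T v = (THE M. is_haar T v M)"

text \<open>\<open>poly_deg_le L d P\<close>: \<open>P\<close> is a real polynomial of degree at most \<open>d\<close> in the linear functionals \<open>L\<close>.\<close>

inductive poly_deg_le :: "('v \<Rightarrow> real) set \<Rightarrow> nat \<Rightarrow> ('v \<Rightarrow> real) \<Rightarrow> bool" for L where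
  const: "poly_deg_le L d (\<lambda>x. c)"
| linear: "l \<in> L \<Longrightarrow> poly_deg_le L 1 l"
| add: "poly_deg_le L d P \<Longrightarrow> poly_deg_le L d Q \<Longrightarrow> poly_deg_le L d (\<lambda>x. P x + Q x)"
| mult: "poly_deg_le L d P \<Longrightarrow> poly_deg_le L e Q \<Longrightarrow> poly_deg_le L (d + e) (\<lambda>x. P x * Q x)"

text \<open>Here \<open>L\<close> is a set of real coordinates spanning the dual of the vector space containing \<open>v\<close>.\<close>

definition is_design ::
    "('v \<Rightarrow> 'v) set \<Rightarrow> 'v \<Rightarrow> ('v::topological_space \<Rightarrow> real) set \<Rightarrow> nat \<Rightarrow> 'v set \<Rightarrow> bool" where
  "is_design T v L d F \<longleftrightarrow>
     finite F \<and> F \<subseteq> orbit_of T v \<and>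
     (\<forall>P. poly_deg_le L d P \<longrightarrow>
        (\<integral>x. P x \<partial>haar_measure T v) = 1 / real (card F) * (\<Sum>p\<in>F. P p))"


section \<open>The torus of \<open>SO(2n)\<close>\<close>

text \<open>\<open>\<complex>\<^sup>n\<close> is the space of functions \<open>nat \<Rightarrow> complex\<close> vanishing outside \<open>{..<n}\<close>.\<close>

definition so_rot :: "nat \<Rightarrow> (nat \<Rightarrow> complex) \<Rightarrow> (nat \<Rightarrow> complex) \<Rightarrow> (nat \<Rightarrow> complex)" where
  "so_rot n z x = (\<lambda>i. if i < n then z i * x i else 0)"

definition so_torus :: "nat \<Rightarrow> ((nat \<Rightarrow> complex) \<Rightarrow> (nat \<Rightarrow> complex)) set" where
  "so_torus n = {so_rot n z | z. \<forall>i<n. cmod (z i) = 1}"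

definition so_base :: "nat \<Rightarrow> nat \<Rightarrow> complex" where
  "so_base n = (\<lambda>i. if i < n then 1 else 0)"

definition so_coords :: "nat \<Rightarrow> ((nat \<Rightarrow> complex) \<Rightarrow> real) set" where
  "so_coords n = (\<Union>i<n. {\<lambda>x. Re (x i), \<lambda>x. Im (x i)})"

definition so_design :: "nat \<Rightarrow> nat \<Rightarrow> (nat \<Rightarrow> complex) set \<Rightarrow> bool" where
  "so_design n d F \<longleftrightarrow> is_design (so_torus n) (so_base n) (so_coords n) d F"


section \<open>The torus of \<open>PSU(n+1)\<close>\<close>

text \<open>
  Matrices are functions \<open>nat \<Rightarrow> nat \<Rightarrow> complex\<close> vanishing outside \<open>{..n} \<times> {..n}\<close>, and \<open>psu_conj n z\<close> is
  conjugation by the diagonal unitary matrix with diagonal entries \<open>z 0, \<dots>, z n\<close>. Diagonal matrices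
  of determinant 1 that differ by a central element give the same transformation, so \<open>psu_torus n\<close>
  is the quotient by the center. The base point is the all-ones matrix; its orbit is faithful and
  consists of the matrices with entries \<open>z j * cnj (z k)\<close>.
\<close>

definition psu_conj ::
    "nat \<Rightarrow> (nat \<Rightarrow> complex) \<Rightarrow> (nat \<Rightarrow> nat \<Rightarrow> complex) \<Rightarrow> (nat \<Rightarrow> nat \<Rightarrow> complex)" where
  "psu_conj n z A = (\<lambda>j k. if j \<le> n \<and> k \<le> n then z j * A j k * cnj (z k) else 0)"

definition psu_torus :: "nat \<Rightarrow> ((nat \<Rightarrow> nat \<Rightarrow> complex) \<Rightarrow> (nat \<Rightarrow> nat \<Rightarrow> complex)) set" where
  "psu_torus n = {psu_conj n z | z. (\<forall>i\<le>n. cmod (z i) = 1) \<and> (\<Prod>i\<le>n. z i) = 1}"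

definition psu_base :: "nat \<Rightarrow> nat \<Rightarrow> nat \<Rightarrow> complex" where
  "psu_base n = (\<lambda>j k. if j \<le> n \<and> k \<le> n then 1 else 0)"

definition psu_coords :: "nat \<Rightarrow> ((nat \<Rightarrow> nat \<Rightarrow> complex) \<Rightarrow> real) set" where
  "psu_coords n = (\<Union>j\<le>n. \<Union>k\<le>n. {\<lambda>A. Re (A j k), \<lambda>A. Im (A j k)})"

definition psu_design :: "nat \<Rightarrow> nat \<Rightarrow> (nat \<Rightarrow> nat \<Rightarrow> complex) set \<Rightarrow> bool" where
  "psu_design n d F \<longleftrightarrow> is_design (psu_torus n) (psu_base n) (psu_coords n) d F"


section \<open>The orbits are faithful\<close>

lemma so_faithful: "inj_on (\<lambda>g. g (so_base n)) (so_torus n)"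
proof (rule inj_onI)
  fix g h assume "g \<in> so_torus n" "h \<in> so_torus n" and eq: "g (so_base n) = h (so_base n)"
  then obtain z w where g: "g = so_rot n z" and h: "h = so_rot n w"
    by (auto simp: so_torus_def)
  have "z i = w i" if "i < n" for i
    using fun_cong[OF eq, of i] that by (simp add: g h so_rot_def so_base_def)
  then show "g = h" by (auto simp: g h so_rot_def fun_eq_iff)
qed

lemma psu_faithful: "inj_on (\<lambda>g. g (psu_base n)) (psu_torus n)"
proof (rule inj_onI)
  fix g h assume "g \<in> psu_torus n" "h \<in> psu_torus n" and eq: "g (psu_base n) = h (psu_base n)"
  then obtain z w where g: "g = psu_conj n z" and h: "h = psu_conj n w"
    by (auto simp: psu_torus_def)
  have *: "z j * cnj (z k) = w j * cnj (w k)" if "j \<le> n" "k \<le> n" for j k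
    using fun_cong[OF fun_cong[OF eq, of j], of k] that by (simp add: g h psu_conj_def psu_base_def)
  have "z j * A * cnj (z k) = w j * A * cnj (w k)" if "j \<le> n" "k \<le> n" for j k A
    using *[OF that] by (metis mult.assoc mult.commute)
  then show "g = h" by (auto simp: g h psu_conj_def fun_eq_iff)
qed

lemma psu_conj_eq_iff_central:
  assumes "\<forall>i\<le>n. cmod (z i) = 1" "\<forall>i\<le>n. cmod (w i) = 1"
  shows "psu_conj n z = psu_conj n w \<longleftrightarrow> (\<exists>c. cmod c = 1 \<and> (\<forall>i\<le>n. w i = c * z i))"
proof
  assume eq: "psu_conj n z = psu_conj n w"
  have *: "z j * cnj (z k) = w j * cnj (w k)" if "j \<le> n" "k \<le> n" for j k
    using fun_cong[OF fun_cong[OF fun_cong[OF eq, of "psu_base n"], of j], of k] that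
    by (simp add: psu_conj_def psu_base_def)
  have u: "cnj (x i) * x i = 1" if "\<forall>i\<le>n. cmod (x i) = 1" "i \<le> n" for x and i
    using that complex_norm_square[of "x i"] by (simp add: mult.commute)
  define c where "c = w 0 * cnj (z 0)"
  have "w i = c * z i" if "i \<le> n" for i
  proof -
    have "c * z i = w 0 * (z i * cnj (z 0))" by (simp add: c_def)
    also have "\<dots> = w i * (cnj (w 0) * w 0)" using *[OF that, of 0] by simp
    finally show ?thesis using u[OF assms(2), of 0] by simp
  qed
  moreover have "cmod c = 1" using assms by (simp add: c_def norm_mult)
  ultimately show "\<exists>c. cmod c = 1 \<and> (\<forall>i\<le>n. w i = c * z i)" by blast
next
  assume "\<exists>c. cmod c = 1 \<and> (\<forall>i\<le>n. w i = c * z i)"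
  then obtain c where c: "cmod c = 1" "\<And>i. i \<le> n \<Longrightarrow> w i = c * z i" by blast
  have cc: "c * cnj c = 1" using complex_norm_square[of c] c(1) by simp
  have "c * z j * a * cnj (c * z k) = z j * a * cnj (z k)" for j k a
  proof -
    have "c * z j * a * cnj (c * z k) = (c * cnj c) * (z j * a * cnj (z k))" by simp
    then show ?thesis by (simp only: cc mult_1)
  qed
  then show "psu_conj n z = psu_conj n w" by (auto simp: psu_conj_def fun_eq_iff c)
qed


section \<open>Existence and uniqueness of Haar measure\<close>

lemma is_haar_unique:
  fixes T :: "('v::topological_space \<Rightarrow> 'v) set" and v :: 'v and m :: "'v \<Rightarrow> 'v \<Rightarrow> 'v"
  defines "B \<equiv> restrict_space borel (orbit_of T v)"
  assumes meas: "(\<lambda>(x, y). m x y) \<in> B \<Otimes>\<^sub>M B \<rightarrow>\<^sub>M B"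
    and comm: "\<And>x y. m x y = m y x"
    and trans: "\<And>x. x \<in> orbit_of T v \<Longrightarrow> \<exists>g\<in>T. \<forall>y\<in>orbit_of T v. g y = m x y"
    and M: "is_haar T v M" and N: "is_haar T v N"
  shows "M = N"
proof -
  interpret M: prob_space M using M by (simp add: is_haar_def)
  interpret N: prob_space N using N by (simp add: is_haar_def)
  interpret MN: pair_sigma_finite M N ..
  have sM [measurable_cong]: "sets M = sets B" and sN [measurable_cong]: "sets N = sets B"
    using M N by (simp_all add: is_haar_def B_def)
  have sp: "space M = orbit_of T v" "space N = orbit_of T v"
    using sets_eq_imp_space_eq[OF sM] sets_eq_imp_space_eq[OF sN]
    by (simp_all add: B_def space_restrict_space)
  note meas [measurable]
  have inv: "distr K K (m x) = K"
    if K: "is_haar T v K" and spK: "space K = orbit_of T v" and x: "x \<in> orbit_of T v" for K x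
  proof -
    obtain g where g: "g \<in> T" "\<forall>y\<in>orbit_of T v. g y = m x y" using trans[OF x] by blast
    have "distr K K (m x) = distr K K g"
      by (rule distr_cong) (use g spK in auto)
    then show ?thesis using K g by (simp add: is_haar_def)
  qed
  show ?thesis
  proof (rule measure_eqI)
    show "sets M = sets N" by (simp add: sM sN)
    fix A assume "A \<in> sets M"
    then have A [measurable]: "A \<in> sets B" by (simp add: sM)
    let ?f = "\<lambda>x y. indicator A (m x y) :: ennreal"
    have key: "(\<integral>\<^sup>+y. ?f x y \<partial>K) = emeasure K A"
      if K: "is_haar T v K" and x: "x \<in> orbit_of T v" for K x
    proof -
      have sK [measurable_cong]: "sets K = sets B" using K by (simp add: is_haar_def B_def)
      have spK: "space K = orbit_of T v"
        using sets_eq_imp_space_eq[OF sK] by (simp add: B_def space_restrict_space)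
      have xB: "x \<in> space B" using x by (simp add: B_def space_restrict_space)
      have mx [measurable]: "m x \<in> B \<rightarrow>\<^sub>M B"
        using measurable_compose[OF measurable_Pair1'[OF xB] meas] by simp
      have "(\<integral>\<^sup>+y. ?f x y \<partial>K) = (\<integral>\<^sup>+y. indicator A y \<partial>distr K K (m x))"
        by (subst nn_integral_distr) simp_all
      also have "\<dots> = emeasure K A" by (simp add: inv[OF K spK x])
      finally show ?thesis .
    qed
    have "emeasure M A = (\<integral>\<^sup>+x. emeasure M A \<partial>N)" by (simp add: N.emeasure_space_1)
    also have "\<dots> = (\<integral>\<^sup>+x. (\<integral>\<^sup>+y. ?f x y \<partial>M) \<partial>N)"
      by (rule nn_integral_cong) (simp add: key[OF M] sp)
    also have "\<dots> = (\<integral>\<^sup>+x. (\<integral>\<^sup>+y. ?f y x \<partial>M) \<partial>N)"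
      by (intro nn_integral_cong arg_cong[where f = "indicator A"] comm)
    also have "\<dots> = (\<integral>\<^sup>+y. (\<integral>\<^sup>+x. ?f y x \<partial>N) \<partial>M)"
    proof (rule MN.Fubini')
      show "case_prod ?f \<in> borel_measurable (M \<Otimes>\<^sub>M N)"
        using measurable_compose[OF meas borel_measurable_indicator[OF A]]
        by (simp add: split_beta sM sN cong: measurable_cong_sets sets_pair_measure_cong)
    qed
    also have "\<dots> = (\<integral>\<^sup>+y. emeasure N A \<partial>M)"
      by (rule nn_integral_cong) (simp add: key[OF N] sp)
    also have "\<dots> = emeasure N A" by (simp add: M.emeasure_space_1)
    finally show "emeasure M A = emeasure N A" .
  qed
qed

lemma is_haar_push:
  fixes T :: "('v::topological_space \<Rightarrow> 'v) set" and v :: 'v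
  defines "B \<equiv> restrict_space borel (orbit_of T v)"
  assumes W: "prob_space W"
    and f: "f \<in> W \<rightarrow>\<^sub>M B"
    and g: "\<And>g. g \<in> T \<Longrightarrow> g \<in> B \<rightarrow>\<^sub>M B \<and>
              (\<exists>r \<in> W \<rightarrow>\<^sub>M W. distr W W r = W \<and> (\<forall>w\<in>space W. g (f w) = f (r w)))"
  shows "is_haar T v (distr W B f)"
  unfolding is_haar_def
proof (intro conjI ballI)
  show "prob_space (distr W B f)" by (rule prob_space.prob_space_distr[OF W f])
  show "sets (distr W B f) = sets (restrict_space borel (orbit_of T v))" by (simp add: B_def)
  fix h assume "h \<in> T"
  from g[OF this] obtain r where h: "h \<in> B \<rightarrow>\<^sub>M B" and r: "r \<in> W \<rightarrow>\<^sub>M W" "distr W W r = W"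
    and e: "\<And>w. w \<in> space W \<Longrightarrow> h (f w) = f (r w)" by blast
  show "h \<in> distr W B f \<rightarrow>\<^sub>M distr W B f" using h by simp
  have "distr (distr W B f) (distr W B f) h = distr (distr W B f) B h"
    by (rule distr_cong) simp_all
  also have "\<dots> = distr W B (h \<circ> f)" by (rule distr_distr[OF h f])
  also have "\<dots> = distr W B (f \<circ> r)" by (rule distr_cong) (simp_all add: e)
  also have "\<dots> = distr (distr W W r) B f" by (rule distr_distr[OF f r(1), symmetric])
  finally show "distr (distr W B f) (distr W B f) h = distr W B f" by (simp add: r)
qed

definition circle_haar :: "complex measure" where
  "circle_haar = distr (restrict_space lborel {0..<1}) (restrict_space borel (sphere 0 1))
                   (\<lambda>x. cis (2 * pi * x))"

lemma sets_circle_haar [measurable_cong]: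
  "sets circle_haar = sets (restrict_space borel (sphere 0 1))"
  by (simp add: circle_haar_def)

lemma space_circle_haar: "space circle_haar = sphere 0 1"
  by (simp add: circle_haar_def space_restrict_space)

lemma cis_measurable [measurable]: "(\<lambda>x. cis (2 * pi * x)) \<in> borel_measurable borel"
  by (intro borel_measurable_continuous_onI continuous_intros)

lemma cis_measurable_circle:
  "(\<lambda>x. cis (2 * pi * x)) \<in> restrict_space lborel {0..<1} \<rightarrow>\<^sub>M restrict_space borel (sphere 0 1)"
  by (intro measurable_restrict_space2 measurable_restrict_space1) auto

lemma prob_space_circle_haar: "prob_space circle_haar"
  unfolding circle_haar_def
proof (rule prob_space.prob_space_distr[OF _ cis_measurable_circle])
  show "prob_space (restrict_space lborel {0..<1::real})"
    by (rule prob_spaceI) (simp add: emeasure_restrict_space space_restrict_space)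
qed

lemma nn_integral_circle_haar:
  assumes [measurable]: "A \<in> sets circle_haar"
  shows "emeasure circle_haar A = (\<integral>\<^sup>+x. indicator A (cis (2 * pi * x)) * indicator {0..<1} x \<partial>lborel)"
proof -
  have "emeasure circle_haar A = (\<integral>\<^sup>+z. indicator A z \<partial>circle_haar)"
    using assms by simp
  also have "\<dots> = (\<integral>\<^sup>+x. indicator A (cis (2 * pi * x)) \<partial>restrict_space lborel {0..<1})"
    unfolding circle_haar_def
    by (rule nn_integral_distr[OF cis_measurable_circle]) (use assms in \<open>simp add: sets_circle_haar\<close>)
  also have "\<dots> = (\<integral>\<^sup>+x. indicator A (cis (2 * pi * x)) * indicator {0..<1} x \<partial>lborel)"
    by (rule nn_integral_restrict_space) simp
  finally show ?thesis .
qed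

lemma circle_rot_measurable:
  assumes "cmod c = 1"
  shows "(\<lambda>z. c * z) \<in> circle_haar \<rightarrow>\<^sub>M circle_haar"
proof -
  have "(\<lambda>z. c * z) \<in> restrict_space borel (sphere 0 1) \<rightarrow>\<^sub>M restrict_space borel (sphere 0 1)"
    by (intro measurable_restrict_space2 measurable_restrict_space1)
       (use assms in \<open>auto simp: space_restrict_space norm_mult\<close>)
  then show ?thesis by (simp cong: measurable_cong_sets add: sets_circle_haar)
qed

lemma circle_haar_invariant:
  assumes c: "cmod c = 1"
  shows "distr circle_haar circle_haar (\<lambda>z. c * z) = circle_haar"
proof (rule measure_eqI)
  note cm = circle_rot_measurable[OF c]
  fix A assume "A \<in> sets (distr circle_haar circle_haar (\<lambda>z. c * z))"
  then have A: "A \<in> sets circle_haar" by simp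
  then have Ab [measurable]: "A \<in> sets borel"
    by (auto simp: sets_circle_haar sets_restrict_space)
  obtain b where b: "0 \<le> b" "b < 2 * pi" and cb: "c = cis b"
    using Arg2pi_ge_0[of c] Arg2pi_lt_2pi[of c] Arg2pi_eq[of c] c
    by (metis cis_conv_exp mult_1 of_real_1)
  define a where "a = b / (2 * pi)"
  have a: "0 \<le> a" "a < 1" "2 * pi * a = b" using b by (simp_all add: a_def)
  define f :: "real \<Rightarrow> ennreal" where "f = (\<lambda>x. indicator A (cis (2 * pi * x)))"
  have [measurable]: "f \<in> borel_measurable borel" unfolding f_def by measurable
  have per: "f (1 + x) = f x" for x
  proof -
    have "cis (2 * pi * (1 + x)) = cis (2 * pi) * cis (2 * pi * x)"
      by (simp add: cis_mult distrib_left del: cis_2pi)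
    then show ?thesis by (simp add: f_def)
  qed
  have shift: "(\<integral>\<^sup>+x. f x * indicator {t..<t + s} x \<partial>lborel)
               = (\<integral>\<^sup>+x. f (t + x) * indicator {0..<s} x \<partial>lborel)" for t s
    by (subst nn_integral_real_affine[where c=1 and t=t])
       (auto simp: indicator_def intro!: nn_integral_cong)
  have "emeasure (distr circle_haar circle_haar (\<lambda>z. c * z)) A
        = emeasure circle_haar ((\<lambda>z. c * z) -` A \<inter> space circle_haar)"
    by (rule emeasure_distr[OF cm A])
  also have "\<dots> = (\<integral>\<^sup>+x. indicator ((\<lambda>z. c * z) -` A \<inter> space circle_haar) (cis (2 * pi * x))
                        * indicator {0..<1} x \<partial>lborel)"
    by (rule nn_integral_circle_haar) (rule measurable_sets[OF cm A])
  also have "\<dots> = (\<integral>\<^sup>+x. f (a + x) * indicator {0..<1} x \<partial>lborel)"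
    by (rule nn_integral_cong)
       (auto simp: f_def space_circle_haar indicator_def cb cis_mult distrib_left a(3))
  also have "\<dots> = (\<integral>\<^sup>+x. f x * indicator {a..<a + 1} x \<partial>lborel)" by (rule shift[symmetric])
  also have "\<dots> = (\<integral>\<^sup>+x. f x * indicator {a..<1} x + f x * indicator {1..<1 + a} x \<partial>lborel)"
    using a by (intro nn_integral_cong) (auto simp: indicator_def)
  also have "\<dots> = (\<integral>\<^sup>+x. f x * indicator {a..<1} x \<partial>lborel) + (\<integral>\<^sup>+x. f x * indicator {1..<1 + a} x \<partial>lborel)"
    by (rule nn_integral_add) measurable
  also have "(\<integral>\<^sup>+x. f x * indicator {1..<1 + a} x \<partial>lborel) = (\<integral>\<^sup>+x. f x * indicator {0..<a} x \<partial>lborel)"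
    by (simp add: shift per)
  also have "(\<integral>\<^sup>+x. f x * indicator {a..<1} x \<partial>lborel) + \<dots>
             = (\<integral>\<^sup>+x. f x * indicator {a..<1} x + f x * indicator {0..<a} x \<partial>lborel)"
    by (rule nn_integral_add[symmetric]) measurable
  also have "\<dots> = (\<integral>\<^sup>+x. f x * indicator {0..<1} x \<partial>lborel)"
    using a by (intro nn_integral_cong) (auto simp: indicator_def)
  also have "\<dots> = emeasure circle_haar A"
    by (simp add: nn_integral_circle_haar[OF A] f_def)
  finally show "emeasure (distr circle_haar circle_haar (\<lambda>z. c * z)) A = emeasure circle_haar A" .
qed simp

lemma product_circle_haar:
  fixes z :: "nat \<Rightarrow> complex"
  assumes "\<And>i. i < n \<Longrightarrow> cmod (z i) = 1"
  defines "W \<equiv> PiM {..<n} (\<lambda>i. circle_haar)" and "r \<equiv> (\<lambda>w. \<lambda>i\<in>{..<n}. z i * w i)"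
  shows "r \<in> W \<rightarrow>\<^sub>M W" "distr W W r = W"
proof -
  interpret prob_space circle_haar by (rule prob_space_circle_haar)
  interpret product_sigma_finite "\<lambda>i::nat. circle_haar" ..
  have z: "(\<lambda>w. z i * w) \<in> circle_haar \<rightarrow>\<^sub>M circle_haar" if "i \<in> {..<n}" for i
    using circle_rot_measurable[of "z i"] assms(1) that by auto
  show r: "r \<in> W \<rightarrow>\<^sub>M W"
    unfolding r_def W_def
  proof (rule measurable_restrict)
    fix i assume "i \<in> {..<n}"
    then show "(\<lambda>w. z i * w i) \<in> PiM {..<n} (\<lambda>i. circle_haar) \<rightarrow>\<^sub>M circle_haar"
      using measurable_compose[OF measurable_component_singleton[of i "{..<n}" "\<lambda>i. circle_haar"] z]
      by simp
  qed
  show "distr W W r = W"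
    unfolding W_def
  proof (rule PiM_eqI)
    fix A :: "nat \<Rightarrow> complex set"
    assume A: "\<And>i. i \<in> {..<n} \<Longrightarrow> A i \<in> sets circle_haar"
    let ?V = "\<lambda>i. (\<lambda>w. z i * w) -` A i \<inter> space circle_haar"
    have V: "?V i \<in> sets circle_haar" if "i \<in> {..<n}" for i
      using measurable_sets[OF z A] that by blast
    have "emeasure (distr W W r) (Pi\<^sub>E {..<n} A) = emeasure W (r -` Pi\<^sub>E {..<n} A \<inter> space W)"
      by (rule emeasure_distr[OF r]) (auto simp: W_def intro!: sets_PiM_I_finite A)
    also have "r -` Pi\<^sub>E {..<n} A \<inter> space W = Pi\<^sub>E {..<n} ?V"
      by (auto simp: r_def W_def space_PiM PiE_iff)
    also have "emeasure W \<dots> = (\<Prod>i<n. emeasure circle_haar (?V i))"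
      unfolding W_def by (rule emeasure_PiM) (use V in auto)
    also have "\<dots> = (\<Prod>i<n. emeasure circle_haar (A i))"
    proof (rule prod.cong)
      fix i assume i: "i \<in> {..<n}"
      have "emeasure circle_haar (?V i) = emeasure (distr circle_haar circle_haar (\<lambda>w. z i * w)) (A i)"
        by (rule emeasure_distr[symmetric, OF z[OF i] A[OF i]])
      then show "emeasure circle_haar (?V i) = emeasure circle_haar (A i)"
        using circle_haar_invariant[of "z i"] assms(1) i by simp
    qed simp
    finally show "emeasure (distr (Pi\<^sub>M {..<n} (\<lambda>i. circle_haar)) (Pi\<^sub>M {..<n} (\<lambda>i. circle_haar)) r)
                    (Pi\<^sub>E {..<n} A) = (\<Prod>i<n. emeasure circle_haar (A i))"
      by (simp add: W_def)
  qed simp_all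
qed

lemma circle_component_measurable:
  assumes "i < n"
  shows "(\<lambda>w. w i) \<in> borel_measurable (PiM {..<n} (\<lambda>i. circle_haar))"
proof -
  have "(\<lambda>w. w i) \<in> PiM {..<n} (\<lambda>i. circle_haar) \<rightarrow>\<^sub>M circle_haar"
    by (rule measurable_component_singleton) (use assms in simp)
  moreover have "(\<lambda>z. z) \<in> borel_measurable circle_haar"
    by (simp cong: measurable_cong_sets add: sets_circle_haar measurable_restrict_space1)
  ultimately show ?thesis by (rule measurable_compose)
qed

lemma prob_space_product_circle: "prob_space (PiM {..<n::nat} (\<lambda>i. circle_haar))"
  by (rule prob_space_PiM) (rule prob_space_circle_haar)

lemma so_orbit: "orbit_of (so_torus n) (so_base n) = {x. (\<forall>i<n. cmod (x i) = 1) \<and> (\<forall>i\<ge>n. x i = 0)}"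
  (is "?L = ?R")
proof (intro equalityI subsetI)
  fix x assume "x \<in> ?R"
  then have "x = so_rot n x (so_base n)" "so_rot n x \<in> so_torus n"
    by (auto simp: so_rot_def so_base_def so_torus_def fun_eq_iff)
  then show "x \<in> ?L" unfolding orbit_of_def by blast
qed (auto simp: orbit_of_def so_torus_def so_rot_def so_base_def)

lemma psu_orbit_eq:
  "orbit_of (psu_torus n) (psu_base n) = 
     {A. \<exists>z. (\<forall>i\<le>n. cmod (z i) = 1) \<and> A = (\<lambda>j k. if j \<le> n \<and> k \<le> n then z j * cnj (z k) else 0)}"
  (is "?L = ?R")
proof (intro equalityI subsetI)
  fix A assume "A \<in> ?L"
  then show "A \<in> ?R"
    by (force simp: orbit_of_def psu_torus_def psu_conj_def psu_base_def fun_eq_iff)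
next
  fix A assume "A \<in> ?R"
  then obtain z where z: "\<forall>i\<le>n. cmod (z i) = 1"
    and A: "A = (\<lambda>j k. if j \<le> n \<and> k \<le> n then z j * cnj (z k) else 0)" by blast
  define p where "p = (\<Prod>i\<le>n. z i)"
  have p: "cmod p = 1" using z by (simp add: p_def prod_norm[symmetric])
  define c where "c = cis (- Arg p / real (Suc n))"
  have "c ^ Suc n = cis (- Arg p)" unfolding c_def Complex.DeMoivre
    by (rule arg_cong[where f = cis], simp only: times_divide_eq_right)
       (rule nonzero_mult_div_cancel_left, simp)
  moreover have "p = cis (Arg p)" using p by (metis cis_Arg norm_zero sgn_eq div_by_1 of_real_1 zero_neq_one)
  ultimately have cp: "c ^ Suc n * p = 1" by (metis add.left_inverse cis_mult cis_zero)
  define w where "w = (\<lambda>i. c * z i)"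
  have w: "\<forall>i\<le>n. cmod (w i) = 1" using z by (simp add: w_def norm_mult c_def)
  have "(\<Prod>i\<le>n. w i) = 1" using cp by (simp add: w_def prod.distrib p_def)
  then have "psu_conj n w \<in> psu_torus n" using w by (auto simp: psu_torus_def)
  moreover have "psu_conj n z = psu_conj n w"
    using psu_conj_eq_iff_central[OF z w] by (auto simp: w_def c_def intro!: exI[of _ c])
  moreover have "psu_conj n z (psu_base n) = A" by (auto simp: psu_conj_def psu_base_def A fun_eq_iff)
  ultimately show "A \<in> ?L" unfolding orbit_of_def by (metis (no_types) imageI)
qed

lemma psu_orbitI:
  assumes "\<forall>i\<le>n. cmod (z i) = 1"
  shows "(\<lambda>j k. if j \<le> n \<and> k \<le> n then z j * cnj (z k) else 0) \<in> orbit_of (psu_torus n) (psu_base n)"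
  unfolding psu_orbit_eq mem_Collect_eq by (intro exI[of _ z] conjI assms refl)

lemma so_haar_exists: "\<exists>M. is_haar (so_torus n) (so_base n) M"
proof -
  let ?W = "PiM {..<n} (\<lambda>i. circle_haar)"
  let ?f = "\<lambda>w i. if i < n then w i else (0::complex)"
  let ?B = "restrict_space borel (orbit_of (so_torus n) (so_base n))"
  have 1: "?f \<in> ?W \<rightarrow>\<^sub>M ?B"
  proof (rule measurable_restrict_space2)
    show "?f \<in> space ?W \<rightarrow> orbit_of (so_torus n) (so_base n)"
      by (auto simp: so_orbit space_PiM space_circle_haar PiE_iff)
    show "?f \<in> borel_measurable ?W"
    proof (rule measurable_coordinatewise_then_product)
      show "(\<lambda>w. ?f w i) \<in> borel_measurable ?W" for i
        by (cases "i < n") (simp_all add: circle_component_measurable)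
    qed
  qed
  have "is_haar (so_torus n) (so_base n) (distr ?W ?B ?f)"
  proof (rule is_haar_push[OF prob_space_product_circle 1])
    fix g assume "g \<in> so_torus n"
    then obtain z where g: "g = so_rot n z" and z: "\<And>i. i < n \<Longrightarrow> cmod (z i) = 1"
      by (auto simp: so_torus_def)
    have "g \<in> borel_measurable ?B"
    proof (rule measurable_coordinatewise_then_product)
      show "(\<lambda>x. g x i) \<in> borel_measurable ?B" for i
        by (cases "i < n") (auto simp: g so_rot_def intro!: measurable_restrict_space1)
    qed
    then have gB: "g \<in> ?B \<rightarrow>\<^sub>M ?B"
      by (rule measurable_restrict_space2[rotated])
         (auto simp: space_restrict_space so_orbit g so_rot_def norm_mult z)
    let ?r = "\<lambda>w. \<lambda>i\<in>{..<n}. z i * w i"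
    have "\<forall>w\<in>space ?W. g (?f w) = ?f (?r w)"
      by (auto simp: g so_rot_def fun_eq_iff)
    with product_circle_haar[of n z, OF z] gB
    show "g \<in> ?B \<rightarrow>\<^sub>M ?B \<and> (\<exists>r \<in> ?W \<rightarrow>\<^sub>M ?W. distr ?W ?W r = ?W \<and> (\<forall>w\<in>space ?W. g (?f w) = ?f (r w)))"
      by blast
  qed
  then show ?thesis by blast
qed

lemma psu_haar_exists: "\<exists>M. is_haar (psu_torus n) (psu_base n) M"
proof -
  let ?W = "PiM {..<Suc n} (\<lambda>i. circle_haar)"
  let ?f = "\<lambda>w j k. if j \<le> n \<and> k \<le> n then w j * cnj (w k) else (0::complex)"
  let ?B = "restrict_space borel (orbit_of (psu_torus n) (psu_base n))"
  have 1: "?f \<in> ?W \<rightarrow>\<^sub>M ?B"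
  proof (rule measurable_restrict_space2)
    show "?f \<in> space ?W \<rightarrow> orbit_of (psu_torus n) (psu_base n)"
    proof
      fix w assume "w \<in> space ?W"
      then have "\<forall>i\<le>n. cmod (w i) = 1" by (auto simp: space_PiM space_circle_haar PiE_iff)
      then show "?f w \<in> orbit_of (psu_torus n) (psu_base n)" by (rule psu_orbitI)
    qed
    show "?f \<in> borel_measurable ?W"
    proof (intro measurable_coordinatewise_then_product)
      fix j k
      have [measurable]: "cnj \<in> borel_measurable borel"
        by (intro borel_measurable_continuous_onI continuous_intros)
      show "(\<lambda>w. ?f w j k) \<in> borel_measurable ?W"
      proof (cases "j \<le> n \<and> k \<le> n")
        case True
        then have [measurable]: "(\<lambda>w. w j) \<in> borel_measurable ?W" "(\<lambda>w. w k) \<in> borel_measurable ?W"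
          using circle_component_measurable[of _ "Suc n"] by simp_all
        have "(\<lambda>w. w j * cnj (w k)) \<in> borel_measurable ?W" by measurable
        with True show ?thesis by simp
      qed auto
    qed
  qed
  have "is_haar (psu_torus n) (psu_base n) (distr ?W ?B ?f)"
  proof (rule is_haar_push[OF prob_space_product_circle 1])
    fix g assume "g \<in> psu_torus n"
    then obtain z where g: "g = psu_conj n z" and z: "\<And>i. i \<le> n \<Longrightarrow> cmod (z i) = 1"
      by (auto simp: psu_torus_def)
    have g1: "g \<in> borel_measurable ?B"
    proof (intro measurable_coordinatewise_then_product)
      fix j k
      have "(\<lambda>A :: nat \<Rightarrow> nat \<Rightarrow> complex. A j k) \<in> borel_measurable borel"
        by (rule measurable_compose[OF measurable_product_coordinates measurable_product_coordinates])
      then show "(\<lambda>x. g x j k) \<in> borel_measurable ?B"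
        by (cases "j \<le> n \<and> k \<le> n") (auto simp: g psu_conj_def intro!: measurable_restrict_space1)
    qed
    have g2: "g \<in> space ?B \<rightarrow> orbit_of (psu_torus n) (psu_base n)"
    proof
      fix A assume "A \<in> space ?B"
      then obtain w where w: "\<forall>i\<le>n. cmod (w i) = 1" and A: "A = ?f w"
        by (auto simp: space_restrict_space psu_orbit_eq)
      have "g A = ?f (\<lambda>i. z i * w i)"
        by (auto simp: g psu_conj_def A fun_eq_iff)
      moreover have "\<forall>i\<le>n. cmod (z i * w i) = 1" using w z by (simp add: norm_mult)
      ultimately show "g A \<in> orbit_of (psu_torus n) (psu_base n)"
        by (simp only: psu_orbitI[of n "\<lambda>i. z i * w i"])
    qed
    have gB: "g \<in> ?B \<rightarrow>\<^sub>M ?B" by (rule measurable_restrict_space2[OF g2 g1])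
    let ?r = "\<lambda>w. \<lambda>i\<in>{..<Suc n}. z i * w i"
    have "\<forall>w\<in>space ?W. g (?f w) = ?f (?r w)"
      by (auto simp: g psu_conj_def fun_eq_iff less_Suc_eq_le)
    moreover have "?r \<in> ?W \<rightarrow>\<^sub>M ?W" "distr ?W ?W ?r = ?W"
      using product_circle_haar[of "Suc n" z] z by simp_all
    ultimately
    show "g \<in> ?B \<rightarrow>\<^sub>M ?B \<and> (\<exists>r \<in> ?W \<rightarrow>\<^sub>M ?W. distr ?W ?W r = ?W \<and> (\<forall>w\<in>space ?W. g (?f w) = ?f (r w)))"
      using gB by blast
  qed
  then show ?thesis by blast
qed

lemma so_haar: "is_haar (so_torus n) (so_base n) (haar_measure (so_torus n) (so_base n))"
proof -
  let ?X = "orbit_of (so_torus n) (so_base n)"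
  let ?B = "restrict_space borel ?X"
  let ?m = "\<lambda>x y (i::nat). x i * y i :: complex"
  have c [measurable]: "(\<lambda>x. x i) \<in> borel_measurable ?B" for i
    by (rule measurable_restrict_space1) simp
  have "(\<lambda>(x, y). ?m x y) \<in> borel_measurable (?B \<Otimes>\<^sub>M ?B)"
    by (rule measurable_coordinatewise_then_product) (simp add: split_beta)
  then have m: "(\<lambda>(x, y). ?m x y) \<in> ?B \<Otimes>\<^sub>M ?B \<rightarrow>\<^sub>M ?B"
    by (rule measurable_restrict_space2[rotated])
       (auto simp: space_pair_measure space_restrict_space so_orbit norm_mult)
  have tr: "\<exists>g\<in>so_torus n. \<forall>y\<in>?X. g y = ?m x y" if "x \<in> ?X" for x
  proof -
    have "\<forall>i<n. cmod (x i) = 1" using that by (simp add: so_orbit)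
    then have "so_rot n x \<in> so_torus n" unfolding so_torus_def by blast
    moreover have "\<forall>y\<in>?X. so_rot n x y = ?m x y" by (auto simp: so_orbit so_rot_def fun_eq_iff)
    ultimately show ?thesis by blast
  qed
  have "M = N" if "is_haar (so_torus n) (so_base n) M" "is_haar (so_torus n) (so_base n) N" for M N
    by (rule is_haar_unique[OF m _ tr that]) (simp_all add: mult.commute)
  with so_haar_exists[of n] have "\<exists>!M. is_haar (so_torus n) (so_base n) M" by blast
  then show ?thesis unfolding haar_measure_def by (rule theI')
qed

lemma psu_haar: "is_haar (psu_torus n) (psu_base n) (haar_measure (psu_torus n) (psu_base n))"
proof -
  let ?X = "orbit_of (psu_torus n) (psu_base n)"
  let ?B = "restrict_space borel ?X"
  let ?m = "\<lambda>x y (j::nat) (k::nat). x j k * y j k :: complex"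
  have tr: "\<exists>g\<in>psu_torus n. \<forall>y. (\<forall>j k. \<not> (j \<le> n \<and> k \<le> n) \<longrightarrow> y j k = 0) \<longrightarrow> g y = ?m x y" if x: "x \<in> ?X" for x
  proof -
    obtain z where z: "psu_conj n z \<in> psu_torus n" "x = psu_conj n z (psu_base n)"
      using x by (auto simp: orbit_of_def psu_torus_def)
    have "psu_conj n z y = ?m x y" if "\<forall>j k. \<not> (j \<le> n \<and> k \<le> n) \<longrightarrow> y j k = 0" for y
      using that by (auto simp: z(2) psu_conj_def psu_base_def fun_eq_iff)
    with z(1) show ?thesis by blast
  qed
  have supp: "\<forall>j k. \<not> (j \<le> n \<and> k \<le> n) \<longrightarrow> y j k = 0" if "y \<in> ?X" for y
    using that by (auto simp: psu_orbit_eq)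
  have cl: "?m x y \<in> ?X" if "x \<in> ?X" "y \<in> ?X" for x y
  proof -
    from that(1)[unfolded psu_orbit_eq mem_Collect_eq] obtain z where z: "\<forall>i\<le>n. cmod (z i) = 1"
      and x: "x = (\<lambda>j k. if j \<le> n \<and> k \<le> n then z j * cnj (z k) else 0)"
      by (elim exE conjE) (rule that)
    from that(2)[unfolded psu_orbit_eq mem_Collect_eq] obtain w where w: "\<forall>i\<le>n. cmod (w i) = 1"
      and y: "y = (\<lambda>j k. if j \<le> n \<and> k \<le> n then w j * cnj (w k) else 0)"
      by (elim exE conjE) (rule that)
    have "?m x y = (\<lambda>j k. if j \<le> n \<and> k \<le> n then (z j * w j) * cnj (z k * w k) else 0)"
      by (auto simp: x y fun_eq_iff)
    moreover have "\<forall>i\<le>n. cmod (z i * w i) = 1" using z w by (simp add: norm_mult)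
    ultimately show ?thesis by (simp only: psu_orbitI[of n "\<lambda>i. z i * w i"])
  qed
  have c [measurable]: "(\<lambda>x. x j k) \<in> borel_measurable ?B" for j k
    by (rule measurable_restrict_space1)
       (rule measurable_compose[OF measurable_product_coordinates measurable_product_coordinates])
  have "(\<lambda>(x, y). ?m x y) \<in> borel_measurable (?B \<Otimes>\<^sub>M ?B)"
    by (intro measurable_coordinatewise_then_product) (simp add: split_beta)
  then have m: "(\<lambda>(x, y). ?m x y) \<in> ?B \<Otimes>\<^sub>M ?B \<rightarrow>\<^sub>M ?B"
    by (rule measurable_restrict_space2[rotated])
       (auto simp: space_pair_measure space_restrict_space intro: cl)
  have tr': "\<exists>g\<in>psu_torus n. \<forall>y\<in>?X. g y = ?m x y" if "x \<in> ?X" for x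
  proof -
    from tr[OF that] obtain g where g: "g \<in> psu_torus n"
      "\<forall>y. (\<forall>j k. \<not> (j \<le> n \<and> k \<le> n) \<longrightarrow> y j k = 0) \<longrightarrow> g y = ?m x y"
      by (elim bexE) (rule that)
    show ?thesis
    proof (intro bexI[OF _ g(1)] ballI)
      fix y assume "y \<in> ?X"
      then show "g y = ?m x y" using supp by (intro g(2)[rule_format]) simp
    qed
  qed
  have "M = N" if "is_haar (psu_torus n) (psu_base n) M" "is_haar (psu_torus n) (psu_base n) N" for M N
    by (rule is_haar_unique[OF m _ tr' that]) (simp_all add: mult.commute)
  with psu_haar_exists[of n] have "\<exists>!M. is_haar (psu_torus n) (psu_base n) M" by blast
  then show ?thesis unfolding haar_measure_def by (rule theI')
qed

end

theory Submission
  imports Defs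
    "HOL-Complex_Analysis.Complex_Analysis"
    "HOL-Number_Theory.Prime_Powers"
    "HOL-Number_Theory.Cong"
    "HOL-Real_Asymp.Real_Asymp"
begin

text \<open>
  A finite subgroup of the torus averages every character to 0 or 1, so it is a \<open>d\<close>-design as soon as
  no nontrivial character of degree at most \<open>d\<close> is trivial on it. Take a prime \<open>p\<close> and the subgroup of
  the points with coordinates \<open>exp (2 pi i f(x) / p)\<close>, where \<open>x\<close> runs through residues that label the
  coordinates and \<open>f\<close> through the polynomials over the field with \<open>p\<close> elements with exponents
  \<open>1, 3, \<dots>, 2 t - 1\<close> for \<open>SO(2n)\<close> and \<open>1, 2, \<dots>, t\<close> for \<open>PSU(n+1)\<close>. A character that is trivial on this
  subgroup gives two small multisets of residues with the same power sums, and by Newton's identities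
  these multisets agree. The subgroup has \<open>p ^ t\<close> elements; adjoining \<open>-1\<close> kills the characters of odd
  degree.

  Since \<open>p\<close> has to exceed \<open>2 n\<close> (or \<open>n\<close>) by a factor \<open>1 + o(1)\<close>, the count needs primes in the intervals
  \<open>[x, (1 + \<epsilon>) x]\<close>. These come from the nonvanishing of the zeta function on the line \<open>Re s = 1\<close>: smooth
  the von Mangoldt function on a logarithmic scale with a kernel that has compactly supported Fourier
  transform, has positive integral, and is nonpositive outside a bounded window.
\<close>

section \<open>The zeta function on the line \<open>Re s = 1\<close>\<close>

text \<open>Two multisets of equal size at most \<open>r < p\<close> are determined mod
  \<open>p\<close> by \<open>r\<close> power sums. For \<open>SO(2n)\<close> a character of degree
  at most \<open>2 t\<close> is given by its coordinates \<open>A\<close> and conjugated coordinates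
  \<open>B\<close>. Labelling conjugates by negative residues, one compares \<open>A\<close> joined
  with \<open>-B\<close> against \<open>B\<close> joined with \<open>-A\<close>: sizes at most
  \<open>2 t\<close>, but half of the power sums agree for free, so \<open>t\<close> parameters
  suffice. For \<open>PSU(n+1)\<close> every matrix entry puts one label on each side, so the sizes
  are equal and at most \<open>t\<close>.

  The constant in the count rests on gaps between primes. A kernel and its Fourier transform cannot
  both have compact support. Keeping it on the frequency side means that only a bounded segment of
  \<open>Re s = 1\<close> enters, where continuity and smoothness of the logarithmic derivative are
  enough. On the other side a sign condition replaces support: terms outside the window can only
  lower the smoothed sum. Rescaling by \<open>la\<close> shrinks the window to
  \<open>40 / la\<close>; the pole still contributes about \<open>1 / la\<close> or more, and for
  fixed \<open>la\<close> the rest tends to 0 as the center of the window moves to infinity.\<close>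

definition zeta_term :: "nat \<Rightarrow> complex \<Rightarrow> complex" where
  "zeta_term n s = (s - 1) * of_nat (Suc n) powr (-s)
     + of_nat (Suc (Suc n)) powr (1 - s) - of_nat (Suc n) powr (1 - s)"

text \<open>\<open>scaled_zeta s\<close> is \<open>(s - 1) * \<zeta>(s)\<close>: for \<open>Re s > 1\<close> the terms telescope, and each
  is a first-order Taylor remainder of \<open>x \<mapsto> x powr (1 - s)\<close>, which gives convergence for \<open>Re s > 0\<close>.\<close>

definition scaled_zeta :: "complex \<Rightarrow> complex" where
  "scaled_zeta s = 1 + (\<Sum>n. zeta_term n s)"

lemma summable_Suc_powr: "a < -1 \<Longrightarrow> summable (\<lambda>n. real (Suc n) powr a)"
  using summable_Suc_iff[of "\<lambda>n. real n powr a"] summable_real_powr_iff[of a] by simp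

lemma norm_of_nat_powr: "norm (of_nat n powr s :: complex) = real n powr Re s"
  using norm_powr_real_powr[of "of_nat n" s] by simp

text \<open>The second derivative of \<open>x powr (1 - s)\<close> is
  \<open>(1 - s) * (-s) * x powr (-s - 1)\<close>; its modulus decreases along the segment, so the
  left end point controls the Taylor remainder.\<close>

lemma norm_zeta_term_le:
  assumes s: "Re s > 0"
  shows "norm (zeta_term n s) \<le> norm (s - 1) * norm s * real (Suc n) powr (- Re s - 1)"
proof -
  define S where "S = closed_segment (of_nat (Suc n)) (of_nat (Suc (Suc n)) :: complex)"
  define f :: "nat \<Rightarrow> complex \<Rightarrow> complex" where "f = (\<lambda>i z.
     if i = 0 then z powr (1 - s) else if i = 1 then (1 - s) * z powr (-s)
     else (1 - s) * (-s) * z powr (-s - 1))"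
  have S: "\<exists>x. z = of_real x \<and> x \<ge> real (Suc n)" if "z \<in> S" for z
  proof -
    have "S = of_real ` closed_segment (real (Suc n)) (real (Suc (Suc n)))"
      unfolding S_def closed_segment_of_real[symmetric] by (simp only: of_real_of_nat_eq)
    then show ?thesis using that by (auto simp: closed_segment_eq_real_ivl)
  qed
  have "norm (f 0 (of_nat (Suc (Suc n))) - (\<Sum>i\<le>1. f i (of_nat (Suc n)) * (of_nat (Suc (Suc n)) - of_nat (Suc n)) ^ i / fact i))
        \<le> norm (s - 1) * norm s * real (Suc n) powr (- Re s - 1) * norm (of_nat (Suc (Suc n)) - of_nat (Suc n) :: complex) ^ Suc 1 / fact 1"
  proof (rule field_Taylor[where S = S])
    show "convex S" by (simp add: S_def)
    show "of_nat (Suc n) \<in> S" "of_nat (Suc (Suc n)) \<in> S" by (simp_all add: S_def del: of_nat_Suc)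
    fix z assume z: "z \<in> S"
    then obtain x where x: "z = of_real x" "x \<ge> real (Suc n)" using S by blast
    have "x > 0" using x(2) by simp
    have znp: "z \<notin> \<real>\<^sub>\<le>\<^sub>0" using \<open>x > 0\<close> by (simp add: x(1))
    show "(f i has_field_derivative f (Suc i) z) (at z within S)" if "i \<le> 1" for i
    proof -
      have "i = 0 \<or> i = 1" using that by linarith
      then show ?thesis
      proof
        assume "i = 0"
        moreover have "((\<lambda>z. z powr (1 - s)) has_field_derivative (1 - s) * z powr (1 - s - 1)) (at z within S)"
          by (rule has_field_derivative_at_within) (rule has_field_derivative_powr[OF znp])
        ultimately show ?thesis by (simp add: f_def)
      next
        assume "i = 1"
        moreover have "((\<lambda>z. (1 - s) * z powr (-s)) has_field_derivative (1 - s) * (-s * z powr (-s - 1))) (at z within S)"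
          by (rule DERIV_cmult, rule has_field_derivative_at_within, rule has_field_derivative_powr[OF znp])
        ultimately show ?thesis by (simp add: f_def mult.assoc)
      qed
    qed
    have "norm (f (Suc 1) z) = norm (s - 1) * norm s * x powr (- Re s - 1)"
      using \<open>x > 0\<close> by (simp add: f_def norm_mult x(1) norm_powr_real_powr norm_minus_commute)
    also have "x powr (- Re s - 1) \<le> real (Suc n) powr (- Re s - 1)"
      using x(2) s by (intro powr_mono2') auto
    finally show "norm (f (Suc 1) z) \<le> norm (s - 1) * norm s * real (Suc n) powr (- Re s - 1)"
      by (simp add: mult_left_mono)
  qed
  then show ?thesis by (simp add: f_def zeta_term_def algebra_simps)
qed

lemma scaled_zeta_holomorphic: "scaled_zeta holomorphic_on {s. Re s > 0}"
  and zeta_term_sums: "Re s > 0 \<Longrightarrow> (\<lambda>n. zeta_term n s) sums (scaled_zeta s - 1)"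
proof -
  let ?S = "{s. Re s > 0}"
  have o: "open ?S" by (rule open_halfspace_Re_gt)
  have "\<exists>g g'. \<forall>x \<in> ?S. ((\<lambda>n. zeta_term n x) sums g x) \<and> ((\<lambda>n. deriv (zeta_term n) x) sums g' x) \<and> (g has_field_derivative g' x) (at x)"
  proof (rule series_and_derivative_comparison_complex[OF o])
    fix n x assume "x \<in> ?S"
    have "zeta_term n holomorphic_on UNIV" unfolding zeta_term_def
      by (intro holomorphic_intros) (simp_all del: of_nat_Suc)
    then show "(zeta_term n has_field_derivative deriv (zeta_term n) x) (at x)"
      by (rule holomorphic_derivI) auto
  next
    fix x :: complex assume "x \<in> ?S"
    \<comment> \<open>On a ball of radius half of \<open>Re x\<close> one has
      \<open>Re y >= a\<close>, which leaves the summable exponent \<open>- a - 1\<close>.\<close>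
    define a where "a = Re x / 2"
    have a: "a > 0" using \<open>x \<in> ?S\<close> by (simp add: a_def)
    define R where "R = norm x + a"
    define h where "h = (\<lambda>n. complex_of_real ((R + 1) * R * real (Suc n) powr (- a - 1)))"
    have R: "R \<ge> 0" using a by (simp add: R_def)
    have "\<forall>y\<in>ball x a \<inter> ?S. cmod (zeta_term n y) \<le> cmod (h n)" for n
    proof
      fix y assume y: "y \<in> ball x a \<inter> ?S"
      have d: "norm (x - y) < a" using y by (simp add: dist_norm)
      have 1: "Re y \<ge> a" using d abs_Re_le_cmod[of "x - y"] by (simp add: a_def)
      have 2: "norm y \<le> R" using d norm_triangle_sub[of y x] by (simp add: R_def norm_minus_commute)
      have 3: "norm (y - 1) \<le> R + 1" using 2 norm_triangle_ineq4[of y 1] by simp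
      have "cmod (zeta_term n y) \<le> norm (y - 1) * norm y * real (Suc n) powr (- Re y - 1)"
        by (rule norm_zeta_term_le) (use y in simp)
      also have "\<dots> \<le> (R + 1) * R * real (Suc n) powr (- a - 1)"
        using 1 2 3 R by (intro mult_mono powr_mono) auto
      also have "\<dots> = cmod (h n)" using R by (simp add: h_def norm_mult)
      finally show "cmod (zeta_term n y) \<le> cmod (h n)" .
    qed
    moreover have "summable h" unfolding h_def
      using a by (intro summable_of_real summable_mult summable_Suc_powr) simp
    moreover have "range h \<subseteq> \<real>\<^sub>\<ge>\<^sub>0" using R by (auto simp: h_def simp del: of_real_mult)
    ultimately show "\<exists>d h. 0 < d \<and> summable h \<and> range h \<subseteq> \<real>\<^sub>\<ge>\<^sub>0 \<and> (\<forall>\<^sub>F n in sequentially. \<forall>y\<in>ball x d \<inter> ?S. cmod (zeta_term n y) \<le> cmod (h n))"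
      using a by (intro exI[of _ a] exI[of _ h]) auto
  qed
  then obtain g g' where g: "\<And>x. x \<in> ?S \<Longrightarrow> ((\<lambda>n. zeta_term n x) sums g x)"
    and g': "\<And>x. x \<in> ?S \<Longrightarrow> (g has_field_derivative g' x) (at x)" by blast
  have gz: "scaled_zeta x = 1 + g x" if "x \<in> ?S" for x
    using sums_unique[OF g[OF that]] by (simp add: scaled_zeta_def)
  show "Re s > 0 \<Longrightarrow> (\<lambda>n. zeta_term n s) sums (scaled_zeta s - 1)"
    using g[of s] gz[of s] by simp
  have "(\<lambda>x. 1 + g x) holomorphic_on ?S"
    using g' o by (intro holomorphic_intros) (auto simp: holomorphic_on_open)
  then show "scaled_zeta holomorphic_on ?S" by (rule holomorphic_transform) (simp add: gz)
qed

lemma scaled_zeta_1 [simp]: "scaled_zeta 1 = 1"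
proof -
  have "zeta_term n 1 = 0" for n by (simp add: zeta_term_def del: of_nat_Suc)
  then show ?thesis by (simp add: scaled_zeta_def)
qed

section \<open>Dirichlet series of zeta and of the von Mangoldt function on
  \<open>Re s > 1\<close>\<close>

definition dir_zeta :: "complex \<Rightarrow> complex" where
  "dir_zeta s = (\<Sum>n. of_nat (Suc n) powr (-s))"

lemma dir_zeta_sums: 
  assumes "Re s > 1"
  shows "(\<lambda>n. of_nat (Suc n) powr (-s)) sums dir_zeta s"
proof -
  have "summable (\<lambda>n. norm (of_nat (Suc n) powr (-s) :: complex))"
    unfolding norm_of_nat_powr using assms by (intro summable_Suc_powr) simp
  then show ?thesis unfolding dir_zeta_def by (rule summable_sums[OF summable_norm_cancel])
qed

lemma scaled_zeta_eq:
  assumes s: "Re s > 1"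
  shows "scaled_zeta s = (s - 1) * dir_zeta s"
proof -
  have "(\<lambda>n. of_nat (Suc n) powr (1 - s) :: complex) \<longlonglongrightarrow> 0"
  proof (rule tendsto_norm_zero_cancel)
    have "((\<lambda>x::real. x powr Re (1 - s)) \<longlongrightarrow> 0) at_top" 
      using s by (intro tendsto_neg_powr filterlim_ident) auto
    then have "(\<lambda>n. real (Suc n) powr Re (1 - s)) \<longlonglongrightarrow> 0"
      by (rule filterlim_compose) (rule filterlim_compose[OF filterlim_real_sequentially filterlim_Suc])
    then show "(\<lambda>n. norm (of_nat (Suc n) powr (1 - s) :: complex)) \<longlonglongrightarrow> 0"
      unfolding norm_of_nat_powr .
  qed
  \<comment> \<open>The telescoped differences sum to \<open>-1\<close>, which cancels the leading
    \<open>1\<close> of \<open>scaled_zeta\<close>.\<close>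
  from telescope_sums[OF this]
  have "(\<lambda>n. of_nat (Suc (Suc n)) powr (1 - s) - of_nat (Suc n) powr (1 - s) :: complex) sums (-1)" by simp
  from sums_add[OF sums_mult[OF dir_zeta_sums[OF s], of "s - 1"] this]
  have "(\<lambda>n. zeta_term n s) sums ((s - 1) * dir_zeta s + -1)"
    by (simp add: zeta_term_def algebra_simps del: of_nat_Suc)
  moreover have "(\<lambda>n. zeta_term n s) sums (scaled_zeta s - 1)" using s by (intro zeta_term_sums) simp
  ultimately have "(s - 1) * dir_zeta s + -1 = scaled_zeta s - 1" by (rule sums_unique2)
  then show ?thesis by simp
qed

text \<open>Absolute convergence allows the pairs \<open>(a, b)\<close> to be regrouped by
  \<open>n = a * b\<close>; unordered sums make this a reindexing by
  \<open>(a * b, a)\<close>.\<close>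

lemma has_sum_dirichlet_product:
  fixes f g :: "nat \<Rightarrow> complex"
  assumes f: "(\<lambda>n. norm (f n)) summable_on {0<..}" and g: "(\<lambda>n. norm (g n)) summable_on {0<..}"
    and S: "(f has_sum S) {0<..}" and T: "(g has_sum T) {0<..}"
  shows "((\<lambda>n. \<Sum>d | d dvd n. f d * g (n div d)) has_sum (S * T)) {0<..}"
proof -
  let ?N = "{0<..} :: nat set"
  have s: "(\<lambda>(a, b). f a * g b) summable_on ?N \<times> ?N"
  proof (rule abs_summable_summable)
    show "(\<lambda>x. norm ((\<lambda>(a, b). f a * g b) x)) summable_on ?N \<times> ?N"
      unfolding Infinite_Sum.abs_summable_on_Sigma_iff
      using f g by (auto simp: norm_mult abs_mult infsum_cmult_right' infsum_nonneg
          intro!: summable_on_cmult_right summable_on_cmult_left)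
  qed
  then obtain X where X: "((\<lambda>(a, b). f a * g b) has_sum X) (?N \<times> ?N)" by (auto simp: summable_on_def)
  have "((\<lambda>a. f a * T) has_sum X) ?N"
    by (rule has_sum_SigmaD[OF X]) (auto intro!: has_sum_cmult_right T)
  moreover have "((\<lambda>a. f a * T) has_sum (S * T)) ?N" by (rule has_sum_cmult_left[OF S])
  ultimately have XST: "X = S * T" using has_sum_unique by blast
  have "((\<lambda>(n, d). f d * g (n div d)) has_sum X) (Sigma ?N (\<lambda>n. {d. d dvd n}))"
    by (subst has_sum_reindex_bij_witness[of _ "\<lambda>(a, b). (a * b, a)" "\<lambda>(n, d). (d, n div d)" "?N \<times> ?N", where h = "\<lambda>(a, b). f a * g b" and s' = X])
       (use X in \<open>auto simp: div_greater_zero_iff dvd_imp_le dest: dvd_pos_nat\<close>)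
  then have "((\<lambda>n. \<Sum>d | d dvd n. f d * g (n div d)) has_sum X) ?N"
  proof (rule has_sum_SigmaD)
    fix n :: nat assume "n \<in> ?N"
    then show "((\<lambda>y. case (n, y) of (n, d) \<Rightarrow> f d * g (n div d)) has_sum (\<Sum>d | d dvd n. f d * g (n div d))) {d. d dvd n}"
      by (auto intro!: has_sum_finite)
  qed
  then show ?thesis by (simp add: XST)
qed

definition dir_mangoldt :: "complex \<Rightarrow> complex" where
  "dir_mangoldt s = (\<Sum>n. mangoldt n * of_nat n powr (-s))"

lemma ln_le_powr: "0 < a \<Longrightarrow> 0 < x \<Longrightarrow> ln x \<le> x powr a / (a::real)"
  using ln_le_minus_one[of "x powr a"] by (simp add: ln_powr field_simps)

lemma summable_ln_powr:
  assumes "a > 1"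
  shows "summable (\<lambda>n. ln (real n) * real n powr (-a))"
proof (rule summable_comparison_test)
  define e where "e = (a - 1) / 2"
  have e: "e > 0" using assms by (simp add: e_def)
  show "summable (\<lambda>n. real n powr (e - a) / e)"
    using assms by (intro summable_divide) (simp add: summable_real_powr_iff e_def field_simps)
  have "ln (real n) * real n powr (-a) \<le> real n powr (e - a) / e" if "n \<ge> 1" for n
  proof -
    have "ln (real n) * real n powr (-a) \<le> real n powr e / e * real n powr (-a)"
      using e that by (intro mult_right_mono ln_le_powr) auto
    then show ?thesis by (simp add: powr_diff powr_minus field_simps)
  qed
  then show "\<exists>N. \<forall>n\<ge>N. norm (ln (real n) * real n powr (-a)) \<le> real n powr (e - a) / e"
    by (intro exI[of _ 1]) auto
qed

lemma summable_mangoldt_powr: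
  assumes "a > 1"
  shows "summable (\<lambda>n. mangoldt n * real n powr (-a))"
proof (rule summable_comparison_test[OF _ summable_ln_powr[OF assms]])
  have "mangoldt n * real n powr (-a) \<le> ln (real n) * real n powr (-a)" if "n \<ge> 1" for n
    using mangoldt_le[of n] that by (intro mult_right_mono) auto
  then show "\<exists>N. \<forall>n\<ge>N. norm (mangoldt n * real n powr (-a)) \<le> ln (real n) * real n powr (-a)"
    by (intro exI[of _ 1]) (auto simp: mangoldt_nonneg)
qed

lemma summable_dir_mangoldt:
  assumes "Re s > 1"
  shows "summable (\<lambda>n. norm (mangoldt n * of_nat n powr (-s) :: complex))"
  using summable_mangoldt_powr[OF assms] by (simp add: norm_mult norm_of_nat_powr)

lemma has_sum_positive_nats:
  fixes f :: "nat \<Rightarrow> complex"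
  assumes "summable (\<lambda>n. norm (f n))" "f 0 = 0"
  shows "(\<lambda>n. norm (f n)) summable_on {0<..}" "(f has_sum (\<Sum>n. f n)) {0<..}"
proof -
  have s: "f sums (\<Sum>n. f n)" using assms(1) by (rule summable_sums[OF summable_norm_cancel])
  have "(\<lambda>n. norm (f n)) summable_on UNIV" using assms(1) by (simp add: summable_on_UNIV_nonneg_real_iff)
  then show "(\<lambda>n. norm (f n)) summable_on {0<..}" by (rule summable_on_subset_banach) simp
  have "(f has_sum (\<Sum>n. f n)) UNIV" by (rule norm_summable_imp_has_sum[OF assms(1) s])
  then show "(f has_sum (\<Sum>n. f n)) {0<..}"
    by (rule has_sum_cong_neutral[THEN iffD1, rotated 3]) (use assms(2) in auto)
qed

text \<open>Summing \<open>mangoldt\<close> over the divisors of \<open>n\<close> gives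
  \<open>ln n\<close>. Hence the Dirichlet product of the two series has coefficients
  \<open>ln n\<close>, which up to sign is the termwise derivative of zeta.\<close>

lemma dir_zeta_deriv:
  assumes s: "Re s > 1"
  shows "(dir_zeta has_field_derivative - (dir_mangoldt s * dir_zeta s)) (at s)"
proof -
  let ?S = "{s. Re s > 1}"
  let ?f = "\<lambda>n s. of_nat (Suc n) powr (-s) :: complex"
  let ?f' = "\<lambda>n s. - of_real (ln (real (Suc n))) * of_nat (Suc n) powr (-s) :: complex"
  have o: "open ?S" by (rule open_halfspace_Re_gt)
  have "\<exists>g g'. \<forall>x \<in> ?S. ((\<lambda>n. ?f n x) sums g x) \<and> ((\<lambda>n. ?f' n x) sums g' x) \<and> (g has_field_derivative g' x) (at x)"
  proof (rule series_and_derivative_comparison_complex[OF o])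
    fix n x assume "x \<in> ?S"
    have "((\<lambda>s. of_nat (Suc n) powr (-s)) has_field_derivative (Ln (of_nat (Suc n)) * of_nat (Suc n) powr (-x)) * (-1)) (at x)"
      by (rule DERIV_chain2[OF has_field_derivative_powr_right]) (auto intro!: derivative_eq_intros simp del: of_nat_Suc)
    moreover have "Ln (of_nat (Suc n)) = of_real (ln (real (Suc n)))"
      using Ln_of_real[of "real (Suc n)"] by (simp del: of_nat_Suc)
    ultimately show "(?f n has_field_derivative ?f' n x) (at x)" by (simp add: mult.commute del: of_nat_Suc)
  next
    fix x :: complex assume "x \<in> ?S"
    define a where "a = (Re x - 1) / 2"
    have a: "a > 0" using \<open>x \<in> ?S\<close> by (simp add: a_def)
    define h where "h = (\<lambda>n. complex_of_real (real (Suc n) powr (- a - 1)))"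
    have "\<forall>y\<in>ball x a \<inter> ?S. cmod (?f n y) \<le> cmod (h n)" for n
    proof
      fix y assume y: "y \<in> ball x a \<inter> ?S"
      have d: "norm (x - y) < a" using y by (simp add: dist_norm)
      have 1: "Re y \<ge> a + 1" using d abs_Re_le_cmod[of "x - y"] by (simp add: a_def field_simps)
      show "cmod (?f n y) \<le> cmod (h n)"
        using 1 unfolding norm_of_nat_powr h_def by (simp add: powr_mono del: of_nat_Suc)
    qed
    moreover have "summable h" unfolding h_def
      using a by (intro summable_of_real summable_Suc_powr) simp
    moreover have "range h \<subseteq> \<real>\<^sub>\<ge>\<^sub>0" by (auto simp: h_def)
    ultimately show "\<exists>d h. 0 < d \<and> summable h \<and> range h \<subseteq> \<real>\<^sub>\<ge>\<^sub>0 \<and> (\<forall>\<^sub>F n in sequentially. \<forall>y\<in>ball x d \<inter> ?S. cmod (?f n y) \<le> cmod (h n))"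
      using a by (intro exI[of _ a] exI[of _ h]) auto
  qed
  then obtain g g' where g: "\<And>x. x \<in> ?S \<Longrightarrow> ((\<lambda>n. ?f n x) sums g x)"
    and g'': "\<And>x. x \<in> ?S \<Longrightarrow> ((\<lambda>n. ?f' n x) sums g' x)"
    and g': "\<And>x. x \<in> ?S \<Longrightarrow> (g has_field_derivative g' x) (at x)" by blast
  have gz: "dir_zeta x = g x" if "x \<in> ?S" for x
    using sums_unique[OF g[OF that]] by (simp add: dir_zeta_def)
  let ?m = "\<lambda>n. mangoldt n * of_nat n powr (-s) :: complex"
  let ?z = "\<lambda>n. of_nat n powr (-s) :: complex"
  let ?l = "\<lambda>n. of_real (ln (real n)) * of_nat n powr (-s) :: complex"
  have m: "summable (\<lambda>n. norm (?m n))" by (rule summable_dir_mangoldt[OF s])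
  have z: "summable (\<lambda>n. norm (?z n))" using s by (simp add: norm_of_nat_powr summable_real_powr_iff)
  have l: "summable (\<lambda>n. norm (?l n))"
  proof -
    have "\<bar>ln (real n)\<bar> = ln (real n)" for n by (cases "n = 0") auto
    then show ?thesis using summable_ln_powr[OF s] by (simp add: norm_mult norm_of_nat_powr)
  qed
  have z1: "suminf ?z = dir_zeta s"
    using suminf_split_head[OF summable_norm_cancel[OF z]] by (simp add: dir_zeta_def)
  have "(\<lambda>n. - ?f' n s) sums (suminf ?l)"
    using summable_sums[OF summable_norm_cancel[OF l]] sums_Suc_iff[of ?l "suminf ?l"] by simp
  moreover have "(\<lambda>n. - ?f' n s) sums (- g' s)" using g''[of s] s by (intro sums_minus) simp
  ultimately have l1: "suminf ?l = - g' s" by (rule sums_unique2)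
  have "((\<lambda>n. \<Sum>d | d dvd n. ?m d * ?z (n div d)) has_sum (suminf ?m * suminf ?z)) {0<..}"
    by (rule has_sum_dirichlet_product; rule has_sum_positive_nats) (use m z in auto)
  also have "?this \<longleftrightarrow> (?l has_sum (suminf ?m * suminf ?z)) {0<..}"
  proof (rule has_sum_cong)
    fix n :: nat assume n: "n \<in> {0<..}"
    have "(\<Sum>d | d dvd n. ?m d * ?z (n div d)) = (\<Sum>d | d dvd n. mangoldt d * ?z n)"
    proof (rule sum.cong)
      fix d assume "d \<in> {d. d dvd n}"
      then have "n = d * (n div d)" by simp
      moreover have "?z (d * (n div d)) = ?z d * ?z (n div d)"
        unfolding of_nat_mult
        using powr_times_real[of "of_nat d" "of_nat (n div d)" "-s"] by simp
      ultimately show "?m d * ?z (n div d) = mangoldt d * ?z n" by simp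
    qed simp
    also have "\<dots> = ?l n" using n mangoldt_sum[of n, where ?'a = complex] by (simp add: sum_distrib_right[symmetric])
    finally show "(\<Sum>d | d dvd n. ?m d * ?z (n div d)) = ?l n" .
  qed
  finally have "(?l has_sum (suminf ?m * suminf ?z)) {0<..}" .
  moreover have "(?l has_sum suminf ?l) {0<..}" by (rule has_sum_positive_nats(2)[OF l]) simp
  ultimately have "suminf ?m * suminf ?z = suminf ?l" by (rule has_sum_unique)
  then have "- (dir_mangoldt s * dir_zeta s) = g' s" using l1 z1 by (simp add: dir_mangoldt_def)
  moreover have "(dir_zeta has_field_derivative g' s) (at s)"
    by (rule has_field_derivative_transform_within_open[OF g' o]) (use s gz in auto)
  ultimately show ?thesis by simp
qed

section \<open>Nonvanishing on the closed half-plane \<open>Re s >= 1\<close>\<close>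

text \<open>Near \<open>z\<close> write \<open>f x = (x - z) ^ m * g x\<close> with \<open>g\<close>
  zero-free; then \<open>(x - z) * f' / f\<close> tends to the order \<open>m\<close>. The point
  \<open>w\<close> excludes that \<open>f\<close> vanishes identically.\<close>

lemma logderiv_limit:
  fixes f :: "complex \<Rightarrow> complex"
  assumes f: "f holomorphic_on S" and S: "open S" "connected S" and z: "z \<in> S"
    and w: "w \<in> S" "f w \<noteq> 0"
  obtains m :: nat where "m = 0 \<longleftrightarrow> f z \<noteq> 0"
    "((\<lambda>x. (x - z) * deriv f x / f x) \<longlongrightarrow> of_nat m) (at z)"
proof (cases "f z = 0")
  case False
  have "isCont f z" by (rule DERIV_isCont[OF holomorphic_derivI[OF f S(1) z]])
  moreover have "isCont (deriv f) z"
    by (rule DERIV_isCont[OF holomorphic_derivI[OF holomorphic_deriv[OF f S(1)] S(1) z]])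
  ultimately have "((\<lambda>x. (x - z) * deriv f x / f x) \<longlongrightarrow> (z - z) * deriv f z / f z) (at z)"
    using False unfolding isCont_def by (intro tendsto_intros) auto
  with that[of 0] False show ?thesis by simp
next
  case True
  have nc: "\<not> f constant_on S" using True z w unfolding constant_on_def by metis
  obtain g r n where n: "0 < n" and r: "0 < r" "ball z r \<subseteq> S" and g: "g holomorphic_on ball z r"
    and fg: "\<And>w. w \<in> ball z r \<Longrightarrow> f w = (w - z) ^ n * g w" and g0: "\<And>w. w \<in> ball z r \<Longrightarrow> g w \<noteq> 0"
    by (rule holomorphic_factor_zero_nonconstant[OF f S z True nc]) (rule that; assumption)
  have c: "isCont g z" "isCont (deriv g) z"
    using r by (auto intro!: DERIV_isCont[OF holomorphic_derivI[OF g]]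
        DERIV_isCont[OF holomorphic_derivI[OF holomorphic_deriv[OF g]]])
  have "((\<lambda>x. of_nat n + (x - z) * deriv g x / g x) \<longlongrightarrow> of_nat n + (z - z) * deriv g z / g z) (at z)"
    using c g0[of z] r unfolding isCont_def by (intro tendsto_intros) auto
  moreover have "\<forall>\<^sub>F x in at z. of_nat n + (x - z) * deriv g x / g x = (x - z) * deriv f x / f x"
    unfolding eventually_at
  proof (intro exI[of _ r] conjI ballI impI)
    fix x assume x: "x \<noteq> z \<and> dist x z < r"
    then have xb: "x \<in> ball z r" by (simp add: dist_commute)
    have "((\<lambda>w. (w - z) ^ n * g w) has_field_derivative (of_nat n * (x - z) ^ (n - 1)) * g x + (x - z) ^ n * deriv g x) (at x)"
      using holomorphic_derivI[OF g _ xb] by (auto intro!: derivative_eq_intros)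
    then have "(f has_field_derivative (of_nat n * (x - z) ^ (n - 1)) * g x + (x - z) ^ n * deriv g x) (at x)"
      by (rule has_field_derivative_transform_within_open[of _ _ _ "ball z r"]) (use xb fg in auto)
    then have d: "deriv f x = (of_nat n * (x - z) ^ (n - 1)) * g x + (x - z) ^ n * deriv g x" by (rule DERIV_imp_deriv)
    have "(x - z) * deriv f x = of_nat n * ((x - z) * (x - z) ^ (n - 1)) * g x + (x - z) * ((x - z) ^ n * deriv g x)"
      unfolding d by (simp add: algebra_simps)
    also have "(x - z) * (x - z) ^ (n - 1) = (x - z) ^ n" using n by (cases n) auto
    finally have "(x - z) * deriv f x = (x - z) ^ n * (of_nat n * g x + (x - z) * deriv g x)"
      by (simp add: algebra_simps)
    then show "of_nat n + (x - z) * deriv g x / g x = (x - z) * deriv f x / f x"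
      using x g0[OF xb] by (simp add: fg[OF xb] add_divide_distrib)
  qed (use r in auto)
  ultimately have "((\<lambda>x. (x - z) * deriv f x / f x) \<longlongrightarrow> of_nat n) (at z)"
    by (auto elim: Lim_transform_eventually)
  with that[of n] n True show ?thesis by simp
qed

text \<open>The form without division holds at zeros of \<open>scaled_zeta\<close> too, so it can
  serve to show that there are none.\<close>

lemma deriv_scaled_zeta:
  assumes s: "Re s > 1"
  shows "deriv scaled_zeta s = scaled_zeta s * (1 / (s - 1) - dir_mangoldt s)"
proof -
  have "((\<lambda>s. (s - 1) * dir_zeta s) has_field_derivative dir_zeta s + (s - 1) * - (dir_mangoldt s * dir_zeta s)) (at s)"
    using dir_zeta_deriv[OF s] by (auto intro!: derivative_eq_intros)
  then have "(scaled_zeta has_field_derivative dir_zeta s + (s - 1) * - (dir_mangoldt s * dir_zeta s)) (at s)"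
    by (rule has_field_derivative_transform_within_open[OF _ open_halfspace_Re_gt[of 1]])
       (use s scaled_zeta_eq in auto)
  then have "deriv scaled_zeta s = dir_zeta s + (s - 1) * - (dir_mangoldt s * dir_zeta s)" by (rule DERIV_imp_deriv)
  moreover have "s - 1 \<noteq> 0" using s by auto
  ultimately show ?thesis by (simp add: scaled_zeta_eq[OF s] right_diff_distrib)
qed

lemma norm_dir_mangoldt_le:
  assumes a: "a > 1" "Re s \<ge> a"
  shows "norm (dir_mangoldt s) \<le> (\<Sum>n. mangoldt n * real n powr (-a))"
  unfolding dir_mangoldt_def
proof (rule norm_suminf_le[OF _ summable_mangoldt_powr[OF a(1)]])
  fix n
  have "real n powr (- Re s) \<le> real n powr (-a)"
    using a by (cases "n = 0") (auto intro!: powr_mono)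
  then show "norm (mangoldt n * of_nat n powr (-s) :: complex) \<le> mangoldt n * real n powr (-a)"
    by (simp add: norm_mult norm_of_nat_powr mult_left_mono mangoldt_nonneg)
qed

lemma open_connected_Re_pos: "open {s. Re s > 0}" "connected {s. Re s > 0}"
  by (rule open_halfspace_Re_gt) (rule convex_connected[OF convex_halfspace_Re_gt])

text \<open>The convergent series for \<open>dir_mangoldt\<close> bounds the logarithmic derivative
  near \<open>z\<close>, so \<open>(x - z) * f' / f\<close> tends to 0; at a zero its limit would be
  the positive order.\<close>

lemma scaled_zeta_nonzero_gt_1:
  assumes z: "Re z > 1"
  shows "scaled_zeta z \<noteq> 0"
proof
  assume z0: "scaled_zeta z = 0"
  obtain m :: nat where m: "m = 0 \<longleftrightarrow> scaled_zeta z \<noteq> 0"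
    and lim: "((\<lambda>x. (x - z) * deriv scaled_zeta x / scaled_zeta x) \<longlongrightarrow> of_nat m) (at z)"
    by (rule logderiv_limit[OF scaled_zeta_holomorphic open_connected_Re_pos, of z 1]) (use z in auto)
  define a where "a = (1 + Re z) / 2"
  define C where "C = 1 / (a - 1) + (\<Sum>n. mangoldt n * real n powr (-a))"
  have a: "a > 1" using z by (simp add: a_def)
  have "((\<lambda>x. (x - z) * deriv scaled_zeta x / scaled_zeta x) \<longlongrightarrow> 0) (at z)"
  proof (rule Lim_null_comparison)
    have "((\<lambda>x. norm (x - z) * C) \<longlongrightarrow> norm (z - z) * C) (at z)" by (intro tendsto_intros)
    then show "((\<lambda>x. norm (x - z) * C) \<longlongrightarrow> 0) (at z)" by simp
    show "\<forall>\<^sub>F x in at z. norm ((x - z) * deriv scaled_zeta x / scaled_zeta x) \<le> norm (x - z) * C"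
      unfolding eventually_at
    proof (intro exI[of _ "a - 1"] conjI ballI impI)
      fix x assume "x \<noteq> z \<and> dist x z < a - 1"
      then have x: "Re x \<ge> a"
        using abs_Re_le_cmod[of "x - z"] unfolding dist_norm a_def by (simp add: abs_le_iff field_simps)
      have n1: "norm (1 / (x - 1)) \<le> 1 / (a - 1)"
        using x a complex_Re_le_cmod[of "x - 1"] by (simp add: norm_divide frac_le)
      \<comment> \<open>At a zero \<open>x\<close> the quotient is 0 by convention and the bound is
        trivial.\<close>
      have "norm (deriv scaled_zeta x / scaled_zeta x) \<le> norm (1 / (x - 1) - dir_mangoldt x)"
        using deriv_scaled_zeta[of x] x a by (cases "scaled_zeta x = 0") auto
      also have "\<dots> \<le> norm (1 / (x - 1)) + norm (dir_mangoldt x)" by (rule norm_triangle_ineq4)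
      also have "\<dots> \<le> C" unfolding C_def by (rule add_mono[OF n1 norm_dir_mangoldt_le[OF a x]])
      finally show "norm ((x - z) * deriv scaled_zeta x / scaled_zeta x) \<le> norm (x - z) * C"
        by (simp add: norm_mult norm_divide mult_left_mono flip: times_divide_eq_right)
    qed (use a in auto)
  qed
  with lim have "of_nat m = (0 :: complex)" by (intro tendsto_unique[OF _ lim]) auto
  with m z0 show False by simp
qed

lemma dir_mangoldt_eq:
  assumes "Re s > 1"
  shows "dir_mangoldt s = 1 / (s - 1) - deriv scaled_zeta s / scaled_zeta s"
  using deriv_scaled_zeta[OF assms] scaled_zeta_nonzero_gt_1[OF assms] by simp

text \<open>The extra phase \<open>x\<close> is for the Fourier smoothing, where it becomes
  \<open>la * t * y\<close>; phase 0 is the case used for nonvanishing.\<close>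

lemma Re_cis_dir_mangoldt:
  assumes "a > 1"
  shows "(\<lambda>n. mangoldt n * real n powr (-a) * cos (x - b * ln (real n))) sums Re (cis x * dir_mangoldt (Complex a b))"
proof -
  have "(\<lambda>n. Re (cis x * (mangoldt n * of_nat n powr (- Complex a b)))) sums Re (cis x * dir_mangoldt (Complex a b))"
    unfolding dir_mangoldt_def
    using summable_sums[OF summable_norm_cancel[OF summable_dir_mangoldt[of "Complex a b"]]] assms
    by (intro sums_Re sums_mult) simp
  moreover have "Re (cis x * (mangoldt n * of_nat n powr (- Complex a b))) = mangoldt n * real n powr (-a) * cos (x - b * ln (real n))" for n
  proof (cases "n = 0")
    case False
    have "of_nat n powr (- Complex a b) = exp (- Complex a b * of_real (ln (real n)))"
      using False by (simp add: powr_def Ln_of_nat)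
    also have "- Complex a b * of_real (ln (real n)) = of_real (- a * ln (real n)) + \<i> * of_real (- (b * ln (real n)))"
      by (simp add: complex_eq_iff)
    also have "exp \<dots> = of_real (real n powr (-a)) * cis (- (b * ln (real n)))"
    proof -
      have p: "exp (- a * ln (real n)) = real n powr (-a)" using False by (simp add: powr_def)
      show ?thesis by (simp only: exp_add cis_conv_exp exp_of_real p)
    qed
    finally have e: "of_nat n powr (- Complex a b) = of_real (real n powr (-a)) * cis (- (b * ln (real n)))" .
    have eq: "cis x * (mangoldt n * of_nat n powr (- Complex a b)) = of_real (mangoldt n * real n powr (-a)) * cis (x + - (b * ln (real n)))"
      unfolding e by (simp only: cis_mult[symmetric] of_real_mult of_real_mangoldt mult_ac)
    show ?thesis unfolding eq by simp
  qed simp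
  ultimately show ?thesis by (simp only:)
qed

lemma Re_dir_mangoldt:
  assumes "a > 1"
  shows "(\<lambda>n. mangoldt n * real n powr (-a) * cos (b * ln (real n))) sums Re (dir_mangoldt (Complex a b))"
  using Re_cis_dir_mangoldt[OF assms, of 0 b] by simp

text \<open>Termwise \<open>3 + 4 * cos u + cos (2 * u) = 2 * (1 + cos u)^2\<close>. What matters is
  that the weight 4 of the middle term exceeds the weight 3 of the term that carries the
  pole.\<close>

lemma mertens_341:
  assumes a: "a > 1"
  shows "3 * Re (dir_mangoldt (Complex a 0)) + 4 * Re (dir_mangoldt (Complex a b)) + Re (dir_mangoldt (Complex a (2 * b))) \<ge> 0"
proof -
  let ?f = "\<lambda>b n. mangoldt n * real n powr (-a) * cos (b * ln (real n))"
  have s: "(\<lambda>n. 3 * ?f 0 n + 4 * ?f b n + ?f (2 * b) n) sums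
    (3 * Re (dir_mangoldt (Complex a 0)) + 4 * Re (dir_mangoldt (Complex a b)) + Re (dir_mangoldt (Complex a (2 * b))))"
    by (intro sums_add sums_mult Re_dir_mangoldt a)
  have "3 * ?f 0 n + 4 * ?f b n + ?f (2 * b) n \<ge> 0" for n
  proof -
    have "3 * ?f 0 n + 4 * ?f b n + ?f (2 * b) n = mangoldt n * real n powr (-a) * (2 * (1 + cos (b * ln n))\<^sup>2)"
    proof -
      have "cos (2 * b * ln n) = 2 * (cos (b * ln n))\<^sup>2 - 1"
        using cos_double_cos[of "b * ln n"] by (simp add: mult.assoc)
      show ?thesis unfolding \<open>cos (2 * b * ln n) = 2 * (cos (b * ln n))\<^sup>2 - 1\<close> by (simp add: power2_eq_square algebra_simps)
    qed
    then show ?thesis by (simp add: mangoldt_nonneg)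
  qed
  then show ?thesis by (rule sums_le[OF _ sums_zero s])
qed

text \<open>Multiply the 3-4-1 inequality at abscissa \<open>1 + h\<close> by \<open>h\<close> and
  let \<open>h\<close> tend to 0. Each term tends to the pole contribution minus the order of
  vanishing. With \<open>m0 = 0\<close> and \<open>b\<close> nonzero this leaves
  \<open>3 - 4 * m1 - m2 >= 0\<close>, so the natural number \<open>m1\<close> is 0.\<close>

lemma scaled_zeta_nonzero:
  assumes z: "Re z \<ge> 1"
  shows "scaled_zeta z \<noteq> 0"
proof (cases "Re z > 1 \<or> z = 1")
  case True
  then show ?thesis using scaled_zeta_nonzero_gt_1 by auto
next
  case False
  define b where "b = Im z"
  have zb: "z = Complex 1 b" using False z by (simp add: complex_eq_iff b_def)
  have b: "b \<noteq> 0" using False zb by (auto simp: complex_eq_iff)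
  \<comment> \<open>The contribution of the pole at 1, which is felt only at height 0.\<close>
  define E :: "real \<Rightarrow> real" where "E = (\<lambda>c. if c = 0 then 1 else 0)"
  have lim: "\<exists>m::nat. (m = 0 \<longleftrightarrow> scaled_zeta (Complex 1 c) \<noteq> 0) \<and>
     ((\<lambda>h. h * Re (dir_mangoldt (Complex (1 + h) c))) \<longlongrightarrow> E c - real m) (at_right 0)" for c
  proof -
    obtain m :: nat where m: "m = 0 \<longleftrightarrow> scaled_zeta (Complex 1 c) \<noteq> 0"
      and lim: "((\<lambda>x. (x - Complex 1 c) * deriv scaled_zeta x / scaled_zeta x) \<longlongrightarrow> of_nat m) (at (Complex 1 c))"
      by (rule logderiv_limit[OF scaled_zeta_holomorphic open_connected_Re_pos, of "Complex 1 c" 1]) auto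
    have e: "Complex (1 + h) c = Complex 1 c + of_real h" for h by (simp add: complex_eq_iff)
    have f: "filterlim (\<lambda>h. Complex (1 + h) c) (at (Complex 1 c)) (at_right 0)"
      unfolding e filterlim_at
    proof (intro conjI)
      have "((\<lambda>h. Complex 1 c + of_real h) \<longlongrightarrow> Complex 1 c + of_real 0) (at_right 0)" by (intro tendsto_intros)
      then show "((\<lambda>h. Complex 1 c + of_real h) \<longlongrightarrow> Complex 1 c) (at_right 0)" by simp
      show "\<forall>\<^sub>F h in at_right 0. Complex 1 c + of_real h \<in> UNIV \<and> Complex 1 c + of_real h \<noteq> Complex 1 c"
        by (auto simp: eventually_at intro: exI[of _ 1])
    qed
    have 1: "((\<lambda>h. of_real h / (of_real h + \<i> * of_real c)) \<longlongrightarrow> (if c = 0 then 1 else 0 :: complex)) (at_right 0)"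
    proof (cases "c = 0")
      case True
      have "\<forall>\<^sub>F h in at_right 0. 1 = of_real h / (of_real h + \<i> * of_real c :: complex)"
        by (auto simp: eventually_at True intro: exI[of _ 1])
      then show ?thesis using True by (auto intro: Lim_transform_eventually[OF tendsto_const])
    next
      case False
      have "((\<lambda>h. of_real h / (of_real h + \<i> * of_real c)) \<longlongrightarrow> of_real 0 / (of_real 0 + \<i> * of_real c :: complex)) (at_right 0)"
        using False by (intro tendsto_intros) auto
      then show ?thesis using False by simp
    qed
    have "((\<lambda>h. Re (of_real h / (of_real h + \<i> * of_real c) - 
       (Complex (1 + h) c - Complex 1 c) * deriv scaled_zeta (Complex (1 + h) c) / scaled_zeta (Complex (1 + h) c)))
        \<longlongrightarrow> Re ((if c = 0 then 1 else 0) - of_nat m)) (at_right 0)"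
      by (intro tendsto_intros 1 filterlim_compose[OF lim f])
    moreover have "\<forall>\<^sub>F h in at_right 0. Re (of_real h / (of_real h + \<i> * of_real c) - 
       (Complex (1 + h) c - Complex 1 c) * deriv scaled_zeta (Complex (1 + h) c) / scaled_zeta (Complex (1 + h) c))
       = h * Re (dir_mangoldt (Complex (1 + h) c))"
      unfolding eventually_at
    proof (intro exI[of _ 1] conjI ballI impI)
      fix h :: real assume "h \<in> {0<..}"
      then have h: "Re (Complex (1 + h) c) > 1" by simp
      have c1: "Complex (1 + h) c - 1 = of_real h + \<i> * of_real c" "Complex (1 + h) c - Complex 1 c = of_real h"
        by (simp_all add: complex_eq_iff)
      have "of_real h * dir_mangoldt (Complex (1 + h) c) = of_real h / (of_real h + \<i> * of_real c) - 
       (Complex (1 + h) c - Complex 1 c) * deriv scaled_zeta (Complex (1 + h) c) / scaled_zeta (Complex (1 + h) c)"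
        unfolding dir_mangoldt_eq[OF h] c1 by (simp add: algebra_simps)
      from arg_cong[OF this[symmetric], where f = Re]
      show "Re (of_real h / (of_real h + \<i> * of_real c) - 
       (Complex (1 + h) c - Complex 1 c) * deriv scaled_zeta (Complex (1 + h) c) / scaled_zeta (Complex (1 + h) c))
       = h * Re (dir_mangoldt (Complex (1 + h) c))" by simp
    qed auto
    ultimately have "((\<lambda>h. h * Re (dir_mangoldt (Complex (1 + h) c))) \<longlongrightarrow> Re ((if c = 0 then 1 else 0) - of_nat m)) (at_right 0)"
      by (rule Lim_transform_eventually)
    moreover have "Re ((if c = 0 then 1 else 0) - of_nat m) = E c - real m" by (simp add: E_def)
    ultimately show ?thesis using m by (intro exI[of _ m]) simp
  qed
  obtain m0 :: nat where m0: "m0 = 0 \<longleftrightarrow> scaled_zeta (Complex 1 0) \<noteq> 0"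
    "((\<lambda>h. h * Re (dir_mangoldt (Complex (1 + h) 0))) \<longlongrightarrow> E 0 - real m0) (at_right 0)"
    using lim[of 0] by (elim exE conjE) (rule that)
  obtain m1 :: nat where m1: "m1 = 0 \<longleftrightarrow> scaled_zeta (Complex 1 b) \<noteq> 0"
    "((\<lambda>h. h * Re (dir_mangoldt (Complex (1 + h) b))) \<longlongrightarrow> E b - real m1) (at_right 0)"
    using lim[of b] by (elim exE conjE) (rule that)
  obtain m2 :: nat where m2: "((\<lambda>h. h * Re (dir_mangoldt (Complex (1 + h) (2 * b)))) \<longlongrightarrow> E (2 * b) - real m2) (at_right 0)"
    using lim[of "2 * b"] by (elim exE conjE) (rule that)
  have "Complex 1 0 = 1" by (simp add: complex_eq_iff)
  then have "m0 = 0" using m0(1) by simp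
  have "((\<lambda>h. 3 * (h * Re (dir_mangoldt (Complex (1 + h) 0))) + 4 * (h * Re (dir_mangoldt (Complex (1 + h) b)))
      + h * Re (dir_mangoldt (Complex (1 + h) (2 * b)))) \<longlongrightarrow> 3 * (E 0 - real m0) + 4 * (E b - real m1) + (E (2 * b) - real m2)) (at_right 0)"
    by (intro tendsto_intros m0 m1 m2)
  moreover have "\<forall>\<^sub>F h in at_right 0. 0 \<le> 3 * (h * Re (dir_mangoldt (Complex (1 + h) 0))) + 4 * (h * Re (dir_mangoldt (Complex (1 + h) b)))
      + h * Re (dir_mangoldt (Complex (1 + h) (2 * b)))"
    unfolding eventually_at
  proof (intro exI[of _ 1] conjI ballI impI)
    fix h :: real assume h: "h \<in> {0<..}"
    have "0 \<le> h * (3 * Re (dir_mangoldt (Complex (1 + h) 0)) + 4 * Re (dir_mangoldt (Complex (1 + h) b)) + Re (dir_mangoldt (Complex (1 + h) (2 * b))))"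
      using h by (intro mult_nonneg_nonneg mertens_341) auto
    then show "0 \<le> 3 * (h * Re (dir_mangoldt (Complex (1 + h) 0))) + 4 * (h * Re (dir_mangoldt (Complex (1 + h) b)))
      + h * Re (dir_mangoldt (Complex (1 + h) (2 * b)))" by (simp add: algebra_simps)
  qed auto
  ultimately have "0 \<le> 3 * (E 0 - real m0) + 4 * (E b - real m1) + (E (2 * b) - real m2)"
    by (rule tendsto_lowerbound) simp
  then have "real m1 < 1" using \<open>m0 = 0\<close> b by (simp add: E_def)
  then have "m1 = 0" by simp
  then show ?thesis using m1(1) zb by simp
qed

section \<open>A kernel that is nonpositive outside a window\<close>

text \<open>With \<open>\<phi>(t) = ((pi - t) * cos t + sin t) / 2\<close>, the autocorrelation of the cosine arch on
  \<open>[-pi/2, pi/2]\<close>, this is \<open>2 * (\<phi> + c * \<phi>'')\<close>. Its cosine transform is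
  therefore \<open>1 - c * v\<^sup>2\<close> times a nonnegative function.\<close>

definition test_fun :: "real \<Rightarrow> real \<Rightarrow> real" where
  "test_fun c t = (1 - c) * (pi - t) * cos t + (1 + c) * sin t"

definition test_kernel :: "real \<Rightarrow> real \<Rightarrow> real" where
  "test_kernel c v = integral {0..pi} (\<lambda>t. test_fun c t * cos (v * t))"

lemma continuous_test_fun [continuous_intros]:
  fixes f :: "'a::t2_space \<Rightarrow> real"
  shows "continuous_on A f \<Longrightarrow> continuous_on A (\<lambda>t. test_fun c (f t))"
  unfolding test_fun_def by (intro continuous_intros)

lemma test_kernel_integrable: "(\<lambda>t. test_fun c t * cos (v * t)) integrable_on {0..pi}"
  by (intro integrable_continuous_interval continuous_intros)

lemma abs_test_fun_le:
  assumes "c \<in> {0..1}" "t \<in> {0..pi}"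
  shows "\<bar>test_fun c t\<bar> \<le> 6"
proof -
  have "\<bar>(1 - c) * (pi - t) * cos t\<bar> \<le> 1 * 4 * 1"
    unfolding abs_mult using assms pi_less_4 by (intro mult_mono) auto
  moreover have "\<bar>(1 + c) * sin t\<bar> \<le> 2 * 1"
    unfolding abs_mult using assms by (intro mult_mono) auto
  ultimately show ?thesis unfolding test_fun_def by linarith
qed

text \<open>Product-to-sum formulas produce the frequencies \<open>a = 1 + v\<close> and
  \<open>b = 1 - v\<close>, both nonzero here, and an explicit antiderivative \<open>Q\<close>. In
  the result \<open>2 * (1 + cos (pi * v)) / (1 - v^2)^2\<close> is the squared transform of the
  cosine arch, so \<open>1 - c * v^2\<close> alone carries the sign.\<close>

lemma test_kernel_eq:
  assumes v: "v\<^sup>2 \<noteq> 1"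
  shows "test_kernel c v = 2 * (1 - c * v\<^sup>2) * (1 + cos (pi * v)) / (1 - v\<^sup>2)\<^sup>2"
proof -
  define a b where "a = 1 + v" and "b = 1 - v"
  have ab: "a \<noteq> 0" "b \<noteq> 0" "a * b = 1 - v\<^sup>2" "a + b = 2" "a\<^sup>2 + b\<^sup>2 = 2 + 2 * v\<^sup>2"
    using v by (auto simp: a_def b_def power2_eq_square algebra_simps add_eq_0_iff)
  define Q where "Q = (\<lambda>t. (1 - c) / 2 * ((pi - t) * sin (a * t) / a - cos (a * t) / a\<^sup>2
     + ((pi - t) * sin (b * t) / b - cos (b * t) / b\<^sup>2)) - (1 + c) / 2 * (cos (a * t) / a + cos (b * t) / b))"
  have ct: "cos t * cos (v * t) = (cos (a * t) + cos (b * t)) / 2" for t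
    by (simp add: a_def b_def distrib_right left_diff_distrib cos_add cos_diff)
  have st: "sin t * cos (v * t) = (sin (a * t) + sin (b * t)) / 2" for t
    by (simp add: a_def b_def distrib_right left_diff_distrib sin_add sin_diff)
  have "(Q has_real_derivative test_fun c t * cos (v * t)) (at t within {0..pi})" for t
  proof -
    have 1: "((\<lambda>t. (pi - t) * sin (x * t) / x - cos (x * t) / x\<^sup>2) has_real_derivative (pi - t) * cos (x * t)) (at t within {0..pi})"
      if "x \<noteq> 0" for x
      using that by (auto intro!: derivative_eq_intros simp: field_simps power2_eq_square)
    have 2: "((\<lambda>t. cos (x * t) / x) has_real_derivative - sin (x * t)) (at t within {0..pi})" if "x \<noteq> 0" for x
      using that by (auto intro!: derivative_eq_intros)
    have "(Q has_real_derivative (1 - c) / 2 * ((pi - t) * cos (a * t) + (pi - t) * cos (b * t)) 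
       - (1 + c) / 2 * (- sin (a * t) + - sin (b * t))) (at t within {0..pi})"
      unfolding Q_def using ab by (intro DERIV_diff DERIV_cmult DERIV_add 1 2)
    also have "(1 - c) / 2 * ((pi - t) * cos (a * t) + (pi - t) * cos (b * t)) - (1 + c) / 2 * (- sin (a * t) + - sin (b * t))
       = (1 - c) * (pi - t) * ((cos (a * t) + cos (b * t)) / 2) + (1 + c) * ((sin (a * t) + sin (b * t)) / 2)"
      by (simp add: field_simps)
    also have "\<dots> = test_fun c t * cos (v * t)"
      unfolding ct[symmetric] st[symmetric] test_fun_def by (simp add: algebra_simps)
    finally show ?thesis .
  qed
  then have "((\<lambda>t. test_fun c t * cos (v * t)) has_integral (Q pi - Q 0)) {0..pi}"
    by (intro fundamental_theorem_of_calculus) (auto simp: has_real_derivative_iff_has_vector_derivative)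
  then have "test_kernel c v = Q pi - Q 0" unfolding test_kernel_def by (rule integral_unique)
  also have "\<dots> = (1 + cos (pi * v)) / 2 * ((1 - c) * (1 / a\<^sup>2 + 1 / b\<^sup>2) + (1 + c) * (1 / a + 1 / b))"
  proof -
    have "a * pi = pi + pi * v" "b * pi = pi - pi * v" by (simp_all add: a_def b_def algebra_simps)
    then have cs: "cos (a * pi) = - cos (pi * v)" "cos (b * pi) = - cos (pi * v)" by simp_all
    have id: "(1-c)/2*(0 - -C*r2+(0 - -C* s2)) - (1+c)/2*(-C*r+-C* s) - ((1-c)/2*(0 - 1*r2+(0 - 1* s2)) - (1+c)/2*(1*r+1* s))
        = (1+C)/2*((1-c)*(1*r2+1* s2)+(1+c)*(1*r+1* s))" for C r2 s2 r s :: real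
      by (simp add: field_simps)
    note id = id[of "cos (pi * v)" "inverse (a\<^sup>2)" "inverse (b\<^sup>2)" "inverse a" "inverse b"]
    show ?thesis using id
      by (simp only: Q_def cs diff_self mult_zero_left mult_zero_right sin_zero cos_zero div_0
          divide_inverse[of _ a] divide_inverse[of _ b] divide_inverse[of _ "a\<^sup>2"] divide_inverse[of _ "b\<^sup>2"])
  qed
  also have "1 / a\<^sup>2 + 1 / b\<^sup>2 = (a\<^sup>2 + b\<^sup>2) / (a * b)\<^sup>2"
    using ab by (simp add: field_simps power2_eq_square)
  also have "1 / a + 1 / b = (a + b) * (a * b) / (a * b)\<^sup>2"
    using ab by (simp add: field_simps power2_eq_square)
  also have "(1 - c) * ((a\<^sup>2 + b\<^sup>2) / (a * b)\<^sup>2) + (1 + c) * ((a + b) * (a * b) / (a * b)\<^sup>2)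
     = ((1 - c) * (a\<^sup>2 + b\<^sup>2) + (1 + c) * ((a + b) * (a * b))) / (a * b)\<^sup>2" by (simp only: times_divide_eq_right add_divide_distrib[symmetric])
  also have "(1 - c) * (a\<^sup>2 + b\<^sup>2) + (1 + c) * ((a + b) * (a * b)) = 4 * (1 - c * v\<^sup>2)"
    unfolding ab by (simp add: algebra_simps)
  also have "(1 + cos (pi * v)) / 2 * (4 * (1 - c * v\<^sup>2) / (a * b)\<^sup>2)
     = 2 * (1 - c * v\<^sup>2) * (1 + cos (pi * v)) / (a * b)\<^sup>2"
    by (simp only: times_divide_times_eq) (simp add: divide_simps)
  finally show ?thesis unfolding ab .
qed

text \<open>For \<open>v^2 >= 4\<close> the closed formula is away from its removable singularities
  and decays like \<open>4 / v^2\<close>. Otherwise the crude bound \<open>6 * pi <= 24\<close> on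
  the integral suffices, and \<open>1 + v^2 < 5\<close> turns 24 into 120.\<close>

lemma abs_test_kernel_le:
  assumes c: "c \<in> {0..1}"
  shows "\<bar>test_kernel c v\<bar> \<le> 120 / (1 + v\<^sup>2)"
proof (cases "v\<^sup>2 \<ge> 4")
  case True
  define q where "q = v\<^sup>2"
  have q: "q \<ge> 4" using True by (simp add: q_def)
  have "0 \<le> c * q" "c * q \<le> q" using c q mult_right_mono[of c 1 q] by auto
  then have "\<bar>1 - c * q\<bar> \<le> q" using q by linarith
  moreover have "\<bar>1 + cos (pi * v)\<bar> \<le> 2" using cos_ge_minus_one[of "pi * v"] cos_le_one[of "pi * v"] by linarith
  ultimately have "2 * \<bar>1 - c * q\<bar> * \<bar>1 + cos (pi * v)\<bar> \<le> 2 * q * 2" using q by (intro mult_mono) auto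
  then have "\<bar>test_kernel c v\<bar> \<le> 4 * q / (1 - q)\<^sup>2"
  proof -
    have "test_kernel c v = 2 * (1 - c * q) * (1 + cos (pi * v)) / (1 - q)\<^sup>2"
      using q by (subst test_kernel_eq) (auto simp: q_def)
    then have "\<bar>test_kernel c v\<bar> = 2 * \<bar>1 - c * q\<bar> * \<bar>1 + cos (pi * v)\<bar> / (1 - q)\<^sup>2"
      by (simp only: abs_mult abs_divide abs_numeral abs_power2)
    then show ?thesis using \<open>_ \<le> 2 * q * 2\<close> by (simp add: divide_right_mono)
  qed
  also have "\<dots> \<le> 120 / (1 + q)"
  proof -
    have "4 * q * (1 + q) \<le> 120 * (1 - q)\<^sup>2"
    proof -
      \<comment> \<open>This is \<open>120 * (1 - q)^2 - 4 * q * (1 + q)\<close>, arranged so that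
        \<open>q >= 4\<close> makes every summand nonnegative.\<close>
      have "0 \<le> (q - 4) * (116 * q + 220) + 1000" using q by (intro add_nonneg_nonneg mult_nonneg_nonneg) auto
      then show ?thesis by (simp add: power2_eq_square algebra_simps)
    qed
    then show ?thesis using q by (simp add: divide_simps)
  qed
  finally show ?thesis by (simp add: q_def)
next
  case False
  have "norm (test_kernel c v) \<le> integral {0..pi} (\<lambda>t. 6 :: real)"
    unfolding test_kernel_def
  proof (rule integral_norm_bound_integral)
    fix t assume t: "t \<in> {0..pi}"
    have "\<bar>test_fun c t\<bar> * \<bar>cos (v * t)\<bar> \<le> 6 * 1" using abs_test_fun_le[OF c t] by (intro mult_mono) auto
    then show "norm (test_fun c t * cos (v * t)) \<le> 6" by (simp add: abs_mult)
  qed (auto simp: test_kernel_integrable)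
  also have "\<dots> \<le> 24" using pi_less_4 by simp
  also have "\<dots> \<le> 120 / (1 + v\<^sup>2)" using False by (simp add: field_simps add_pos_nonneg)
  finally show ?thesis by simp
qed

lemma continuous_test_kernel [continuous_intros]:
  fixes f :: "'a::t2_space \<Rightarrow> real"
  assumes "continuous_on A f"
  shows "continuous_on A (\<lambda>x. test_kernel c (f x))"
proof -
  have "continuous_on UNIV (\<lambda>v. integral (cbox 0 pi) (\<lambda>t. test_fun c t * cos (v * t)))"
    by (rule integral_continuous_on_param) (auto simp: split_beta intro!: continuous_intros)
  then have "continuous_on UNIV (test_kernel c)" by (simp add: test_kernel_def[abs_def])
  from continuous_on_compose2[OF this assms] show ?thesis by simp
qed

lemma one_plus_cos: "0 \<le> 1 + cos (x::real)"
  using cos_ge_minus_one[of x] by linarith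

text \<open>The closed formula settles all \<open>v\<close> other than 1 and -1; those two follow by
  continuity, as the complement of a finite set is dense.\<close>

lemma test_kernel_0_nonneg: "test_kernel 0 v \<ge> 0"
proof -
  let ?S = "{v. test_kernel 0 v \<ge> 0}"
  have "closed ?S" by (intro closed_Collect_le continuous_intros)
  moreover have "- {1, -1} \<subseteq> ?S"
  proof
    fix v :: real assume "v \<in> - {1, -1}"
    then have "v\<^sup>2 \<noteq> 1" by (simp add: power2_eq_1_iff)
    then show "v \<in> ?S" using one_plus_cos[of "pi * v"] by (auto simp: test_kernel_eq intro!: divide_nonneg_nonneg)
  qed
  ultimately have "closure (- {1, -1}) \<subseteq> ?S" by (rule closure_minimal[rotated])
  moreover have "closure (- {1, -1 :: real}) = UNIV"
    by (simp add: closure_complement empty_interior_finite)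
  ultimately show ?thesis by auto
qed

lemma integral_inverse_quadratic_le: "integral {a..b} (\<lambda>v::real. 1 / (1 + v\<^sup>2)) \<le> pi"
proof (cases "a \<le> b")
  case True
  have "((\<lambda>v. 1 / (1 + v\<^sup>2)) has_integral (arctan b - arctan a)) {a..b}"
    using True by (intro fundamental_theorem_of_calculus)
      (auto simp: has_real_derivative_iff_has_vector_derivative[symmetric] inverse_eq_divide intro!: derivative_eq_intros)
  then show ?thesis using arctan_bounded[of a] arctan_bounded[of b] by (simp add: integral_unique)
qed simp

lemma test_kernel_integrable_interval: "test_kernel c integrable_on {a..b}"
  by (intro integrable_continuous_interval continuous_intros)

text \<open>Separates the nonnegative kernel \<open>c = 0\<close> from a perturbation proportional
  to \<open>c\<close>, so that a small \<open>c\<close> keeps the integral positive.\<close>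

lemma test_kernel_affine: "test_kernel c v = test_kernel 0 v - c * (test_kernel 0 v - test_kernel 1 v)"
proof -
  have "test_fun c t * cos (v * t) = test_fun 0 t * cos (v * t) - c * (test_fun 0 t * cos (v * t) - test_fun 1 t * cos (v * t))" for t
    by (simp add: test_fun_def algebra_simps)
  then show ?thesis unfolding test_kernel_def
    by (simp add: integral_diff test_kernel_integrable integrable_on_mult_right integrable_diff)
qed

text \<open>The sign changes at \<open>v^2 = 1000\<close>, and \<open>40^2 = 1600\<close> is a round
  value beyond it.\<close>

lemma test_kernel_nonpos:
  assumes "\<bar>v\<bar> \<ge> 40"
  shows "test_kernel (1 / 1000) v \<le> 0"
proof -
  have "v\<^sup>2 \<ge> 40\<^sup>2" using assms by (metis power2_abs power_mono zero_le_numeral)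
  then show ?thesis using one_plus_cos[of "pi * v"]
    by (subst test_kernel_eq) (auto simp: divide_le_0_iff mult_le_0_iff)
qed

text \<open>Origin of \<open>c = 1 / 1000\<close>: the kernel with \<open>c = 0\<close> is at least
  2 on an interval of length 1, so it has integral at least 2, while the perturbation costs at most
  \<open>c * 240 * pi\<close>, less than \<open>c * 960\<close>, hence less than 1.\<close>

lemma integral_test_kernel_ge:
  assumes a: "a \<le> -1" and b: "b \<ge> 1"
  shows "integral {a..b} (test_kernel (1 / 1000)) \<ge> 1"
proof -
  have "integral {-1/2..1/2::real} (\<lambda>_. 2 :: real) \<le> integral {-1/2..1/2} (test_kernel 0)"
  proof (rule integral_le)
    fix v :: real assume v: "v \<in> {-1/2..1/2}"
    have v2: "v\<^sup>2 \<le> 1 / 4" using v power2_le_iff_abs_le[of "1/2" v] by (auto simp: abs_le_iff power2_eq_square)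
    have "cos (pi * v) \<ge> 0" 
      using v mult_left_mono[of "-1/2" v pi] mult_left_mono[of v "1/2" pi] by (intro cos_ge_zero) auto
    moreover have "(1 - v\<^sup>2)\<^sup>2 \<le> 1" using v2 by (simp add: power_le_one)
    moreover have "(1 - v\<^sup>2)\<^sup>2 > 0" using v2 by (simp add: zero_less_power2)
    ultimately show "2 \<le> test_kernel 0 v"
      using v2 by (subst test_kernel_eq) (auto simp: le_divide_eq)
  qed (auto simp: test_kernel_integrable_interval)
  also have "\<dots> \<le> integral {a..b} (test_kernel 0)"
    using a b by (intro integral_subset_le test_kernel_integrable_interval) (auto simp: test_kernel_0_nonneg)
  finally have 1: "2 \<le> integral {a..b} (test_kernel 0)" by simp
  have "integral {a..b} (\<lambda>v. test_kernel 0 v - test_kernel 1 v) \<le> integral {a..b} (\<lambda>v. 240 * (1 / (1 + v\<^sup>2)))"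
  proof (rule integral_le)
    fix v
    show "test_kernel 0 v - test_kernel 1 v \<le> 240 * (1 / (1 + v\<^sup>2))"
      using abs_test_kernel_le[of 0 v] abs_test_kernel_le[of 1 v] by simp
    show "(\<lambda>v. 240 * (1 / (1 + v\<^sup>2))) integrable_on {a..b}"
      by (intro integrable_continuous_interval continuous_intros) (auto simp: add_nonneg_eq_0_iff)
  qed (auto intro!: integrable_diff test_kernel_integrable_interval)
  also have "\<dots> = 240 * integral {a..b} (\<lambda>v. 1 / (1 + v\<^sup>2))" by (rule integral_mult_right)
  also have "\<dots> \<le> 240 * 4" using integral_inverse_quadratic_le[of a b] pi_less_4 by simp
  finally have 2: "integral {a..b} (\<lambda>v. test_kernel 0 v - test_kernel 1 v) \<le> 960" by simp
  have "integral {a..b} (test_kernel (1 / 1000)) = integral {a..b} (\<lambda>v. test_kernel 0 v - 1 / 1000 * (test_kernel 0 v - test_kernel 1 v))"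
    by (rule integral_cong) (rule test_kernel_affine)
  also have "\<dots> = integral {a..b} (test_kernel 0) - integral {a..b} (\<lambda>v. 1 / 1000 * (test_kernel 0 v - test_kernel 1 v))"
    by (intro integral_diff test_kernel_integrable_interval integrable_on_mult_right integrable_diff)
  also have "integral {a..b} (\<lambda>v. 1 / 1000 * (test_kernel 0 v - test_kernel 1 v)) = 1 / 1000 * integral {a..b} (\<lambda>v. test_kernel 0 v - test_kernel 1 v)"
    by (rule integral_mult_right)
  finally show ?thesis using 1 2 by simp
qed

section \<open>Primes in short intervals\<close>

text \<open>Frequency side of smoothing around \<open>y\<close> at scale \<open>1 / la\<close>:
  \<open>\<Phi>\<close> holds values on a vertical line at heights \<open>la * t\<close>. For
  conjugate-symmetric \<open>\<Phi>\<close>, taking the real part folds the two-sided Fourier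
  integral onto \<open>{0..pi}\<close>.\<close>

definition smoothed_integral :: "real \<Rightarrow> real \<Rightarrow> real \<Rightarrow> (real \<Rightarrow> complex) \<Rightarrow> real" where
  "smoothed_integral c la y \<Phi> = integral {0..pi} (\<lambda>t. test_fun c t * Re (cis (la * t * y) * \<Phi> t))"

text \<open>Sum and integral can be swapped, since
  \<open>6 * (mangoldt n * real n powr (-a))\<close> dominates the terms uniformly in
  \<open>t\<close>. A sum concentrated where \<open>ln n\<close> is near \<open>y\<close> is thus
  read off from a bounded vertical segment.\<close>

lemma kernel_sums:
  assumes a: "a > 1" and c: "c \<in> {0..1}"
  shows "(\<lambda>n. mangoldt n * real n powr (-a) * test_kernel c (la * (y - ln (real n)))) sums
    smoothed_integral c la y (\<lambda>t. dir_mangoldt (Complex a (la * t)))"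
proof -
  define f where "f = (\<lambda>n t. test_fun c t * (mangoldt n * real n powr (-a) * cos (la * t * y - la * t * ln (real n))))"
  have "uniform_limit {0..pi} (\<lambda>N t. \<Sum>n<N. f n t) (\<lambda>t. \<Sum>n. f n t) sequentially"
  proof (rule Weierstrass_m_test)
    fix n t assume t: "t \<in> {0..pi}"
    have "\<bar>test_fun c t\<bar> * (mangoldt n * real n powr (-a) * \<bar>cos (la * t * y - la * t * ln (real n))\<bar>) \<le> 6 * (mangoldt n * real n powr (-a) * 1)"
      by (intro mult_mono abs_test_fun_le c t order_refl) (auto simp: mangoldt_nonneg)
    then show "norm (f n t) \<le> 6 * (mangoldt n * real n powr (-a))" by (simp add: f_def abs_mult)
  qed (intro summable_mult summable_mangoldt_powr a)
  then obtain I J where I: "\<And>N. ((\<lambda>t. \<Sum>n<N. f n t) has_integral I N) {0..pi}"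
    and J: "((\<lambda>t. \<Sum>n. f n t) has_integral J) {0..pi}" and IJ: "I \<longlonglongrightarrow> J"
    by (rule uniform_limit_integral) (auto simp: f_def intro!: continuous_intros)
  have fs: "(\<lambda>n. f n t) sums (test_fun c t * Re (cis (la * t * y) * dir_mangoldt (Complex a (la * t))))" for t
    unfolding f_def by (intro sums_mult Re_cis_dir_mangoldt a)
  have "J = smoothed_integral c la y (\<lambda>t. dir_mangoldt (Complex a (la * t)))"
    unfolding smoothed_integral_def using integral_unique[OF J] by (simp add: sums_unique[OF fs, symmetric])
  moreover have "I = (\<lambda>N. \<Sum>n<N. mangoldt n * real n powr (-a) * test_kernel c (la * (y - ln (real n))))"
  proof
    fix N
    have 1: "I N = (\<Sum>n<N. integral {0..pi} (f n))"
      unfolding integral_unique[OF I, symmetric]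
      by (rule integral_sum) (auto simp: f_def intro!: integrable_continuous_interval continuous_intros)
    have 2: "integral {0..pi} (f n) = mangoldt n * real n powr (-a) * test_kernel c (la * (y - ln (real n)))" for n
    proof -
      have "f n = (\<lambda>t. mangoldt n * real n powr (-a) * (test_fun c t * cos (la * (y - ln (real n)) * t)))"
        by (simp add: f_def fun_eq_iff algebra_simps)
      then show ?thesis by (simp add: test_kernel_def)
    qed
    show "I N = (\<Sum>n<N. mangoldt n * real n powr (-a) * test_kernel c (la * (y - ln (real n))))"
      unfolding 1 2 ..
  qed
  ultimately show ?thesis using IJ by (simp only: sums_def)
qed

lemma integral_reflect_scale:
  fixes f :: "real \<Rightarrow> real"
  assumes f: "continuous_on UNIV f" and la: "la > 0" and U: "U \<ge> 0"
  shows "integral {0..U} (\<lambda>u. f (la * (y - u))) = 1 / la * integral {la * (y - U)..la * y} f"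
proof -
  let ?g = "\<lambda>u. la * (y - u)"
  have "((\<lambda>u. - la *\<^sub>R f (?g u)) has_integral (integral {?g 0..?g U} f - integral {?g U..?g 0} f)) {0..U}"
  proof (rule has_integral_substitution_general[of "{}"])
    show "?g ` {0..U} \<subseteq> {?g U..?g 0}" using la by (auto intro!: mult_left_mono)
  qed (use U f in \<open>auto intro!: continuous_intros derivative_eq_intros intro: continuous_on_subset\<close>)
  moreover have "integral {?g 0..?g U} f = 0"
    using la U by (cases "U = 0") auto
  ultimately have "((\<lambda>u. - (1 / la) * (- la *\<^sub>R f (?g u))) has_integral - (1 / la) * (0 - integral {?g U..?g 0} f)) {0..U}"
    by (intro has_integral_mult_right) simp
  then show ?thesis using la by (simp add: integral_unique)
qed

text \<open>Writes the pole \<open>1 / (d + i * la * t)\<close> as the Laplace integral of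
  \<open>exp (- z * u)\<close>. Truncation at \<open>U\<close> leaves compact intervals, on which
  the \<open>u\<close> and \<open>t\<close> integrals can be exchanged.\<close>

lemma pole_integral:
  assumes d: "d > 0" and U: "U \<ge> 0"
  shows "integral {0..U} (\<lambda>u. exp (- d * u) * cos (la * (y - u) * t))
     = Re (cis (la * t * y) * (1 - exp (- Complex d (la * t) * of_real U)) / Complex d (la * t))"
proof -
  define z where "z = Complex d (la * t)"
  have z: "z \<noteq> 0" using d by (simp add: z_def complex_eq_iff)
  have "((\<lambda>u. exp (- z * of_real u)) has_integral (- exp (- z * of_real U) / z - (- exp (- z * of_real 0) / z))) {0..U}"
  proof (rule fundamental_theorem_of_calculus[OF U])
    fix u :: real
    have "((\<lambda>u. - exp (- z * u) / z) has_field_derivative exp (- z * of_real u)) (at (of_real u))"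
      using z by (auto intro!: derivative_eq_intros)
    then have "((\<lambda>u. - exp (- z * of_real u) / z) has_vector_derivative exp (- z * of_real u)) (at u)"
      by (rule has_vector_derivative_real_field)
    then show "((\<lambda>u. - exp (- z * of_real u) / z) has_vector_derivative exp (- z * of_real u)) (at u within {0..U})"
      by (rule has_vector_derivative_at_within)
  qed
  from has_integral_linear[OF has_integral_mult_right[OF this, of "cis (la * t * y)"] bounded_linear_Re]
  have "((\<lambda>u. Re (cis (la * t * y) * exp (- z * of_real u))) has_integral 
      Re (cis (la * t * y) * (- exp (- z * of_real U) / z - (- exp (- z * of_real 0) / z)))) {0..U}"
    by (simp add: o_def)
  moreover have "Re (cis (la * t * y) * exp (- z * of_real u)) = exp (- d * u) * cos (la * (y - u) * t)" for u
  proof -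
    have "- z * of_real u = of_real (- d * u) + \<i> * of_real (- (la * t * u))"
      by (simp add: complex_eq_iff z_def)
    then have "exp (- z * of_real u) = of_real (exp (- d * u)) * cis (- (la * t * u))"
      by (simp only: exp_add cis_conv_exp exp_of_real)
    then have "cis (la * t * y) * exp (- z * of_real u) = of_real (exp (- d * u)) * cis (la * t * y + - (la * t * u))"
      by (simp only: cis_mult[symmetric] mult_ac)
    then show ?thesis by (simp add: algebra_simps)
  qed
  ultimately have "((\<lambda>u. exp (- d * u) * cos (la * (y - u) * t)) has_integral 
      Re (cis (la * t * y) * (- exp (- z * of_real U) / z - (- exp (- z * of_real 0) / z)))) {0..U}" by (simp only:)
  then have i: "integral {0..U} (\<lambda>u. exp (- d * u) * cos (la * (y - u) * t)) = 
      Re (cis (la * t * y) * (- exp (- z * of_real U) / z - (- exp (- z * of_real 0) / z)))"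
    by (rule integral_unique)
  have "- exp (- z * of_real U) / z - (- exp (- z * of_real 0) / z) = (1 - exp (- z * of_real U)) / z"
    by (simp add: diff_divide_distrib)
  then show ?thesis unfolding i z_def[symmetric] by (simp only: times_divide_eq_right)
qed

text \<open>Damping by \<open>exp (- d * u) <= 1\<close> only helps where the kernel is nonpositive.
  Where it is positive, \<open>u < y + 40 / la\<close>, so the loss is at most
  \<open>d * (y + 40 / la)\<close> times the bound \<open>120 / (1 + v^2)\<close>, which integrates
  to at most \<open>480 / la\<close>. The conditions on \<open>y\<close> and \<open>U\<close> ensure
  that the rescaled range contains \<open>{-1..1}\<close>.\<close>

lemma laplace_test_kernel_ge:
  fixes d la y :: real
  assumes d: "d > 0" and la: "la > 0" and y: "y \<ge> 1 / la" and U: "U \<ge> y + 1 / la"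
  shows "integral {0..U} (\<lambda>u. exp (- d * u) * test_kernel (1 / 1000) (la * (y - u)))
    \<ge> 1 / la - d * (y + 40 / la) * (480 / la)"
proof -
  let ?K = "test_kernel (1 / 1000)"
  have y0: "y > 0" using y la by (meson divide_pos_pos less_le_trans zero_less_one)
  have U0: "U \<ge> 0" using U y0 la by (meson add_nonneg_nonneg divide_nonneg_pos less_imp_le order_trans zero_le_one)
  have q: "continuous_on UNIV (\<lambda>v::real. 1 / (1 + v\<^sup>2))"
    by (intro continuous_intros) (auto simp: add_nonneg_eq_0_iff)
  have K: "continuous_on UNIV ?K" using continuous_test_kernel[OF continuous_on_id] by simp
  define D where "D = d * (y + 40 / la) * 120"
  have D: "D \<ge> 0" using d la y0 by (simp add: D_def)
  have "1 / la \<le> 1 / la * integral {la * (y - U)..la * y} ?K"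
  proof -
    have "la * (y - U) \<le> -1" "la * y \<ge> 1" using U y la by (auto simp: field_simps)
    from integral_test_kernel_ge[OF this] show ?thesis using la by (simp add: field_simps)
  qed
  also have "\<dots> = integral {0..U} (\<lambda>u. ?K (la * (y - u)))"
    by (rule integral_reflect_scale[OF K la U0, symmetric])
  finally have 1: "1 / la \<le> integral {0..U} (\<lambda>u. ?K (la * (y - u)))" .
  have "integral {0..U} (\<lambda>u. 1 / (1 + (la * (y - u))\<^sup>2)) = 1 / la * integral {la * (y - U)..la * y} (\<lambda>v. 1 / (1 + v\<^sup>2))"
    by (rule integral_reflect_scale[OF q la U0])
  also have "\<dots> \<le> 1 / la * 4"
    using integral_inverse_quadratic_le[of "la * (y - U)" "la * y"] pi_less_4 la by (intro mult_left_mono) auto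
  finally have 2: "integral {0..U} (\<lambda>u. 1 / (1 + (la * (y - u))\<^sup>2)) \<le> 4 / la" by simp
  have iK: "(\<lambda>u. ?K (la * (y - u))) integrable_on {0..U}"
    by (intro integrable_continuous_interval continuous_intros)
  have iq: "(\<lambda>u. 1 / (1 + (la * (y - u))\<^sup>2)) integrable_on {0..U}"
    by (intro integrable_continuous_interval continuous_intros) (auto simp: add_nonneg_eq_0_iff)
  have "1 / la - D * (4 / la) \<le> integral {0..U} (\<lambda>u. ?K (la * (y - u))) - D * integral {0..U} (\<lambda>u. 1 / (1 + (la * (y - u))\<^sup>2))"
    using 1 mult_left_mono[OF 2 D] by linarith
  also have "\<dots> = integral {0..U} (\<lambda>u. ?K (la * (y - u)) - D * (1 / (1 + (la * (y - u))\<^sup>2)))"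
    by (simp only: integral_diff[OF iK integrable_on_mult_right[OF iq]] integral_mult_right)
  also have "\<dots> \<le> integral {0..U} (\<lambda>u. exp (- d * u) * ?K (la * (y - u)))"
  proof (rule integral_le)
    show "(\<lambda>u. ?K (la * (y - u)) - D * (1 / (1 + (la * (y - u))\<^sup>2))) integrable_on {0..U}"
      by (intro integrable_diff iK integrable_on_mult_right iq)
    show "(\<lambda>u. exp (- d * u) * ?K (la * (y - u))) integrable_on {0..U}"
      by (intro integrable_continuous_interval continuous_intros)
    fix u assume u: "u \<in> {0..U}"
    let ?k = "?K (la * (y - u))"
    let ?q = "1 / (1 + (la * (y - u))\<^sup>2)"
    have e: "exp (- d * u) \<le> 1" "1 - exp (- d * u) \<le> d * u"
      using u d exp_ge_add_one_self[of "- d * u"] by auto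
    show "?k - D * ?q \<le> exp (- d * u) * ?k"
    proof (cases "?k \<le> 0")
      case True
      have "0 \<le> D * ?q" using D by (intro mult_nonneg_nonneg) auto
      moreover have "1 * ?k \<le> exp (- d * u) * ?k" using True e by (intro mult_right_mono_neg) auto
      ultimately show ?thesis by linarith
    next
      case False
      then have "\<not> \<bar>la * (y - u)\<bar> \<ge> 40" using test_kernel_nonpos by blast
      then have "la * (u - y) < 40" by (simp add: algebra_simps abs_le_iff not_le) 
      then have uy: "u \<le> y + 40 / la" using la by (simp add: field_simps)
      have "?k \<le> 120 * ?q" using abs_test_kernel_le[of "1 / 1000" "la * (y - u)"] by simp
      moreover have "1 - exp (- d * u) \<le> d * (y + 40 / la)"
        using e(2) mult_left_mono[OF uy, of d] d by linarith
      ultimately have "(1 - exp (- d * u)) * ?k \<le> d * (y + 40 / la) * (120 * ?q)"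
        using False d la y0 by (intro mult_mono) auto
      moreover have "d * (y + 40 / la) * (120 * ?q) = D * ?q" by (simp add: D_def)
      moreover have "(1 - exp (- d * u)) * ?k = ?k - exp (- d * u) * ?k" by (simp add: left_diff_distrib)
      ultimately show ?thesis by linarith
    qed
  qed
  finally show ?thesis by (simp add: D_def mult_ac)
qed

text \<open>Fubini on the truncated Laplace integral, then \<open>U\<close> to infinity. The
  truncation error is at most \<open>6 * pi * exp (- d * U) / d\<close>, hence the constant
  24.\<close>

lemma smoothed_integral_pole_ge:
  fixes d la y :: real
  assumes d: "d > 0" and la: "la > 0" and y: "y \<ge> 1 / la"
  shows "smoothed_integral (1 / 1000) la y (\<lambda>t. 1 / Complex d (la * t)) \<ge> 1 / la - d * (y + 40 / la) * (480 / la)"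
proof (rule tendsto_lowerbound)
  let ?c = "1 / 1000 :: real"
  let ?J = "smoothed_integral (1 / 1000) la y (\<lambda>t. 1 / Complex d (la * t))"
  let ?z = "\<lambda>t. Complex d (la * t)"
  have "((\<lambda>U. ?J + 24 * exp (- (d * U)) / d) \<longlongrightarrow> ?J + 24 * 0 / d) at_top"
    using d by (intro tendsto_intros filterlim_compose[OF exp_at_bot] filterlim_compose[OF filterlim_uminus_at_bot_at_top]
        filterlim_tendsto_pos_mult_at_top[OF tendsto_const] filterlim_ident) auto
  then show "((\<lambda>U. ?J + 24 * exp (- (d * U)) / d) \<longlongrightarrow> ?J) at_top" by simp
  have y0: "y > 0" using y la by (meson divide_pos_pos less_le_trans zero_less_one)
  have z0: "?z t \<noteq> 0" for t using d by (simp add: complex_eq_iff)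
  have cz: "continuous_on A ?z" for A unfolding Complex_eq by (intro continuous_intros)
  show "\<forall>\<^sub>F U in at_top. 1 / la - d * (y + 40 / la) * (480 / la) \<le> ?J + 24 * exp (- (d * U)) / d"
    using eventually_ge_at_top[of "y + 1 / la"]
  proof eventually_elim
    case (elim U)
    have U0: "U \<ge> 0" using elim y0 la by (meson add_nonneg_nonneg divide_nonneg_pos less_imp_le order_trans zero_le_one)
    let ?e = "\<lambda>t. cis (la * t * y) * exp (- ?z t * of_real U) / ?z t"
    have "1 / la - d * (y + 40 / la) * (480 / la) \<le> integral {0..U} (\<lambda>u. exp (- d * u) * test_kernel ?c (la * (y - u)))"
      by (rule laplace_test_kernel_ge[OF d la y elim])
    also have "\<dots> = integral {0..U} (\<lambda>u. integral {0..pi} (\<lambda>t. exp (- d * u) * (test_fun ?c t * cos (la * (y - u) * t))))"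
      by (simp add: test_kernel_def)
    also have "\<dots> = integral {0..pi} (\<lambda>t. integral {0..U} (\<lambda>u. exp (- d * u) * (test_fun ?c t * cos (la * (y - u) * t))))"
      using integral_swap_continuous[of 0 0 U pi "\<lambda>u t. exp (- d * u) * (test_fun ?c t * cos (la * (y - u) * t))"]
      by (simp add: split_beta continuous_intros)
    also have "\<dots> = integral {0..pi} (\<lambda>t. test_fun ?c t * Re (cis (la * t * y) * (1 / ?z t)) - test_fun ?c t * Re (?e t))"
    proof (rule integral_cong)
      fix t
      have "integral {0..U} (\<lambda>u. exp (- d * u) * (test_fun ?c t * cos (la * (y - u) * t)))
        = integral {0..U} (\<lambda>u. test_fun ?c t * (exp (- d * u) * cos (la * (y - u) * t)))" by (simp only: mult_ac)
      also have "\<dots> = test_fun ?c t * Re (cis (la * t * y) * (1 - exp (- ?z t * of_real U)) / ?z t)"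
        unfolding integral_mult_right pole_integral[OF d U0] ..
      also have "cis (la * t * y) * (1 - exp (- ?z t * of_real U)) / ?z t = cis (la * t * y) * (1 / ?z t) - ?e t"
        by (simp add: algebra_simps diff_divide_distrib)
      finally show "integral {0..U} (\<lambda>u. exp (- d * u) * (test_fun ?c t * cos (la * (y - u) * t)))
        = test_fun ?c t * Re (cis (la * t * y) * (1 / ?z t)) - test_fun ?c t * Re (?e t)"
        by (simp only: minus_complex.sel right_diff_distrib)
    qed
    also have "\<dots> = ?J - integral {0..pi} (\<lambda>t. test_fun ?c t * Re (?e t))"
      unfolding smoothed_integral_def
      by (intro integral_diff integrable_continuous_interval continuous_intros cz) (use z0 in auto)
    also have "\<dots> \<le> ?J + norm (integral {0..pi} (\<lambda>t. test_fun ?c t * Re (?e t)))" by simp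
    also have "norm (integral {0..pi} (\<lambda>t. test_fun ?c t * Re (?e t))) \<le> integral {0..pi} (\<lambda>t. 6 * (exp (- (d * U)) / d))"
    proof (rule integral_norm_bound_integral)
      show "(\<lambda>t. test_fun ?c t * Re (?e t)) integrable_on {0..pi}"
        by (intro integrable_continuous_interval continuous_intros cz) (use z0 in auto)
      fix t assume t: "t \<in> {0..pi}"
      have "\<bar>Re (?e t)\<bar> \<le> norm (?e t)" by (rule abs_Re_le_cmod)
      also have "\<dots> = exp (- (d * U)) / norm (?z t)" by (simp add: norm_mult norm_divide)
      also have "\<dots> \<le> exp (- (d * U)) / d"
        using d complex_Re_le_cmod[of "?z t"] z0[of t] by (intro divide_left_mono mult_pos_pos) auto
      finally have "\<bar>test_fun ?c t\<bar> * \<bar>Re (?e t)\<bar> \<le> 6 * (exp (- (d * U)) / d)"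
        using abs_test_fun_le[OF _ t, of ?c] by (intro mult_mono) auto
      then show "norm (test_fun ?c t * Re (?e t)) \<le> 6 * (exp (- (d * U)) / d)" by (simp only: real_norm_def abs_mult)
    qed (rule integrable_const_ivl)
    also have "integral {0..pi} (\<lambda>t. 6 * (exp (- (d * U)) / d)) \<le> 24 * exp (- (d * U)) / d"
      using pi_less_4 d by (simp add: mult_right_mono divide_right_mono)
    finally show ?case by simp
  qed
qed simp

section \<open>The contribution away from the pole\<close>

text \<open>One integration by parts gains a factor \<open>1 / x\<close>; \<open>C\<close> collects
  the boundary values and the integral of the derivative.\<close>

lemma riemann_lebesgue_C1:
  fixes g g' :: "real \<Rightarrow> complex"
  assumes ab: "a \<le> b" and g: "\<And>t. t \<in> {a..b} \<Longrightarrow> (g has_vector_derivative g' t) (at t within {a..b})"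
    and g': "continuous_on {a..b} g'"
  shows "((\<lambda>x. integral {a..b} (\<lambda>t. g t * cis (x * t))) \<longlongrightarrow> 0) at_top"
proof (rule Lim_null_comparison)
  define C where "C = norm (g b) + norm (g a) + integral {a..b} (\<lambda>t. norm (g' t))"
  show "((\<lambda>x. C / x) \<longlongrightarrow> 0) at_top" by (intro tendsto_divide_0[OF tendsto_const] filterlim_at_top_imp_at_infinity filterlim_ident)
  have cg: "continuous_on {a..b} g" 
    by (rule continuous_on_vector_derivative[OF g])
  show "\<forall>\<^sub>F x in at_top. norm (integral {a..b} (\<lambda>t. g t * cis (x * t))) \<le> C / x"
    using eventually_gt_at_top[of 0]
  proof eventually_elim
    case (elim x)
    have "((\<lambda>t. g t * (cis (x * t) / (\<i> * x))) has_vector_derivative 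
        (g t * cis (x * t) + g' t * (cis (x * t) / (\<i> * x)))) (at t within {a..b})" if t: "t \<in> {a..b}" for t
    proof -
      have "((\<lambda>z. exp (\<i> * x * z) / (\<i> * x)) has_field_derivative exp (\<i> * x * of_real t)) (at (of_real t))"
        using elim by (auto intro!: derivative_eq_intros)
      then have "((\<lambda>t. exp (\<i> * x * of_real t) / (\<i> * x)) has_vector_derivative exp (\<i> * x * of_real t)) (at t within {a..b})"
        by (rule has_vector_derivative_at_within[OF has_vector_derivative_real_field])
      then have "((\<lambda>t. cis (x * t) / (\<i> * x)) has_vector_derivative cis (x * t)) (at t within {a..b})"
        by (simp add: cis_conv_exp mult.assoc)
      from has_vector_derivative_mult[OF g[OF t] this] show ?thesis .
    qed
    from fundamental_theorem_of_calculus[OF ab this]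
    have i1: "((\<lambda>t. g t * cis (x * t) + g' t * (cis (x * t) / (\<i> * x))) has_integral
        (g b * (cis (x * b) / (\<i> * x)) - g a * (cis (x * a) / (\<i> * x)))) {a..b}" by simp
    have i2: "(\<lambda>t. g' t * (cis (x * t) / (\<i> * x))) integrable_on {a..b}"
      using elim by (intro integrable_continuous_interval continuous_intros g') auto
    have "integral {a..b} (\<lambda>t. g t * cis (x * t)) = 
        g b * (cis (x * b) / (\<i> * x)) - g a * (cis (x * a) / (\<i> * x)) - integral {a..b} (\<lambda>t. g' t * (cis (x * t) / (\<i> * x)))"
      using has_integral_diff[OF i1 integrable_integral[OF i2]] by (intro integral_unique) simp
    also have "norm \<dots> \<le> norm (g b * (cis (x * b) / (\<i> * x))) + norm (g a * (cis (x * a) / (\<i> * x))) + norm (integral {a..b} (\<lambda>t. g' t * (cis (x * t) / (\<i> * x))))"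
      by (meson norm_triangle_ineq4 order_trans add_right_mono)
    also have "norm (integral {a..b} (\<lambda>t. g' t * (cis (x * t) / (\<i> * x)))) \<le> integral {a..b} (\<lambda>t. norm (g' t) / x)"
    proof (rule integral_norm_bound_integral[OF i2])
      show "(\<lambda>t. norm (g' t) / x) integrable_on {a..b}"
        using elim by (intro integrable_continuous_interval continuous_intros g') auto
    qed (use elim in \<open>simp add: norm_mult norm_divide\<close>)
    also have "\<dots> = integral {a..b} (\<lambda>t. norm (g' t)) / x" by simp
    finally show ?case using elim by (simp add: C_def norm_mult norm_divide add_divide_distrib)
  qed
qed

text \<open>With \<open>scaled_zeta s = (s - 1) * zeta(s)\<close> this is
  \<open>- zeta'/zeta - 1 / (s - 1)\<close>: the logarithmic derivative with its pole at 1
  removed.\<close>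

definition zeta_logderiv :: "complex \<Rightarrow> complex" where
  "zeta_logderiv s = - deriv scaled_zeta s / scaled_zeta s"

lemma zeta_logderiv_holomorphic: "zeta_logderiv holomorphic_on {s. Re s > 0 \<and> scaled_zeta s \<noteq> 0}"
  and open_zeta_logderiv: "open {s. Re s > 0 \<and> scaled_zeta s \<noteq> 0}"
proof -
  let ?S = "{s. Re s > 0}"
  have h: "scaled_zeta holomorphic_on ?S" by (rule scaled_zeta_holomorphic)
  show "zeta_logderiv holomorphic_on {s. Re s > 0 \<and> scaled_zeta s \<noteq> 0}"
    unfolding zeta_logderiv_def
    by (intro holomorphic_intros holomorphic_on_subset[OF h] holomorphic_on_subset[OF holomorphic_deriv[OF h open_connected_Re_pos(1)]]) auto
  have "open (scaled_zeta -` (- {0}) \<inter> ?S)"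
    using holomorphic_on_imp_continuous_on[OF h] open_connected_Re_pos(1)
    by (subst continuous_on_open_vimage[THEN iffD1, rule_format]) (auto simp: open_Compl)
  also have "scaled_zeta -` (- {0}) \<inter> ?S = {s. Re s > 0 \<and> scaled_zeta s \<noteq> 0}" by auto
  finally show "open {s. Re s > 0 \<and> scaled_zeta s \<noteq> 0}" .
qed

lemma zeta_logderiv_continuous: "continuous_on {s. Re s \<ge> 1} zeta_logderiv"
  by (rule continuous_on_subset[OF holomorphic_on_imp_continuous_on[OF zeta_logderiv_holomorphic]])
     (use scaled_zeta_nonzero in force)

text \<open>Nonvanishing on \<open>Re s = 1\<close> makes the integrand continuously differentiable
  in \<open>t\<close>, and the frequency \<open>la * y\<close> tends to infinity.\<close>

lemma smoothed_integral_tendsto_0: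
  assumes la: "la > 0"
  shows "((\<lambda>y. smoothed_integral c la y (\<lambda>t. zeta_logderiv (Complex 1 (la * t)))) \<longlongrightarrow> 0) at_top"
proof -
  let ?D = "{s. Re s > 0 \<and> scaled_zeta s \<noteq> 0}"
  let ?z = "\<lambda>t. 1 + \<i> * of_real la * of_real t"
  have zC: "Complex 1 (la * t) = ?z t" for t by (simp add: complex_eq_iff)
  have zD: "?z t \<in> ?D" for t by (simp add: scaled_zeta_nonzero)
  define g where "g = (\<lambda>t. of_real (test_fun c t) * zeta_logderiv (?z t))"
  define f' where "f' = (\<lambda>t. - (1 - c) * cos t - (1 - c) * (pi - t) * sin t + (1 + c) * cos t)"
  define g' where "g' = (\<lambda>t. of_real (test_fun c t) * (deriv zeta_logderiv (?z t) * (\<i> * la)) + of_real (f' t) * zeta_logderiv (?z t))"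
  have g: "(g has_vector_derivative g' t) (at t within {0..pi})" for t
  proof -
    have "(test_fun c has_real_derivative f' t) (at t within {0..pi})"
      unfolding test_fun_def f'_def by (auto intro!: derivative_eq_intros)
    then have 1: "((\<lambda>t. of_real (test_fun c t)) has_vector_derivative of_real (f' t)) (at t within {0..pi})"
      by (intro has_vector_derivative_of_real) (simp add: has_real_derivative_iff_has_vector_derivative)
    have 2: "(zeta_logderiv has_field_derivative deriv zeta_logderiv (?z t)) (at (?z t))"
      by (rule holomorphic_derivI[OF zeta_logderiv_holomorphic open_zeta_logderiv zD])
    have 3: "((\<lambda>w. 1 + \<i> * of_real la * w) has_field_derivative \<i> * la) (at (of_real t))"
      by (auto intro!: derivative_eq_intros)
    from DERIV_chain2[of zeta_logderiv "deriv zeta_logderiv (?z t)" "\<lambda>w. 1 + \<i> * of_real la * w" "of_real t" "\<i> * la" UNIV, OF 2 3]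
    have "((\<lambda>w. zeta_logderiv (1 + \<i> * of_real la * w)) has_field_derivative deriv zeta_logderiv (?z t) * (\<i> * la)) (at (of_real t))" .
    then have "((\<lambda>t. zeta_logderiv (?z t)) has_vector_derivative deriv zeta_logderiv (?z t) * (\<i> * la)) (at t within {0..pi})"
      by (rule has_vector_derivative_at_within[OF has_vector_derivative_real_field])
    from has_vector_derivative_mult[OF 1 this] show ?thesis unfolding g_def g'_def .
  qed
  have cz: "continuous_on {0..pi} (\<lambda>t. zeta_logderiv (?z t))"
    by (rule continuous_on_compose2[OF holomorphic_on_imp_continuous_on[OF zeta_logderiv_holomorphic]])
       (use zD in \<open>auto intro!: continuous_intros\<close>)
  have cz': "continuous_on {0..pi} (\<lambda>t. deriv zeta_logderiv (?z t))"
    by (rule continuous_on_compose2[OF holomorphic_on_imp_continuous_on[OF holomorphic_deriv[OF zeta_logderiv_holomorphic open_zeta_logderiv]]])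
       (use zD in \<open>auto intro!: continuous_intros\<close>)
  have cg': "continuous_on {0..pi} g'"
    unfolding g'_def f'_def by (intro continuous_intros cz cz')
  have cg: "continuous_on {0..pi} g" unfolding g_def by (intro continuous_intros cz)
  have "((\<lambda>x. integral {0..pi} (\<lambda>t. g t * cis (x * t))) \<longlongrightarrow> 0) at_top"
    by (rule riemann_lebesgue_C1[OF _ g cg']) simp
  then have "((\<lambda>y. integral {0..pi} (\<lambda>t. g t * cis (la * y * t))) \<longlongrightarrow> 0) at_top"
    by (rule filterlim_compose) (use la in \<open>auto intro!: filterlim_tendsto_pos_mult_at_top[OF tendsto_const] filterlim_ident\<close>)
  then have "((\<lambda>y. Re (integral {0..pi} (\<lambda>t. g t * cis (la * y * t)))) \<longlongrightarrow> Re 0) at_top" by (rule tendsto_Re)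
  moreover have "Re (integral {0..pi} (\<lambda>t. g t * cis (la * y * t))) = smoothed_integral c la y (\<lambda>t. zeta_logderiv (Complex 1 (la * t)))" for y
  proof -
    have "(\<lambda>t. g t * cis (la * y * t)) integrable_on {0..pi}"
      by (intro integrable_continuous_interval continuous_intros cg)
    from integral_linear[OF this bounded_linear_Re]
    have "Re (integral {0..pi} (\<lambda>t. g t * cis (la * y * t))) = integral {0..pi} (\<lambda>t. Re (g t * cis (la * y * t)))"
      by (simp add: o_def)
    also have "(\<lambda>t. Re (g t * cis (la * y * t))) = (\<lambda>t. test_fun c t * Re (cis (la * t * y) * zeta_logderiv (Complex 1 (la * t))))"
    proof
      fix t
      have "Re (of_real r * Z * C) = r * Re (C * Z)" for r Z C by (simp add: algebra_simps)
      then show "Re (g t * cis (la * y * t)) = test_fun c t * Re (cis (la * t * y) * zeta_logderiv (Complex 1 (la * t)))"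
        unfolding g_def zC by (simp only: mult.assoc mult.commute[of y])
    qed
    finally show ?thesis by (simp add: smoothed_integral_def)
  qed
  ultimately show ?thesis by simp
qed

text \<open>With the pole split off, the integrand extends continuously to \<open>d = 0\<close>, and
  the heights \<open>la * t\<close> stay in a compact interval.\<close>

lemma smoothed_integral_tendsto:
  "((\<lambda>d. smoothed_integral c la y (\<lambda>t. zeta_logderiv (Complex (1 + d) (la * t)))) \<longlongrightarrow>
    smoothed_integral c la y (\<lambda>t. zeta_logderiv (Complex 1 (la * t)))) (at_right 0)"
proof -
  have "continuous_on {0..} (\<lambda>d. integral (cbox 0 pi) (\<lambda>t. test_fun c t * Re (cis (la * t * y) * zeta_logderiv (Complex (1 + d) (la * t)))))"
  proof (rule integral_continuous_on_param)
    have "continuous_on ({0..} \<times> cbox 0 pi) (\<lambda>x. zeta_logderiv (Complex (1 + fst x) (la * snd x)))"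
      by (rule continuous_on_compose2[OF zeta_logderiv_continuous]) (auto simp: Complex_eq intro!: continuous_intros)
    then show "continuous_on ({0..} \<times> cbox 0 pi) (\<lambda>(d, t). test_fun c t * Re (cis (la * t * y) * zeta_logderiv (Complex (1 + d) (la * t))))"
      unfolding split_beta by (intro continuous_intros)
  qed
  from this[unfolded continuous_on_def, rule_format, of 0]
  have "((\<lambda>d. smoothed_integral c la y (\<lambda>t. zeta_logderiv (Complex (1 + d) (la * t)))) \<longlongrightarrow>
    smoothed_integral c la y (\<lambda>t. zeta_logderiv (Complex (1 + 0) (la * t)))) (at 0 within {0..})"
    unfolding smoothed_integral_def by simp
  then show ?thesis by (auto intro: tendsto_within_subset)
qed

lemma smoothed_integral_mangoldt:
  assumes d: "d > 0"
  shows "smoothed_integral c la y (\<lambda>t. dir_mangoldt (Complex (1 + d) (la * t))) =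
    smoothed_integral c la y (\<lambda>t. 1 / Complex d (la * t)) + smoothed_integral c la y (\<lambda>t. zeta_logderiv (Complex (1 + d) (la * t)))"
proof -
  have z0: "Complex d (la * t) \<noteq> 0" for t using d by (simp add: complex_eq_iff)
  have e: "dir_mangoldt (Complex (1 + d) (la * t)) = 1 / Complex d (la * t) + zeta_logderiv (Complex (1 + d) (la * t))" for t
  proof -
    have "Complex (1 + d) (la * t) - 1 = Complex d (la * t)" by (simp add: complex_eq_iff)
    then show ?thesis using d by (subst dir_mangoldt_eq) (simp_all add: zeta_logderiv_def)
  qed
  have "continuous_on {0..pi} (\<lambda>t. zeta_logderiv (Complex (1 + d) (la * t)))"
    by (rule continuous_on_compose2[OF zeta_logderiv_continuous]) (use d in \<open>auto simp: Complex_eq intro!: continuous_intros\<close>)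
  moreover have "continuous_on {0..pi} (\<lambda>t. Complex d (la * t))" unfolding Complex_eq by (intro continuous_intros)
  ultimately show ?thesis
    unfolding smoothed_integral_def e
    by (subst integral_add[symmetric]) (use z0 in \<open>auto simp: ring_distribs intro!: integrable_continuous_interval continuous_intros\<close>)
qed

section \<open>From the smoothed sum to primes\<close>

text \<open>For each \<open>p\<close> the geometric series over \<open>k >= 2\<close> is at most
  \<open>2 / p^2\<close>, and \<open>ln p <= 2 * sqrt p\<close> then leaves the summable
  \<open>4 * p powr (-3/2)\<close>.\<close>

lemma summable_higher_prime_powers: "summable (\<lambda>n. if prime n then 0 else mangoldt n / real n)"
proof (rule summableI_nonneg_bounded)
  let ?a = "\<lambda>n::nat. if prime n then 0 else mangoldt n / real n"
  show "0 \<le> ?a n" for n by (simp add: mangoldt_nonneg)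
  have s: "summable (\<lambda>p. 4 * real p powr (-3/2))"
    by (intro summable_mult) (simp add: summable_real_powr_iff)
  fix N :: nat
  let ?S = "{n. n < N \<and> primepow n \<and> \<not> prime n}"
  let ?g = "\<lambda>(p, k). ln (real p) * (1 / real p) ^ k"
  have "sum ?a {..<N} = sum ?a ?S"
    by (rule sum.mono_neutral_right) (auto simp: mangoldt_def)
  also have "\<dots> \<le> sum ?g ({2..<N} \<times> {2..<N})"
  proof (rule sum_le_included[where i = "\<lambda>(p, k). p ^ k"])
    show "\<forall>y\<in>{2..<N} \<times> {2..<N}. 0 \<le> ?g y" by auto
    show "\<forall>x\<in>?S. \<exists>y\<in>{2..<N} \<times> {2..<N}. (case y of (p, k) \<Rightarrow> p ^ k) = x \<and> ?a x \<le> ?g y"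
    proof
      fix n assume n: "n \<in> ?S"
      then obtain p k where pk: "prime p" "k > 0" "n = p ^ k" by (auto simp: primepow_def)
      have p2: "p \<ge> 2" using pk(1) prime_ge_2_nat by blast
      have "k \<noteq> 1" using n pk by auto
      then have k: "k \<ge> 2" using pk(2) by linarith
      have "p < p ^ k" using power_strict_increasing[of 1 k p] p2 k by simp
      moreover have "k < p ^ k" using p2 by (simp add: power_gt_expt)
      ultimately have "(p, k) \<in> {2..<N} \<times> {2..<N}" using n pk p2 k by auto
      moreover have "?a n = ?g (p, k)" using n pk by (simp add: power_divide)
      ultimately show "\<exists>y\<in>{2..<N} \<times> {2..<N}. (case y of (p, k) \<Rightarrow> p ^ k) = n \<and> ?a n \<le> ?g y"
        using pk by (intro bexI[of _ "(p, k)"]) auto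
    qed
  qed auto
  also have "\<dots> = (\<Sum>p=2..<N. ln (real p) * (\<Sum>k=2..<N. (1 / real p) ^ k))"
    by (simp add: sum.cartesian_product[symmetric] sum_distrib_left)
  also have "\<dots> \<le> (\<Sum>p=2..<N. 4 * real p powr (-3/2))"
  proof (rule sum_mono)
    fix p assume p: "p \<in> {2..<N}"
    define x where "x = 1 / real p"
    have x: "0 < x" "x \<le> 1 / 2" using p by (auto simp: x_def field_simps)
    have x2: "x ^ k = x\<^sup>2 * x ^ (k - 2)" if "k \<ge> 2" for k
      by (metis that power_add le_add_diff_inverse)
    have "(\<Sum>k=2..<N. x ^ k) = x\<^sup>2 * (\<Sum>k=2..<N. x ^ (k - 2))"
      unfolding sum_distrib_left by (intro sum.cong refl x2) simp
    also have "(\<Sum>k=2..<N. x ^ (k - 2)) = (\<Sum>k<N - 2. x ^ k)"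
      by (rule sum.reindex_bij_witness[of _ "\<lambda>k. 2 + k" "\<lambda>k. k - 2"]) auto
    also have "(\<Sum>k<N - 2. x ^ k) \<le> 2"
    proof -
      have "(\<Sum>k<N - 2. x ^ k) = (1 - x ^ (N - 2)) / (1 - x)" using x by (intro sum_gp_strict[THEN trans]) auto
      also have "\<dots> \<le> 1 / (1 / 2)" using x by (intro frac_le) (auto simp: power_le_one)
      finally show ?thesis by simp
    qed
    finally have 1: "(\<Sum>k=2..<N. x ^ k) \<le> x\<^sup>2 * 2" using x by (simp add: mult_left_mono)
    have "ln (real p) \<le> real p powr (1 / 2) / (1 / 2)" using p by (intro ln_le_powr) auto
    then have "ln (real p) * (\<Sum>k=2..<N. x ^ k) \<le> (real p powr (1 / 2) / (1 / 2)) * (x\<^sup>2 * 2)"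
      using 1 x p by (intro mult_mono) (auto intro!: sum_nonneg)
    also have "x\<^sup>2 = real p powr (-2)" using p by (simp add: x_def powr_minus powr_numeral power_divide inverse_eq_divide)
    also have "real p powr (1 / 2) / (1 / 2) * (real p powr (-2) * 2) = 4 * real p powr (-3/2)"
      by (simp add: powr_add[symmetric])
    finally show "ln (real p) * (\<Sum>k=2..<N. (1 / real p) ^ k) \<le> 4 * real p powr (-3/2)" by (simp add: x_def)
  qed
  also have "\<dots> \<le> (\<Sum>p. 4 * real p powr (-3/2))"
    by (rule sum_le_suminf[OF s]) auto
  finally show "sum ?a {..<N} \<le> (\<Sum>p. 4 * real p powr (-3/2))" .
qed

text \<open>If the window contained no prime, the smoothed sum over the von Mangoldt function would be at most
  the contribution of proper prime powers, since the kernel is nonpositive outside the window; but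
  the pole of the zeta function contributes at least \<open>1 / la\<close>.\<close>

lemma prime_in_log_window:
  assumes la: "la > 0"
  shows "\<forall>\<^sub>F y in at_top. \<exists>p::nat. prime p \<and> \<bar>ln (real p) - y\<bar> < 40 / la"
proof -
  let ?c = "1 / 1000 :: real"
  let ?R = "\<lambda>d y. smoothed_integral ?c la y (\<lambda>t. zeta_logderiv (Complex (1 + d) (la * t)))"
  define a where "a = (\<lambda>n::nat. if prime n then 0 else mangoldt n / real n)"
  have a0: "a n \<ge> 0" for n by (simp add: a_def mangoldt_nonneg)
  have sa: "summable a" using summable_higher_prime_powers by (simp add: a_def)
  \<comment> \<open>Multiplied by the kernel bound 120, this tail stays below
    \<open>1 / (4 * la)\<close>.\<close>
  obtain N where N: "norm (\<Sum>i. a (i + N)) < 1 / (480 * la)"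
    using suminf_exist_split[OF _ sa, of "1 / (480 * la)"] la by auto
  have "\<forall>\<^sub>F y in at_top. norm (?R 0 y) < 1 / (4 * la)"
    using smoothed_integral_tendsto_0[OF la, of ?c] la
    by (auto simp: tendsto_iff dest!: spec[of _ "1 / (4 * la)"])
  then show ?thesis
    using eventually_ge_at_top[of "1 / la"] eventually_ge_at_top[of "ln (real (Suc N)) + 40 / la"]
  proof eventually_elim
    case (elim y)
    show ?case
    proof (rule ccontr)
      assume no: "\<not> ?thesis"
      \<comment> \<open>Terms below \<open>N\<close> may be dropped: \<open>y\<close> is so large
        that they lie outside the window, where the kernel is nonpositive.\<close>
      define b where "b = (\<lambda>n. if n < N then 0 else 120 * a n)"
      have b: "b sums (120 * (\<Sum>i. a (i + N)))"
      proof -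
        have "(\<lambda>i. b (i + N)) sums (120 * (\<Sum>i. a (i + N)))"
          unfolding b_def using sums_mult[OF summable_sums[OF summable_ignore_initial_segment[OF sa, of N]], of 120] by simp
        then show ?thesis by (subst (asm) sums_iff_shift) (simp add: b_def)
      qed
      have le: "smoothed_integral ?c la y (\<lambda>t. dir_mangoldt (Complex (1 + d) (la * t))) \<le> 1 / (4 * la)" if d: "d > 0" for d
      proof -
        have "smoothed_integral ?c la y (\<lambda>t. dir_mangoldt (Complex (1 + d) (la * t))) \<le> 120 * (\<Sum>i. a (i + N))"
        proof (rule sums_le[OF _ kernel_sums b])
          fix n
          let ?v = "la * (y - ln (real n))"
          have b0: "b n \<ge> 0" using a0 by (simp add: b_def)
          have w: "mangoldt n * real n powr - (1 + d) \<ge> 0" by (simp add: mangoldt_nonneg)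
          show "mangoldt n * real n powr - (1 + d) * test_kernel ?c ?v \<le> b n"
          proof (cases "n = 0 \<or> \<bar>?v\<bar> \<ge> 40")
            case True
            then have "mangoldt n * real n powr - (1 + d) * test_kernel ?c ?v \<le> 0"
              using mult_nonneg_nonpos[OF w] test_kernel_nonpos by auto
            then show ?thesis using b0 by linarith
          next
            case False
            then have n: "n > 0" and v: "\<bar>?v\<bar> < 40" by auto
            have "\<bar>ln (real n) - y\<bar> < 40 / la"
            proof -
              have "\<bar>?v\<bar> = la * \<bar>ln (real n) - y\<bar>" using la by (simp add: abs_mult abs_minus_commute)
              then show ?thesis using v la by (simp add: field_simps)
            qed
            then have np: "\<not> prime n" and "ln (real n) > y - 40 / la" using no by auto
            then have "ln (real n) > ln (real (Suc N))" using elim by linarith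
            then have "n > N" using n by (subst (asm) ln_less_cancel_iff) auto
            have "test_kernel ?c ?v \<le> 120 / (1 + ?v\<^sup>2)" using abs_test_kernel_le[of ?c ?v] by simp
            also have "\<dots> \<le> 120" by (simp add: divide_le_eq add_pos_nonneg)
            finally have "mangoldt n * real n powr - (1 + d) * test_kernel ?c ?v \<le> mangoldt n * real n powr - (1 + d) * 120"
              using w by (rule mult_left_mono)
            also have "\<dots> \<le> mangoldt n * real n powr (-1) * 120"
              using n d by (intro mult_right_mono mult_left_mono powr_mono) (auto simp: mangoldt_nonneg)
            also have "\<dots> = b n" using np n \<open>n > N\<close> by (simp add: b_def a_def powr_minus field_simps)
            finally show ?thesis .
          qed
        qed (use d in auto)
        also have "\<dots> \<le> 120 * (1 / (480 * la))" using N by (intro mult_left_mono) auto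
        finally show ?thesis by simp
      qed
      \<comment> \<open>The product with 0 is kept so that the left side is literally the limit as
        \<open>d\<close> tends to 0. Together with \<open>?R 0 y > - 1 / (4 * la)\<close> it
        contradicts the size of the pole term.\<close>
      have "?R 0 y + 1 / la - 0 * ((y + 40 / la) * (480 / la)) \<le> 1 / (4 * la)"
      proof (rule tendsto_upperbound)
        show "((\<lambda>d. ?R d y + 1 / la - d * ((y + 40 / la) * (480 / la))) \<longlongrightarrow> ?R 0 y + 1 / la - 0 * ((y + 40 / la) * (480 / la))) (at_right 0)"
          using smoothed_integral_tendsto[of ?c la y] by (intro tendsto_intros) simp
        show "\<forall>\<^sub>F d in at_right 0. ?R d y + 1 / la - d * ((y + 40 / la) * (480 / la)) \<le> 1 / (4 * la)"
          unfolding eventually_at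
        proof (intro exI[of _ 1] conjI ballI impI)
          fix d :: real assume "d \<in> {0<..}"
          then have d: "d > 0" by simp
          show "?R d y + 1 / la - d * ((y + 40 / la) * (480 / la)) \<le> 1 / (4 * la)"
            using le[OF d] smoothed_integral_pole_ge[OF d la elim(2)] smoothed_integral_mangoldt[OF d, of ?c la y]
            by (simp only: mult.assoc)
        qed simp
      qed simp
      moreover have "?R 0 y > - (1 / (4 * la))" using elim(1) by (simp add: abs_less_iff)
      moreover have "1 / la = 4 * (1 / (4 * la))" "1 / (4 * la) > 0" using la by simp_all
      ultimately show False by linarith
    qed
  qed
qed

lemma prime_in_short_interval:
  assumes e: "e > 0"
  shows "\<forall>\<^sub>F x in at_top. \<exists>p::nat. prime p \<and> x < real p \<and> real p < (1 + e) * x"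
proof -
  \<comment> \<open>A window of radius \<open>w\<close> around \<open>ln x + w\<close> is exactly
    the interval from \<open>ln x\<close> to \<open>ln ((1 + e) * x)\<close>;
    \<open>la = 40 / w\<close> gives that radius.\<close>
  define w where "w = ln (1 + e) / 2"
  have w: "w > 0" using e by (simp add: w_def)
  have "\<forall>\<^sub>F y in at_top. \<exists>p::nat. prime p \<and> \<bar>ln (real p) - y\<bar> < 40 / (40 / w)"
    by (rule prime_in_log_window) (use w in simp)
  then have "\<forall>\<^sub>F y in at_top. \<exists>p::nat. prime p \<and> \<bar>ln (real p) - y\<bar> < w" using w by simp
  moreover have "filterlim (\<lambda>x::real. ln x + w) at_top at_top"
    using filterlim_tendsto_add_at_top[OF tendsto_const[of w] ln_at_top] by (simp add: add.commute)
  ultimately have "\<forall>\<^sub>F x in at_top. \<exists>p::nat. prime p \<and> \<bar>ln (real p) - (ln x + w)\<bar> < w"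
    by (auto simp: filterlim_iff)
  then show ?thesis using eventually_gt_at_top[of 0]
  proof eventually_elim
    case (elim x)
    then obtain p :: nat where p: "prime p" "\<bar>ln (real p) - (ln x + w)\<bar> < w" by blast
    have p0: "real p > 0" using p(1) prime_gt_0_nat by simp
    have "ln x < ln (real p)" using p(2) by linarith
    then have 1: "x < real p" using elim p0 by simp
    have "ln (real p) < (w + w) + ln x" using p(2) by linarith
    also have "w + w = ln (1 + e)" by (simp add: w_def)
    also have "ln (1 + e) + ln x = ln ((1 + e) * x)" using e elim by (simp add: ln_mult_pos)
    finally have "real p < (1 + e) * x" using e elim p0 by simp
    with 1 p(1) show ?case by blast
  qed
qed

definition next_prime :: "nat \<Rightarrow> nat" where
  "next_prime n = (LEAST p. prime p \<and> n \<le> p)"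

lemma next_prime: "prime (next_prime n)" "n \<le> next_prime n"
proof -
  obtain p :: nat where "prime p" "n < p" using bigger_prime[of n] by blast
  then have "prime (next_prime n) \<and> n \<le> next_prime n"
    unfolding next_prime_def using LeastI[of "\<lambda>p. prime p \<and> n \<le> p" p] by simp
  then show "prime (next_prime n)" "n \<le> next_prime n" by auto
qed

lemma next_prime_asymp: "(\<lambda>n. real (next_prime n) / real n) \<longlonglongrightarrow> 1"
proof (rule LIMSEQ_I)
  fix e :: real assume e: "e > 0"
  have "\<forall>\<^sub>F n in sequentially. \<exists>p::nat. prime p \<and> real n < real p \<and> real p < (1 + e) * real n"
    by (rule eventually_compose_filterlim[OF prime_in_short_interval[OF e] filterlim_real_sequentially])
  then have "\<forall>\<^sub>F n in sequentially. norm (real (next_prime n) / real n - 1) < e"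
    using eventually_gt_at_top[of 0]
  proof eventually_elim
    case (elim n)
    then obtain p :: nat where p: "prime p" "real n < real p" "real p < (1 + e) * real n" by blast
    have "next_prime n \<le> p" 
      unfolding next_prime_def using p Least_le[of "\<lambda>p. prime p \<and> n \<le> p" p] by simp
    then have "real (next_prime n) / real n < 1 + e" using p elim by (simp add: divide_less_eq)
    moreover have "1 \<le> real (next_prime n) / real n" using next_prime(2)[of n] elim by simp
    ultimately show ?case by simp
  qed
  then show "\<exists>no. \<forall>n\<ge>no. norm (real (next_prime n) / real n - 1) < e" by (simp add: eventually_sequentially)
qed

section \<open>Power sums modulo a prime\<close>

text \<open>The reversed polynomial with roots \<open>1 / y\<close>: its constant term is 1 and its
  coefficients are the signed elementary symmetric functions. An element 0 contributes the factor 1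
  and is invisible.\<close>

definition root_poly :: "int multiset \<Rightarrow> int poly" where
  "root_poly Y = (\<Prod>y\<in>#Y. [:1, - y:])"

lemma root_poly_simps [simp]: "root_poly {#} = 1" "root_poly (add_mset y Y) = [:1, - y:] * root_poly Y"
  by (simp_all add: root_poly_def)

lemma poly_root_poly: "poly (root_poly Y) b = (\<Prod>y\<in>#Y. 1 - y * b)"
  by (induction Y) (auto simp: algebra_simps)

lemma degree_root_poly_le: "degree (root_poly Y) \<le> size Y"
proof (induction Y)
  case (add y Y)
  have "degree (root_poly (add_mset y Y)) \<le> degree [:1, - y:] + degree (root_poly Y)"
    unfolding root_poly_simps by (rule degree_mult_le)
  also have "\<dots> \<le> 1 + size Y" using add by (intro add_mono) simp_all
  finally show ?case by simp
qed simp

definition power_sum :: "int multiset \<Rightarrow> nat \<Rightarrow> int" where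
  "power_sum Y j = (\<Sum>y\<in>#Y. y ^ j)"

lemma power_sum_simps [simp]: "power_sum {#} j = 0" "power_sum (add_mset y Y) j = y ^ j + power_sum Y j"
  by (simp_all add: power_sum_def)

text \<open>The logarithmic derivative of the product is minus the sum of
  \<open>y / (1 - y * X)\<close>. Expanding geometrically gives the power sums; \<open>C\<close>
  absorbs everything beyond \<open>X ^ r\<close>.\<close>

lemma pderiv_root_poly:
  "\<exists>C. pderiv (root_poly Y) = - (root_poly Y * (\<Sum>j<r. monom (power_sum Y (Suc j)) j)) + monom 1 r * C"
proof (induction Y)
  case empty
  show ?case by (intro exI[of _ 0]) simp
next
  case (add y Y)
  then obtain C where C: "pderiv (root_poly Y) = - (root_poly Y * (\<Sum>j<r. monom (power_sum Y (Suc j)) j)) + monom 1 r * C" by blast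
  define S where "S = (\<Sum>j<r. monom (power_sum Y (Suc j)) j)"
  define T where "T = (\<Sum>j<r. monom (y ^ Suc j) j)"
  have T: "[:1, - y:] * T = [:y:] - monom (y ^ Suc r) r"
    unfolding T_def
  proof (induction r)
    case (Suc r)
    have "[:1, - y:] * monom (y ^ Suc r) r = monom (y ^ Suc r) r - monom (y ^ Suc (Suc r)) (Suc r)"
      by (simp add: monom_Suc smult_monom minus_monom)
    then show ?case using Suc by (simp add: distrib_left)
  qed (simp add: monom_0)
  have d: "pderiv [:1, - y:] = [:- y:]" by (simp add: pderiv_pCons)
  have m: "monom (y ^ Suc r) r = monom 1 r * [:y ^ Suc r:]" by (simp add: smult_monom)
  have "pderiv (root_poly (add_mset y Y)) = [:1, - y:] * pderiv (root_poly Y) + root_poly Y * [:- y:]"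
    by (simp only: root_poly_simps pderiv_mult d)
  also have "\<dots> = - ([:1, - y:] * root_poly Y * S) + monom 1 r * ([:1, - y:] * C) - root_poly Y * [:y:]"
    unfolding C S_def[symmetric] by (simp add: algebra_simps)
  also have "[:y:] = [:1, - y:] * T + monom 1 r * [:y ^ Suc r:]" unfolding T m[symmetric] by simp
  also have "- ([:1, - y:] * root_poly Y * S) + monom 1 r * ([:1, - y:] * C) - root_poly Y * ([:1, - y:] * T + monom 1 r * [:y ^ Suc r:])
      = - ([:1, - y:] * root_poly Y * (T + S)) + monom 1 r * ([:1, - y:] * C - root_poly Y * [:y ^ Suc r:])"
    by (simp only: algebra_simps)
  also have "T + S = (\<Sum>j<r. monom (power_sum (add_mset y Y) (Suc j)) j)"
    unfolding T_def S_def by (simp add: sum.distrib add_monom[symmetric])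
  finally show ?case unfolding root_poly_simps by blast
qed

text \<open>Coefficient of \<open>X ^ k\<close> in the previous identity with
  \<open>r = Suc k\<close>, where the remainder does not contribute.\<close>

lemma newton_identity:
  "of_nat (Suc k) * coeff (root_poly Y) (Suc k) = - (\<Sum>i\<le>k. coeff (root_poly Y) i * power_sum Y (Suc (k - i)))"
proof -
  obtain C where C: "pderiv (root_poly Y) = - (root_poly Y * (\<Sum>j<Suc k. monom (power_sum Y (Suc j)) j)) + monom 1 (Suc k) * C"
    using pderiv_root_poly by blast
  have "of_nat (Suc k) * coeff (root_poly Y) (Suc k) = coeff (pderiv (root_poly Y)) k" by (simp add: coeff_pderiv)
  also have "\<dots> = - coeff (root_poly Y * (\<Sum>j<Suc k. monom (power_sum Y (Suc j)) j)) k"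
    unfolding C by (simp add: coeff_monom_mult)
  also have "coeff (root_poly Y * (\<Sum>j<Suc k. monom (power_sum Y (Suc j)) j)) k
      = (\<Sum>i\<le>k. coeff (root_poly Y) i * power_sum Y (Suc (k - i)))"
    unfolding coeff_mult by (intro sum.cong refl) (simp add: coeff_sum sum.delta)
  finally show ?thesis .
qed

context
  fixes p :: nat and r :: nat
  assumes p: "prime p" and r: "r < p"
begin

lemma prime_int: "prime (int p)"
  using p by simp

text \<open>Newton's identity determines coefficient \<open>Suc l\<close> from lower ones after
  division by \<open>Suc l\<close>, which is invertible because
  \<open>Suc l <= r < p\<close>.\<close>

lemma coeff_root_poly_cong:
  assumes s: "\<And>j. j \<in> {1..r} \<Longrightarrow> [power_sum Y j = power_sum W j] (mod int p)"
  shows "k \<le> r \<Longrightarrow> [coeff (root_poly Y) k = coeff (root_poly W) k] (mod int p)"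
proof (induction k rule: less_induct)
  case (less k)
  show ?case
  proof (cases k)
    case 0
    have "coeff (root_poly Z) 0 = 1" for Z
      using poly_root_poly[of Z 0] by (simp add: poly_0_coeff_0)
    then show ?thesis using 0 by simp
  next
    case (Suc l)
    have "[- (\<Sum>i\<le>l. coeff (root_poly Y) i * power_sum Y (Suc (l - i))) = - (\<Sum>i\<le>l. coeff (root_poly W) i * power_sum W (Suc (l - i)))] (mod int p)"
      using less Suc by (intro cong_minus_minus_iff[THEN iffD2] cong_sum cong_mult s less.IH) auto
    then have "[of_nat (Suc l) * coeff (root_poly Y) (Suc l) = of_nat (Suc l) * coeff (root_poly W) (Suc l)] (mod int p)"
      by (simp only: newton_identity)
    moreover have "coprime (int (Suc l)) (int p)"
      using p r less.prems Suc prime_imp_coprime[of "int p" "int (Suc l)"] prime_int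
      by (auto simp: coprime_commute zdvd_not_zless)
    ultimately show ?thesis unfolding Suc by (simp only: cong_mult_lcancel)
  qed
qed

lemma prod_one_minus_cong:
  assumes s: "\<And>j. j \<in> {1..r} \<Longrightarrow> [power_sum Y j = power_sum W j] (mod int p)"
    and Y: "size Y \<le> r" and W: "size W \<le> r"
  shows "[(\<Prod>y\<in>#Y. 1 - y * b) = (\<Prod>w\<in>#W. 1 - w * b)] (mod int p)"
proof -
  have e: "poly (root_poly Z) b = (\<Sum>i\<le>r. coeff (root_poly Z) i * b ^ i)" if "size Z \<le> r" for Z
    unfolding poly_altdef
    using degree_root_poly_le[of Z] that
    by (intro sum.mono_neutral_left) (auto simp: coeff_eq_0)
  show ?thesis
    unfolding poly_root_poly[symmetric] e[OF Y] e[OF W]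
    by (intro cong_sum cong_mult coeff_root_poly_cong s cong_refl) auto
qed

text \<open>At an inverse \<open>b\<close> of \<open>y\<close> the product over \<open>Y\<close>
  vanishes mod \<open>p\<close>, hence so does the product over \<open>W\<close>; as
  \<open>p\<close> is prime, some factor \<open>1 - w * b\<close> vanishes, and then
  \<open>w\<close> is congruent to \<open>y\<close>.\<close>

lemma matching_root:
  assumes s: "\<And>j. j \<in> {1..r} \<Longrightarrow> [power_sum Y j = power_sum W j] (mod int p)"
    and Y: "size Y \<le> r" and W: "size W \<le> r" and y: "y \<in># Y" "\<not> int p dvd y"
  shows "\<exists>w\<in>#W. [y = w] (mod int p)"
proof -
  have "coprime y (int p)" using prime_imp_coprime[OF prime_int y(2)] by (simp add: coprime_commute)
  then obtain b where b: "[y * b = 1] (mod int p)" using cong_solve_coprime_int by blast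
  then have "int p dvd (1 - y * b)" by (simp add: cong_iff_dvd_diff dvd_diff_commute)
  also have "(1 - y * b) dvd (\<Prod>y\<in>#Y. 1 - y * b)" using y(1) by (intro dvd_prod_mset) auto
  finally have "int p dvd (\<Prod>w\<in>#W. 1 - w * b)"
    using prod_one_minus_cong[OF s Y W, of b] by (meson cong_0_iff cong_sym cong_trans)
  then obtain a where "a \<in># image_mset (\<lambda>w. 1 - w * b) W" "int p dvd a"
    by (rule prime_elem_dvd_prod_msetE[OF prime_imp_prime_elem[OF prime_int]])
  then obtain w where w: "w \<in># W" "int p dvd 1 - w * b" by auto
  have "[w * b = 1] (mod int p)" using w(2) by (simp add: cong_iff_dvd_diff dvd_diff_commute)
  then have "[y * (w * b) = y * 1] (mod int p)" by (rule cong_scalar_left)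
  moreover have "[w * (y * b) = w * 1] (mod int p)" using b by (rule cong_scalar_left)
  ultimately have "[y = w] (mod int p)" by (metis cong_sym cong_trans mult.left_commute mult_1_right)
  then show ?thesis using w(1) by blast
qed

text \<open>Matching elements are removed one pair at a time. A nonzero residue on either side has a
  partner; if all residues are 0, any pair matches. Equality of sizes fixes the number of zeros,
  which positive power sums cannot detect.\<close>

lemma power_sums_determine_mset:
  assumes "size Y = size W" "size Y \<le> r" "\<And>j. j \<in> {1..r} \<Longrightarrow> [power_sum Y j = power_sum W j] (mod int p)"
  shows "image_mset (\<lambda>y. y mod int p) Y = image_mset (\<lambda>y. y mod int p) W"
  using assms
proof (induction "size Y" arbitrary: Y W)
  case 0
  then show ?case by simp
next
  case (Suc n)
  note s = Suc.prems(3)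
  have W: "size W \<le> r" using Suc.prems by simp
  have "\<exists>y\<in>#Y. \<exists>w\<in>#W. [y = w] (mod int p)"
  proof -
    consider y where "y \<in># Y" "\<not> int p dvd y" | w where "w \<in># W" "\<not> int p dvd w"
      | "\<forall>y\<in>#Y. int p dvd y" "\<forall>w\<in>#W. int p dvd w" by blast
    then show ?thesis
    proof cases
      case 1
      then show ?thesis using matching_root[OF s Suc.prems(2) W] by blast
    next
      case 2
      then show ?thesis using matching_root[OF cong_sym[OF s] W Suc.prems(2)] cong_sym by blast
    next
      case 3
      have "Y \<noteq> {#}" "W \<noteq> {#}" using Suc by auto
      then obtain y w where yw: "y \<in># Y" "w \<in># W" by blast
      then have "[y = w] (mod int p)" using 3 by (simp add: cong_iff_dvd_diff)
      then show ?thesis using yw by blast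
    qed
  qed
  then obtain y w where yw: "y \<in># Y" "w \<in># W" "[y = w] (mod int p)" by blast
  obtain Y' W' where Y': "Y = add_mset y Y'" and W': "W = add_mset w W'"
    using yw by (metis mset_add)
  have "image_mset (\<lambda>y. y mod int p) Y' = image_mset (\<lambda>y. y mod int p) W'"
  proof (rule Suc.hyps(1))
    fix j assume "j \<in> {1..r}"
    then have "[y ^ j + power_sum Y' j = w ^ j + power_sum W' j] (mod int p)" using s[of j] by (simp add: Y' W')
    moreover have "[y ^ j = w ^ j] (mod int p)" using yw(3) by (rule cong_pow)
    ultimately show "[power_sum Y' j = power_sum W' j] (mod int p)"
      by (metis cong_diff add_diff_cancel_left')
  qed (use Suc.hyps(2) Suc.prems in \<open>auto simp: Y' W'\<close>)
  then show ?case using yw(3) by (simp add: Y' W' cong_def)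
qed

end

text \<open>The root bound over the field with \<open>p\<close> elements, carried out on integer
  polynomials: split off one root by synthetic division and cancel \<open>x - a\<close>, which is
  invertible mod \<open>p\<close>.\<close>

lemma coeffs_dvd_if_many_roots:
  fixes f :: "int poly"
  assumes p: "prime p" and X: "finite X" "degree f < card X"
    and inc: "\<And>x y. x \<in> X \<Longrightarrow> y \<in> X \<Longrightarrow> p dvd x - y \<Longrightarrow> x = y"
    and root: "\<And>x. x \<in> X \<Longrightarrow> p dvd poly f x"
  shows "p dvd coeff f i"
  using X inc root
proof (induction X arbitrary: f i rule: finite_induct)
  case (insert a X)
  show ?case
  proof (cases "degree f = 0")
    case True
    then obtain c where "f = [:c:]" by (rule degree_eq_zeroE)
    then show ?thesis using insert.prems(3)[of a] by (auto simp: coeff_pCons split: nat.splits)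
  next
    case False
    define q where "q = synthetic_div f a"
    have f: "f = [:- a, 1:] * q + [:poly f a:]" using synthetic_div_correct'[of a f] by (simp add: q_def)
    have q: "p dvd coeff q i" for i
    proof (rule insert.IH)
      show "degree q < card X" using insert False by (simp add: q_def degree_synthetic_div)
      fix x assume x: "x \<in> X"
      have "poly f x - poly f a = (x - a) * poly q x"
        by (subst (1) f) (simp add: algebra_simps)
      moreover have "p dvd poly f x - poly f a" using insert.prems(3) x by simp
      ultimately have "p dvd (x - a) * poly q x" by simp
      moreover have "\<not> p dvd x - a" using insert.prems(2)[of x a] insert.hyps x by auto
      ultimately show "p dvd poly q x" using p by (simp add: prime_dvd_mult_iff)
    qed (use insert in auto)
    have "p dvd poly f a" using insert.prems by simp
    then show ?thesis
      by (subst f) (auto simp: coeff_pCons q split: nat.splits intro!: dvd_add dvd_diff)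
  qed
qed simp

section \<open>A criterion for designs\<close>

text \<open>On coordinates of modulus 1 this is a character with positive exponents from
  \<open>A\<close> and negative ones from \<open>B\<close>. Two multisets, with common elements
  allowed, keep the degree equal to \<open>size A + size B\<close> and products additive.\<close>

definition monomial :: "('c \<Rightarrow> 'v \<Rightarrow> complex) \<Rightarrow> 'c multiset \<Rightarrow> 'c multiset \<Rightarrow> 'v \<Rightarrow> complex" where
  "monomial u A B x = (\<Prod>c\<in>#A. u c x) * cnj (\<Prod>c\<in>#B. u c x)"

lemma monomial_add: "monomial u (A + A') (B + B') x = monomial u A B x * monomial u A' B' x"
  by (simp add: monomial_def)

inductive monomial_comb :: "('c \<Rightarrow> 'v \<Rightarrow> complex) \<Rightarrow> 'c set \<Rightarrow> nat \<Rightarrow> ('v \<Rightarrow> complex) \<Rightarrow> bool"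
  for u :: "'c \<Rightarrow> 'v \<Rightarrow> complex" and C :: "'c set" where
  monomial: "set_mset A \<subseteq> C \<Longrightarrow> set_mset B \<subseteq> C \<Longrightarrow> size A + size B \<le> d \<Longrightarrow> monomial_comb u C d (monomial u A B)"
| scale: "monomial_comb u C d f \<Longrightarrow> monomial_comb u C d (\<lambda>x. a * f x)"
| add: "monomial_comb u C d f \<Longrightarrow> monomial_comb u C d g \<Longrightarrow> monomial_comb u C d (\<lambda>x. f x + g x)"

lemma monomial_comb_mult_monomial:
  assumes "monomial_comb u C e g" "set_mset A \<subseteq> C" "set_mset B \<subseteq> C" "size A + size B \<le> d"
  shows "monomial_comb u C (d + e) (\<lambda>x. monomial u A B x * g x)"
  using assms
proof (induction rule: monomial_comb.induct)
  case (monomial A' B' e)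
  then have "monomial_comb u C (d + e) (monomial u (A + A') (B + B'))"
    by (intro monomial_comb.monomial) auto
  then show ?case by (simp add: monomial_add[abs_def])
next
  case (scale e f a)
  then have "monomial_comb u C (d + e) (\<lambda>x. a * (monomial u A B x * f x))" by (intro monomial_comb.scale)
  then show ?case by (simp only: mult.left_commute)
next
  case (add e f g)
  then show ?case unfolding distrib_left by (intro monomial_comb.add)
qed

lemma monomial_comb_mult:
  assumes "monomial_comb u C d f" "monomial_comb u C e g"
  shows "monomial_comb u C (d + e) (\<lambda>x. f x * g x)"
  using assms
proof (induction rule: monomial_comb.induct)
  case (monomial A B d)
  then show ?case by (intro monomial_comb_mult_monomial)
next
  case (scale d f a)
  then show ?case unfolding mult.assoc by (intro monomial_comb.scale)
next
  case (add d f f')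
  then show ?case unfolding distrib_right by (intro monomial_comb.add)
qed

lemma monomial_comb_of_poly:
  assumes "poly_deg_le (\<Union>c\<in>C. {\<lambda>x. Re (u c x), \<lambda>x. Im (u c x)}) d P"
  shows "monomial_comb u C d (\<lambda>x. complex_of_real (P x))"
  using assms
proof (induction rule: poly_deg_le.induct)
  case (const d c)
  have "monomial_comb u C d (\<lambda>x. of_real c * monomial u {#} {#} x)"
    by (intro monomial_comb.scale monomial_comb.monomial) auto
  then show ?case by (simp add: monomial_def)
next
  case (linear l)
  then obtain c where c: "c \<in> C" and l: "l = (\<lambda>x. Re (u c x)) \<or> l = (\<lambda>x. Im (u c x))" by auto
  have "monomial_comb u C 1 (\<lambda>x. a * monomial u {#c#} {#} x + b * monomial u {#} {#c#} x)" for a b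
    using c by (intro monomial_comb.add monomial_comb.scale monomial_comb.monomial) auto
  from this[of "1 / 2" "1 / 2"] this[of "- \<i> / 2" "\<i> / 2"]
  have "monomial_comb u C 1 (\<lambda>x. 1 / 2 * u c x + 1 / 2 * cnj (u c x))"
    "monomial_comb u C 1 (\<lambda>x. - \<i> / 2 * u c x + \<i> / 2 * cnj (u c x))"
    by (simp_all add: monomial_def)
  moreover have "1 / 2 * z + 1 / 2 * cnj z = of_real (Re z)" "- \<i> / 2 * z + \<i> / 2 * cnj z = of_real (Im z)" for z
    by (simp_all add: complex_eq_iff)
  ultimately show ?case using l by auto
next
  case (add d P Q)
  then show ?case unfolding of_real_add by (intro monomial_comb.add)
next
  case (mult d P e Q)
  then show ?case unfolding of_real_mult by (intro monomial_comb_mult)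
qed

text \<open>If a monomial is not 1 at some \<open>q\<close> in \<open>F\<close>, translation by
  \<open>q\<close> multiplies both its integral and its sum over \<open>F\<close> by that value, so
  both vanish. Otherwise \<open>triv\<close> makes it the constant 1. Subgroups appear as sets that
  are permuted by the translations by their own points.\<close>

lemma is_design_criterion:
  fixes T :: "('v::topological_space \<Rightarrow> 'v) set" and u :: "'c \<Rightarrow> 'v \<Rightarrow> complex"
  assumes haar: "is_haar T v (haar_measure T v)"
    and L: "L = (\<Union>c\<in>C. {\<lambda>x. Re (u c x), \<lambda>x. Im (u c x)})"
    and meas: "\<And>c. c \<in> C \<Longrightarrow> u c \<in> borel_measurable (restrict_space borel (orbit_of T v))"
    and unit: "\<And>c x. c \<in> C \<Longrightarrow> x \<in> orbit_of T v \<Longrightarrow> cmod (u c x) = 1"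
    and F: "finite F" "F \<noteq> {}" "F \<subseteq> orbit_of T v"
    and trans: "\<And>q. q \<in> F \<Longrightarrow> \<exists>g\<in>T. inj_on g F \<and> g ` F \<subseteq> F \<and> (\<forall>c\<in>C. \<forall>x\<in>orbit_of T v. u c (g x) = u c q * u c x)"
    and triv: "\<And>A B x. set_mset A \<subseteq> C \<Longrightarrow> set_mset B \<subseteq> C \<Longrightarrow> size A + size B \<le> d \<Longrightarrow>
        (\<And>q. q \<in> F \<Longrightarrow> monomial u A B q = 1) \<Longrightarrow> x \<in> orbit_of T v \<Longrightarrow> monomial u A B x = 1"
  shows "is_design T v L d F"
proof -
  define M where "M = haar_measure T v"
  have M: "is_haar T v M" using haar by (simp add: M_def)
  interpret prob_space M using M by (simp add: is_haar_def)
  have sM: "sets M = sets (restrict_space borel (orbit_of T v))" using M by (simp add: is_haar_def)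
  have sp: "space M = orbit_of T v" using sets_eq_imp_space_eq[OF sM] by (simp add: space_restrict_space)
  have um: "u c \<in> borel_measurable M" if "c \<in> C" for c
    using meas[OF that] by (simp cong: measurable_cong_sets add: sM)
  have pm: "(\<lambda>x. \<Prod>c\<in>#A. u c x) \<in> borel_measurable M" if "set_mset A \<subseteq> C" for A
    using that by (induction A) (auto intro!: borel_measurable_times um)
  have cnjm: "cnj \<in> borel_measurable borel"
    by (intro borel_measurable_continuous_onI continuous_intros)
  have mm: "monomial u A B \<in> borel_measurable M" if "set_mset A \<subseteq> C" "set_mset B \<subseteq> C" for A B
    unfolding monomial_def[abs_def]
    by (intro borel_measurable_times pm that measurable_compose[OF pm cnjm])
  have pu: "cmod (\<Prod>c\<in>#A. u c x) = 1" if "set_mset A \<subseteq> C" "x \<in> orbit_of T v" for A x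
    using that by (induction A) (auto simp: norm_mult unit)
  have mu: "cmod (monomial u A B x) = 1" if "set_mset A \<subseteq> C" "set_mset B \<subseteq> C" "x \<in> orbit_of T v" for A B x
    using that by (simp add: monomial_def norm_mult pu)
  have main: "integrable M f \<and> (\<integral>x. f x \<partial>M) = 1 / of_nat (card F) * (\<Sum>x\<in>F. f x)"
    if "monomial_comb u C d f" for f
    using that
  proof (induction d\<equiv>d f rule: monomial_comb.induct)
    case (monomial A B)
    note AB = monomial(1-3)
    have i: "integrable M (monomial u A B)"
      by (rule integrable_const_bound[of _ 1]) (use mu[OF AB(1,2)] mm[OF AB(1,2)] sp in auto)
    show ?case
    proof (cases "\<forall>q\<in>F. monomial u A B q = 1")
      case True
      have 1: "monomial u A B x = 1" if "x \<in> orbit_of T v" for x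
        using triv[OF AB] True that by blast
      have "(\<integral>x. monomial u A B x \<partial>M) = (\<integral>x. 1 \<partial>M)"
        by (rule Bochner_Integration.integral_cong) (use 1 sp in auto)
      also have "\<dots> = 1" by (simp add: prob_space)
      finally show ?thesis using i True F by simp
    next
      case False
      then obtain q where q: "q \<in> F" "monomial u A B q \<noteq> 1" by blast
      obtain g where g: "g \<in> T" "inj_on g F" "g ` F \<subseteq> F" and ug: "\<And>c x. c \<in> C \<Longrightarrow> x \<in> orbit_of T v \<Longrightarrow> u c (g x) = u c q * u c x"
        using trans[OF q(1)] by blast
      have pg: "(\<Prod>c\<in>#A. u c (g x)) = (\<Prod>c\<in>#A. u c q) * (\<Prod>c\<in>#A. u c x)" if "set_mset A \<subseteq> C" "x \<in> orbit_of T v" for A x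
        using that by (induction A) (auto simp: ug)
      have mg: "monomial u A B (g x) = monomial u A B q * monomial u A B x" if "x \<in> orbit_of T v" for x
        using that AB by (simp add: monomial_def pg)
      have gM: "g \<in> M \<rightarrow>\<^sub>M M" "distr M M g = M" using M g(1) by (auto simp: is_haar_def)
      have "(\<integral>x. monomial u A B x \<partial>M) = (\<integral>x. monomial u A B x \<partial>distr M M g)" by (simp only: gM(2))
      also have "\<dots> = (\<integral>x. monomial u A B (g x) \<partial>M)"
        by (rule integral_distr[OF gM(1) mm[OF AB(1,2)]])
      also have "\<dots> = (\<integral>x. monomial u A B q * monomial u A B x \<partial>M)"
        by (rule Bochner_Integration.integral_cong) (use mg sp in auto)
      also have "\<dots> = monomial u A B q * (\<integral>x. monomial u A B x \<partial>M)" by simp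
      finally have int0: "(\<integral>x. monomial u A B x \<partial>M) = 0" using q(2) by simp
      have "bij_betw g F F"
        using endo_inj_surj[OF F(1) g(3,2)] g(2) by (simp add: bij_betw_def)
      from sum.reindex_bij_betw[OF this, of "monomial u A B", symmetric]
      have "(\<Sum>x\<in>F. monomial u A B x) = (\<Sum>x\<in>F. monomial u A B (g x))" .
      also have "(\<Sum>x\<in>F. monomial u A B (g x)) = monomial u A B q * (\<Sum>x\<in>F. monomial u A B x)"
        unfolding sum_distrib_left by (rule sum.cong) (use mg F(3) in auto)
      finally have "(\<Sum>x\<in>F. monomial u A B x) = monomial u A B q * (\<Sum>x\<in>F. monomial u A B x)" .
      then have "(\<Sum>x\<in>F. monomial u A B x) = 0" using q(2) by simp
      then show ?thesis using i int0 by simp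
    qed
  next
    case (scale f a)
    then show ?case by (simp add: sum_distrib_left[symmetric])
  next
    case (add f g)
    then show ?case by (simp add: sum.distrib distrib_left)
  qed
  have "(\<integral>x. P x \<partial>haar_measure T v) = 1 / real (card F) * (\<Sum>p\<in>F. P p)" if "poly_deg_le L d P" for P
  proof -
    have "monomial_comb u C d (\<lambda>x. complex_of_real (P x))"
      by (rule monomial_comb_of_poly) (use that L in simp)
    from main[OF this] have "complex_of_real (\<integral>x. P x \<partial>M) = of_real (1 / real (card F) * (\<Sum>p\<in>F. P p))"
      by simp
    then show ?thesis unfolding M_def of_real_eq_iff .
  qed
  then show ?thesis using F by (simp add: is_design_def)
qed

section \<open>Grids of roots of unity\<close>

definition unit_root :: "nat \<Rightarrow> int \<Rightarrow> complex" where
  "unit_root p m = cis (2 * pi * of_int m / real p)"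

lemma norm_unit_root [simp]: "cmod (unit_root p m) = 1"
  by (simp add: unit_root_def)

lemma unit_root_0 [simp]: "unit_root p 0 = 1"
  by (simp add: unit_root_def)

lemma unit_root_add: "unit_root p (a + b) = unit_root p a * unit_root p b"
  by (simp add: unit_root_def cis_mult add_divide_distrib distrib_left)

lemma unit_root_uminus: "unit_root p (- a) = cnj (unit_root p a)"
  by (simp add: unit_root_def cis_cnj)

lemma unit_root_eq_1_iff:
  assumes "p > 0"
  shows "unit_root p m = 1 \<longleftrightarrow> int p dvd m"
proof
  assume "unit_root p m = 1"
  then obtain k :: int where "2 * pi * of_int m / real p = of_int (2 * k) * pi"
    by (auto simp: unit_root_def cis_conv_exp exp_eq_1)
  then have "real_of_int m = real_of_int (int p * k)" using assms by (simp add: field_simps)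
  then have "m = int p * k" unfolding of_int_eq_iff .
  then show "int p dvd m" by simp
next
  assume "int p dvd m"
  then obtain k where "m = int p * k" by blast
  then have "2 * pi * of_int m / real p = of_int (2 * k) * pi" using assms by simp
  then show "unit_root p m = 1" by (auto simp: unit_root_def cis_conv_exp exp_eq_1)
qed

lemma unit_root_cong:
  assumes "p > 0" "[a = b] (mod int p)"
  shows "unit_root p a = unit_root p b"
proof -
  have "unit_root p (a - b) = 1" using assms by (simp add: unit_root_eq_1_iff cong_iff_dvd_diff)
  moreover have "unit_root p a = unit_root p (a - b) * unit_root p b" by (simp flip: unit_root_add)
  ultimately show ?thesis by simp
qed

lemma unit_root_power_p: "p > 0 \<Longrightarrow> unit_root p m ^ p = 1"
proof -
  assume p: "p > 0"
  have "unit_root p m ^ k = unit_root p (int k * m)" for k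
    by (induction k) (simp_all add: unit_root_add distrib_right)
  then show ?thesis using p by (simp add: unit_root_eq_1_iff)
qed

lemma prod_mset_unit_root: "(\<Prod>x\<in>#A. unit_root p (f x)) = unit_root p (\<Sum>x\<in>#A. f x)"
  by (induction A) (simp_all add: unit_root_add)

text \<open>Labels \<open>x\<close> are evaluation points and \<open>\<xi>\<close> is the
  coefficient vector. Summed over a multiset of labels, this becomes a combination of its power sums
  with exponents \<open>e j\<close>.\<close>

definition phase :: "(nat \<Rightarrow> nat) \<Rightarrow> nat \<Rightarrow> (nat \<Rightarrow> nat) \<Rightarrow> int \<Rightarrow> int" where
  "phase e t \<xi> x = (\<Sum>j<t. int (\<xi> j) * x ^ e j)"

definition grid :: "nat \<Rightarrow> nat \<Rightarrow> (nat \<Rightarrow> nat) set" where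
  "grid p t = PiE {..<t} (\<lambda>_. {..<p})"

definition grid_add :: "nat \<Rightarrow> nat \<Rightarrow> (nat \<Rightarrow> nat) \<Rightarrow> (nat \<Rightarrow> nat) \<Rightarrow> nat \<Rightarrow> nat" where
  "grid_add p t \<xi> \<eta> = (\<lambda>j\<in>{..<t}. (\<xi> j + \<eta> j) mod p)"

definition weight :: "nat \<Rightarrow> (nat \<Rightarrow> nat) \<Rightarrow> nat \<Rightarrow> (nat \<Rightarrow> nat) \<Rightarrow> int \<Rightarrow> complex" where
  "weight p e t \<xi> x = unit_root p (phase e t \<xi> x)"

lemma norm_weight [simp]: "cmod (weight p e t \<xi> x) = 1"
  by (simp add: weight_def)

lemma finite_grid: "finite (grid p t)"
  by (simp add: grid_def finite_PiE)

lemma card_grid: "card (grid p t) = p ^ t"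
  by (simp add: grid_def card_PiE)

lemma grid_nonempty: "p > 0 \<Longrightarrow> grid p t \<noteq> {}"
  by (auto simp: grid_def PiE_eq_empty_iff)

lemma grid_add_in: "p > 0 \<Longrightarrow> grid_add p t \<xi> \<eta> \<in> grid p t"
  by (auto simp: grid_add_def grid_def)

lemma weight_grid_add:
  assumes "p > 0"
  shows "weight p e t (grid_add p t \<xi> \<eta>) x = weight p e t \<xi> x * weight p e t \<eta> x"
proof -
  have "[phase e t (grid_add p t \<xi> \<eta>) x = (\<Sum>j<t. int (\<xi> j + \<eta> j) * x ^ e j)] (mod int p)"
    unfolding phase_def by (intro cong_sum cong_mult cong_refl) (simp add: grid_add_def zmod_int)
  also have "(\<Sum>j<t. int (\<xi> j + \<eta> j) * x ^ e j) = phase e t \<xi> x + phase e t \<eta> x"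
    by (simp add: phase_def distrib_right sum.distrib)
  finally show ?thesis unfolding weight_def unit_root_add[symmetric] by (rule unit_root_cong[OF assms])
qed

lemma power_sums_cong_if_trivial_on_grid:
  assumes p: "p > 1" and j: "j < t"
    and triv: "\<And>\<xi>. \<xi> \<in> grid p t \<Longrightarrow> (\<Prod>x\<in>#A. weight p e t \<xi> x) * cnj (\<Prod>x\<in>#B. weight p e t \<xi> x) = 1"
  shows "[power_sum A (e j) = power_sum B (e j)] (mod int p)"
proof -
  \<comment> \<open>The unit vector at \<open>j\<close> isolates the power sum with exponent
    \<open>e j\<close>.\<close>
  define \<xi> where "\<xi> = (\<lambda>i\<in>{..<t}. if i = j then 1 else 0 :: nat)"
  have \<xi>: "\<xi> \<in> grid p t" using p by (auto simp: \<xi>_def grid_def)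
  have "phase e t \<xi> x = (\<Sum>i<t. if i = j then x ^ e j else 0)" for x
    unfolding phase_def by (rule sum.cong) (auto simp: \<xi>_def)
  then have ph: "phase e t \<xi> x = x ^ e j" for x using j by simp
  have "unit_root p (power_sum A (e j) - power_sum B (e j)) = unit_root p (power_sum A (e j)) * cnj (unit_root p (power_sum B (e j)))"
    unfolding unit_root_uminus[symmetric] unit_root_add[symmetric] by simp
  also have "\<dots> = 1" using triv[OF \<xi>] by (simp add: weight_def ph prod_mset_unit_root power_sum_def)
  finally show ?thesis using p by (simp add: unit_root_eq_1_iff cong_iff_dvd_diff)
qed

text \<open>The difference of the two phases is a polynomial with more incongruent roots mod
  \<open>p\<close> than its degree. Its coefficients vanish mod \<open>p\<close>, injectivity of
  \<open>e\<close> separates them, and entries below \<open>p\<close> must then coincide.\<close>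

lemma grid_eqI:
  assumes p: "prime p" and e: "inj_on e {..<t}" and X: "finite X" "\<And>j. j < t \<Longrightarrow> e j < card X"
    and inc: "\<And>x y. x \<in> X \<Longrightarrow> y \<in> X \<Longrightarrow> int p dvd x - y \<Longrightarrow> x = y"
    and eq: "\<And>x. x \<in> X \<Longrightarrow> weight p e t \<xi> x = weight p e t \<eta> x"
    and g: "\<xi> \<in> grid p t" "\<eta> \<in> grid p t"
  shows "\<xi> = \<eta>"
proof (cases "t = 0")
  case True
  then show ?thesis using g by (auto simp: grid_def)
next
  case False
  have p0: "p > 0" using p by (rule prime_gt_0_nat)
  define f where "f = (\<Sum>j<t. monom (int (\<xi> j) - int (\<eta> j)) (e j))"
  have "X \<noteq> {}" using X(2)[of 0] False by auto
  then have cX: "card X > 0" using X(1) by (simp add: card_gt_0_iff)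
  have "degree f \<le> card X - 1"
    unfolding f_def by (rule degree_sum_le) (auto intro!: order_trans[OF degree_monom_le] dest: X(2))
  then have deg: "degree f < card X" using cX by linarith
  have root: "int p dvd poly f x" if x: "x \<in> X" for x
  proof -
    have "poly f x = phase e t \<xi> x - phase e t \<eta> x"
      by (simp add: f_def phase_def poly_sum poly_monom left_diff_distrib sum_subtractf)
    moreover have "unit_root p (phase e t \<xi> x - phase e t \<eta> x) = unit_root p (phase e t \<xi> x) * cnj (unit_root p (phase e t \<eta> x))"
      unfolding unit_root_uminus[symmetric] unit_root_add[symmetric] by simp
    moreover have "unit_root p (phase e t \<eta> x) * cnj (unit_root p (phase e t \<eta> x)) = 1"
      by (simp add: complex_norm_square[symmetric])
    ultimately show ?thesis using eq[OF x] p0 by (simp add: weight_def unit_root_eq_1_iff)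
  qed
  have "\<xi> j = \<eta> j" if j: "j < t" for j
  proof -
    have "coeff f (e j) = (\<Sum>i<t. if i = j then int (\<xi> j) - int (\<eta> j) else 0)"
      unfolding f_def coeff_sum using e j by (intro sum.cong) (auto simp: inj_on_def)
    then have "int p dvd int (\<xi> j) - int (\<eta> j)"
      using coeffs_dvd_if_many_roots[of "int p" X f "e j"] p X(1) deg inc root j by simp
    moreover have "\<xi> j < p" "\<eta> j < p" using g j by (auto simp: grid_def)
    ultimately have "[\<xi> j = \<eta> j] (mod p)" by (simp add: cong_iff_dvd_diff cong_int_iff[symmetric])
    then show ?thesis using \<open>\<xi> j < p\<close> \<open>\<eta> j < p\<close> by (simp add: cong_less_modulus_unique_nat)
  qed
  then show ?thesis using PiE_ext[OF g[unfolded grid_def]] by simp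
qed

lemma image_mset_mod_id:
  assumes "\<And>x. x \<in># A \<Longrightarrow> 0 \<le> x \<and> x < m"
  shows "image_mset (\<lambda>x. x mod m) A = (A :: int multiset)"
  using assms by (induction A) auto

lemma prod_mset_mult_cnj_self:
  assumes "\<And>c. c \<in># A \<Longrightarrow> cmod (f c) = 1"
  shows "(\<Prod>c\<in>#A. f c) * cnj (\<Prod>c\<in>#A. f c) = 1"
proof -
  have "cmod (\<Prod>c\<in>#A. f c) = 1" using assms by (induction A) (auto simp: norm_mult)
  then show ?thesis by (simp add: complex_norm_square[symmetric])
qed

section \<open>The torus of \<open>SO(2n)\<close>\<close>

abbreviation (input) odd_exp :: "nat \<Rightarrow> nat" where
  "odd_exp j \<equiv> 2 * j + 1"

lemma weight_odd_uminus: "weight p odd_exp t \<xi> (- x) = cnj (weight p odd_exp t \<xi> x)"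
proof -
  have "phase odd_exp t \<xi> (- x) = - phase odd_exp t \<xi> x"
    by (simp add: phase_def sum_negf)
  then show ?thesis by (simp add: weight_def unit_root_uminus)
qed

lemma weight_0:
  assumes "\<And>j. e j > 0"
  shows "weight p e t \<xi> 0 = 1"
proof -
  have "phase e t \<xi> 0 = 0" unfolding phase_def using assms by (intro sum.neutral) auto
  then show ?thesis by (simp add: weight_def)
qed

text \<open>For a prime \<open>p > 2 n\<close> the \<open>n\<close> residues \<open>1, \<dots>, n\<close> and their negatives are distinct, and odd power
  sums up to exponent \<open>2 t - 1\<close> suffice because even ones do not change under \<open>y \<mapsto> - y\<close>.\<close>

definition so_point :: "nat \<Rightarrow> nat \<Rightarrow> nat \<Rightarrow> (nat \<Rightarrow> nat) \<Rightarrow> nat \<Rightarrow> complex" where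
  "so_point p t n \<xi> = (\<lambda>i. if i < n then weight p odd_exp t \<xi> (int i + 1) else 0)"

definition so_grid :: "nat \<Rightarrow> nat \<Rightarrow> nat \<Rightarrow> (nat \<Rightarrow> complex) set" where
  "so_grid p t n = so_point p t n ` grid p t"

definition so_grid_pm :: "nat \<Rightarrow> nat \<Rightarrow> nat \<Rightarrow> (nat \<Rightarrow> complex) set" where
  "so_grid_pm p t n = so_grid p t n \<union> (\<lambda>q i. - q i) ` so_grid p t n"

lemma so_grid_finite: "finite (so_grid p t n)" "finite (so_grid_pm p t n)"
  by (simp_all add: so_grid_def so_grid_pm_def finite_grid)

lemma so_grid_orbit: "so_grid p t n \<subseteq> orbit_of (so_torus n) (so_base n)" "so_grid_pm p t n \<subseteq> orbit_of (so_torus n) (so_base n)"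
  by (auto simp: so_grid_def so_grid_pm_def so_orbit so_point_def)

lemma so_grid_mult:
  assumes "p > 0" "q \<in> so_grid p t n" "q' \<in> so_grid p t n"
  shows "(\<lambda>i. q i * q' i) \<in> so_grid p t n"
proof -
  obtain \<xi> \<eta> where "q = so_point p t n \<xi>" "q' = so_point p t n \<eta>" using assms by (auto simp: so_grid_def)
  then have "(\<lambda>i. q i * q' i) = so_point p t n (grid_add p t \<xi> \<eta>)"
    using assms(1) by (auto simp: so_point_def weight_grid_add fun_eq_iff)
  then show ?thesis using grid_add_in[OF assms(1)] by (simp add: so_grid_def)
qed

lemma so_grid_pm_mult:
  assumes "p > 0" "q \<in> so_grid_pm p t n" "q' \<in> so_grid_pm p t n"
  shows "(\<lambda>i. q i * q' i) \<in> so_grid_pm p t n"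
proof -
  obtain r r' where r: "r \<in> so_grid p t n" "r' \<in> so_grid p t n"
    and q: "q = r \<or> q = (\<lambda>i. - r i)" "q' = r' \<or> q' = (\<lambda>i. - r' i)"
    using assms(2,3) unfolding so_grid_pm_def by blast
  have m: "(\<lambda>i. r i * r' i) \<in> so_grid p t n" by (rule so_grid_mult[OF assms(1) r])
  from q have "(\<lambda>i. q i * q' i) = (\<lambda>i. r i * r' i) \<or> (\<lambda>i. q i * q' i) = (\<lambda>i. - ((\<lambda>i. r i * r' i) i))" by auto
  then show ?thesis 
    unfolding so_grid_pm_def using m imageI[OF m, of "\<lambda>q i. - q i"] by auto
qed

text \<open>On this torus a monomial is constantly 1 exactly when \<open>A = B\<close>, so the
  criterion asks \<open>F\<close> to separate exponents. Multiplication by \<open>q\<close> is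
  injective, so closure under products makes it a permutation of the finite set
  \<open>F\<close>.\<close>

lemma so_design_if_closed:
  assumes F: "finite F" "F \<noteq> {}" "F \<subseteq> orbit_of (so_torus n) (so_base n)"
    and closed: "\<And>q q'. q \<in> F \<Longrightarrow> q' \<in> F \<Longrightarrow> (\<lambda>i. q i * q' i) \<in> F"
    and triv: "\<And>A B. set_mset A \<subseteq> {..<n} \<Longrightarrow> set_mset B \<subseteq> {..<n} \<Longrightarrow> size A + size B \<le> d \<Longrightarrow>
      (\<And>q. q \<in> F \<Longrightarrow> monomial (\<lambda>i x. x i) A B q = 1) \<Longrightarrow> A = B"
  shows "so_design n d F"
  unfolding so_design_def
proof (rule is_design_criterion[where u = "\<lambda>i x. x i" and C = "{..<n}"])
  show "is_haar (so_torus n) (so_base n) (haar_measure (so_torus n) (so_base n))" by (rule so_haar)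
  show "so_coords n = (\<Union>c<n. {\<lambda>x. Re (x c), \<lambda>x. Im (x c)})" by (simp add: so_coords_def)
  show "(\<lambda>x. x c) \<in> borel_measurable (restrict_space borel (orbit_of (so_torus n) (so_base n)))" for c
    by (rule measurable_restrict_space1) simp
  show "cmod (x c) = 1" if "c \<in> {..<n}" "x \<in> orbit_of (so_torus n) (so_base n)" for c x
    using that by (auto simp: so_orbit)
  show "\<exists>g\<in>so_torus n. inj_on g F \<and> g ` F \<subseteq> F \<and> (\<forall>c\<in>{..<n}. \<forall>x\<in>orbit_of (so_torus n) (so_base n). g x c = q c * x c)"
    if q: "q \<in> F" for q
  proof (intro bexI[of _ "so_rot n q"] conjI)
    have qo: "\<forall>i<n. cmod (q i) = 1" using q F(3) by (auto simp: so_orbit)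
    then show "so_rot n q \<in> so_torus n" by (auto simp: so_torus_def)
    have e: "so_rot n q x = (\<lambda>i. q i * x i)" if "x \<in> F" for x
      using that q F(3) by (auto simp: so_orbit so_rot_def fun_eq_iff)
    show "inj_on (so_rot n q) F"
    proof (rule inj_onI)
      fix x y assume xy: "x \<in> F" "y \<in> F" "so_rot n q x = so_rot n q y"
      show "x = y"
      proof
        fix i
        show "x i = y i"
        proof (cases "i < n")
          case True
          then have "q i \<noteq> 0" using qo by auto
          moreover have "q i * x i = q i * y i" using fun_cong[OF xy(3), of i] True by (simp add: so_rot_def)
          ultimately show ?thesis by simp
        next
          case False
          moreover have "x \<in> orbit_of (so_torus n) (so_base n)" "y \<in> orbit_of (so_torus n) (so_base n)"
            using xy F(3) by auto
          ultimately show ?thesis by (simp add: so_orbit)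
        qed
      qed
    qed
    show "so_rot n q ` F \<subseteq> F" using e closed[OF q] by auto
  qed (simp add: so_rot_def)
  show "monomial (\<lambda>i x. x i) A B x = 1"
    if "set_mset A \<subseteq> {..<n}" "set_mset B \<subseteq> {..<n}" "size A + size B \<le> d" "\<And>q. q \<in> F \<Longrightarrow> monomial (\<lambda>i x. x i) A B q = 1"
      "x \<in> orbit_of (so_torus n) (so_base n)" for A B x
  proof -
    have "A = B" by (rule triv) (use that in auto)
    then show ?thesis
      unfolding monomial_def using that by (simp only:) (rule prod_mset_mult_cnj_self, auto simp: so_orbit)
  qed
qed (use F in auto)

text \<open>The grid controls only the \<open>t\<close> odd power sums, but the multisets compared
  may have \<open>2 t\<close> elements. Symmetrizing under negation supplies the even ones.\<close>

lemma so_grid_separates: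
  assumes p: "prime p" "2 * n < p" "2 * t < p"
    and AB: "set_mset A \<subseteq> {..<n}" "set_mset B \<subseteq> {..<n}" "size A + size B \<le> 2 * t"
    and triv: "\<And>q. q \<in> so_grid p t n \<Longrightarrow> monomial (\<lambda>i x. x i) A B q = 1"
  shows "A = B"
proof -
  define s :: "nat \<Rightarrow> int" where "s = (\<lambda>i. int i + 1)"
  define A' B' where "A' = image_mset s A" and "B' = image_mset s B"
  have A': "x \<in># A' \<Longrightarrow> 1 \<le> x \<and> x \<le> int n" for x using AB(1) by (auto simp: A'_def s_def)
  have B': "x \<in># B' \<Longrightarrow> 1 \<le> x \<and> x \<le> int n" for x using AB(2) by (auto simp: B'_def s_def)
  have odd: "[power_sum A' (odd_exp j) = power_sum B' (odd_exp j)] (mod int p)" if "j < t" for j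
  proof (rule power_sums_cong_if_trivial_on_grid[OF _ that])
    show "p > 1" by (rule prime_gt_1_nat[OF p(1)])
    fix \<xi> assume "\<xi> \<in> grid p t"
    then have "monomial (\<lambda>i x. x i) A B (so_point p t n \<xi>) = 1" by (intro triv) (simp add: so_grid_def)
    moreover have "(\<Prod>i\<in>#D. so_point p t n \<xi> i) = (\<Prod>x\<in>#image_mset s D. weight p odd_exp t \<xi> x)" if "set_mset D \<subseteq> {..<n}" for D
      using that by (induction D) (auto simp: so_point_def s_def)
    ultimately show "(\<Prod>x\<in>#A'. weight p odd_exp t \<xi> x) * cnj (\<Prod>x\<in>#B'. weight p odd_exp t \<xi> x) = 1"
      using AB by (simp add: monomial_def A'_def B'_def)
  qed
  \<comment> \<open>Even power sums of \<open>Y\<close> and \<open>W\<close> coincide identically.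
    The odd ones are plus and minus the difference of those of \<open>A'\<close> and
    \<open>B'\<close>, which is 0 mod \<open>p\<close>.\<close>
  define Y W where "Y = A' + image_mset uminus B'" and "W = B' + image_mset uminus A'"
  have ps: "power_sum (D + image_mset uminus E) j = power_sum D j + (-1) ^ j * power_sum E j" for D E j
  proof (induction E)
    case (add y E)
    then show ?case using power_minus[of y j] by (simp add: distrib_left)
  qed simp
  have "image_mset (\<lambda>y. y mod int p) Y = image_mset (\<lambda>y. y mod int p) W"
  proof (rule power_sums_determine_mset[OF p(1,3)])
    show "size Y = size W" "size Y \<le> 2 * t" using AB(3) by (simp_all add: Y_def W_def A'_def B'_def)
    fix j assume j: "j \<in> {1..2 * t}"
    show "[power_sum Y j = power_sum W j] (mod int p)"
    proof (cases "even j")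
      case True
      then show ?thesis by (simp add: Y_def W_def ps add.commute)
    next
      case False
      then obtain l where l: "j = odd_exp l" by (elim oddE)
      then have "l < t" using j by auto
      from cong_diff[OF odd[OF this] cong_sym[OF odd[OF this]]]
      show ?thesis using False by (simp add: Y_def W_def ps l)
    qed
  qed
  then have eq: "filter_mset (\<lambda>r. r \<le> int n) (image_mset (\<lambda>y. y mod int p) Y) = filter_mset (\<lambda>r. r \<le> int n) (image_mset (\<lambda>y. y mod int p) W)" by simp
  \<comment> \<open>Positive labels keep residues in \<open>1..n\<close>, negated ones become
    \<open>p - x > n\<close> since \<open>p > 2 * n\<close>. Cutting at \<open>n\<close> therefore
    reads \<open>A'\<close> off \<open>Y\<close> and \<open>B'\<close> off \<open>W\<close>.\<close>
  have f: "filter_mset (\<lambda>r. r \<le> int n) (image_mset (\<lambda>y. y mod int p) (D + image_mset uminus E)) = D"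
    if D: "\<And>x. x \<in># D \<Longrightarrow> 1 \<le> x \<and> x \<le> int n" and E: "\<And>x. x \<in># E \<Longrightarrow> 1 \<le> x \<and> x \<le> int n" for D E
  proof -
    have "image_mset (\<lambda>y. y mod int p) D = D" by (rule image_mset_mod_id) (use D p(2) in fastforce)
    moreover have "filter_mset (\<lambda>r. r \<le> int n) D = D" using D by (simp add: filter_mset_eq_conv)
    moreover have "\<not> r \<le> int n" if "r \<in># image_mset (\<lambda>y. y mod int p) (image_mset uminus E)" for r
    proof -
      from that obtain x where x: "x \<in># E" "r = (- x) mod int p" by auto
      have "(- x) mod int p = (int p - x) mod int p" by simp
      also have "\<dots> = int p - x" using E[OF x(1)] p(2) by (intro mod_pos_pos_trivial) auto
      finally show "\<not> r \<le> int n" using x E[OF x(1)] p(2) by simp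
    qed
    then have "filter_mset (\<lambda>r. r \<le> int n) (image_mset (\<lambda>y. y mod int p) (image_mset uminus E)) = {#}"
      by (subst set_mset_eq_empty_iff[symmetric]) auto
    ultimately show ?thesis by simp
  qed
  have "A' = B'" using eq f[OF A' B'] f[OF B' A'] by (simp add: Y_def W_def)
  then show "A = B" unfolding A'_def B'_def
    by (rule multiset.inj_map_strong[rotated]) (simp add: s_def)
qed

lemma so_design_grid:
  assumes p: "prime p" "2 * n < p" "2 * t < p"
  shows "so_design n (2 * t) (so_grid p t n)"
proof (rule so_design_if_closed)
  have p0: "p > 0" using p(1) by (rule prime_gt_0_nat)
  show "so_grid p t n \<noteq> {}" using grid_nonempty[OF p0] by (simp add: so_grid_def)
  show "(\<lambda>i. q i * q' i) \<in> so_grid p t n" if "q \<in> so_grid p t n" "q' \<in> so_grid p t n" for q q'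
    by (rule so_grid_mult[OF p0 that])
qed (use so_grid_separates[OF p] so_grid_finite so_grid_orbit in auto)

text \<open>A monomial that is 1 at both \<open>q\<close> and \<open>-q\<close> has even total
  degree, so the bound \<open>2 t + 1\<close> drops to \<open>2 t\<close>.\<close>

lemma so_design_grid_pm:
  assumes p: "prime p" "2 * n < p" "2 * t < p"
  shows "so_design n (2 * t + 1) (so_grid_pm p t n)"
proof (rule so_design_if_closed)
  have p0: "p > 0" using p(1) by (rule prime_gt_0_nat)
  show "so_grid_pm p t n \<noteq> {}" using grid_nonempty[OF p0] by (simp add: so_grid_pm_def so_grid_def)
  show "(\<lambda>i. q i * q' i) \<in> so_grid_pm p t n" if "q \<in> so_grid_pm p t n" "q' \<in> so_grid_pm p t n" for q q'
    by (rule so_grid_pm_mult[OF p0 that])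
  fix A B :: "nat multiset"
  assume AB: "set_mset A \<subseteq> {..<n}" "set_mset B \<subseteq> {..<n}" "size A + size B \<le> 2 * t + 1"
    and triv: "\<And>q. q \<in> so_grid_pm p t n \<Longrightarrow> monomial (\<lambda>i x. x i) A B q = 1"
  obtain \<xi> where "\<xi> \<in> grid p t" using grid_nonempty[OF p0, of t] by blast
  then obtain q where q: "q \<in> so_grid p t n" unfolding so_grid_def by blast
  have neg: "(\<Prod>i\<in>#D. - q i) = (-1) ^ size D * (\<Prod>i\<in>#D. q i)" for D
    by (induction D) simp_all
  have "monomial (\<lambda>i x. x i) A B (\<lambda>i. - q i) = (-1) ^ (size A + size B) * monomial (\<lambda>i x. x i) A B q"
    by (simp add: monomial_def neg power_add)
  moreover have "monomial (\<lambda>i x. x i) A B q = 1" "monomial (\<lambda>i x. x i) A B (\<lambda>i. - q i) = 1"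
    using q by (auto intro!: triv simp: so_grid_pm_def)
  ultimately have "even (size A + size B)" by (metis mult_1_right neg_one_odd_power one_neq_neg_one)
  then have "size A + size B \<le> 2 * t" using AB(3) by (elim evenE) auto
  then show "A = B"
    using AB triv by (intro so_grid_separates[OF p]) (auto simp: so_grid_pm_def)
qed (use so_grid_finite so_grid_orbit in auto)

text \<open>Agreement on \<open>1..n\<close> spreads to negative labels by conjugation, as the
  exponents are odd, and at 0 all weights are 1. This gives \<open>2 n + 1\<close> points against
  degree at most \<open>2 t - 1\<close>.\<close>

lemma card_so_grid:
  assumes p: "prime p" "2 * n < p" and t: "t \<le> n"
  shows "card (so_grid p t n) = p ^ t"
proof -
  have "inj_on (so_point p t n) (grid p t)"
  proof (rule inj_onI)
    fix \<xi> \<eta> assume g: "\<xi> \<in> grid p t" "\<eta> \<in> grid p t" and eq: "so_point p t n \<xi> = so_point p t n \<eta>"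
    have pos: "weight p odd_exp t \<xi> x = weight p odd_exp t \<eta> x" if "x \<in> {1..int n}" for x
      using fun_cong[OF eq, of "nat (x - 1)"] that by (simp add: so_point_def nat_less_iff)
    show "\<xi> = \<eta>"
    proof (rule grid_eqI[OF p(1) _ _ _ _ _ g])
      show "inj_on odd_exp {..<t}" by (simp add: inj_on_def)
      show "finite {- int n..int n}" by simp
      show "odd_exp j < card {- int n..int n}" if "j < t" for j using that t by simp
      fix x assume x: "x \<in> {- int n..int n}"
      show "x = y" if "y \<in> {- int n..int n}" "int p dvd x - y" for y
      proof (rule ccontr)
        assume "x \<noteq> y"
        then have "int p \<le> \<bar>x - y\<bar>" using that by (intro zdvd_imp_le) auto
        then show False using x that p(2) by auto
      qed
      consider "x \<in> {1..int n}" | "- x \<in> {1..int n}" | "x = 0" using x by fastforce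
      then show "weight p odd_exp t \<xi> x = weight p odd_exp t \<eta> x"
      proof cases
        case 1
        then show ?thesis by (rule pos)
      next
        case 2
        from pos[OF this] show ?thesis by (simp only: weight_odd_uminus complex_cnj_cancel_iff)
      next
        case 3
        then show ?thesis by (simp add: weight_0)
      qed
    qed
  qed
  then show ?thesis by (simp add: so_grid_def card_image card_grid)
qed

text \<open>The grid and its negative are disjoint: the coordinate at 0 has \<open>p\<close>-th
  power 1 on the grid and, \<open>p\<close> being odd, -1 on its negative.\<close>

lemma card_so_grid_pm:
  assumes p: "prime p" "2 * n < p" and n: "n \<ge> 1"
  shows "card (so_grid_pm p t n) = 2 * card (so_grid p t n)"
proof -
  have p0: "p > 0" using p(1) by (rule prime_gt_0_nat)
  have "odd p" using p n prime_odd_nat[of p] by auto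
  have w: "q 0 ^ p = 1" if "q \<in> so_grid p t n" for q
    using that n by (auto simp: so_grid_def so_point_def weight_def unit_root_power_p[OF p0])
  have "so_grid p t n \<inter> (\<lambda>q i. - q i) ` so_grid p t n = {}"
  proof (rule equals0I)
    fix q assume "q \<in> so_grid p t n \<inter> (\<lambda>q i. - q i) ` so_grid p t n"
    then obtain r where r: "r \<in> so_grid p t n" "q = (\<lambda>i. - r i)" "q \<in> so_grid p t n" by auto
    have "q 0 ^ p = - (r 0 ^ p)" using \<open>odd p\<close> by (simp add: r(2))
    then show False using w[OF r(1)] w[OF r(3)] by (simp add: eq_neg_iff_add_eq_0)
  qed
  moreover have "card ((\<lambda>q i. - q i) ` so_grid p t n) = card (so_grid p t n)"
    by (rule card_image) (auto simp: inj_on_def fun_eq_iff)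
  ultimately show ?thesis unfolding so_grid_pm_def by (simp add: card_Un_disjoint so_grid_finite)
qed

section \<open>The torus of \<open>PSU(n+1)\<close>\<close>

definition psu_point :: "nat \<Rightarrow> (nat \<Rightarrow> complex) \<Rightarrow> nat \<Rightarrow> nat \<Rightarrow> complex" where
  "psu_point n z = (\<lambda>j k. if j \<le> n \<and> k \<le> n then z j * cnj (z k) else 0)"

definition psu_grid :: "nat \<Rightarrow> nat \<Rightarrow> nat \<Rightarrow> (nat \<Rightarrow> nat \<Rightarrow> complex) set" where
  "psu_grid p t n = (\<lambda>\<xi>. psu_point n (\<lambda>j. weight p Suc t \<xi> (int j))) ` grid p t"

lemma psu_orbit: "orbit_of (psu_torus n) (psu_base n) = {psu_point n z | z. \<forall>i\<le>n. cmod (z i) = 1}"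
  unfolding psu_orbit_eq psu_point_def by blast

text \<open>Entry \<open>(j, k)\<close> carries \<open>z j\<close> and the conjugate of
  \<open>z k\<close>; conjugating the entry swaps the roles. Both resulting multisets have size
  \<open>size A + size B\<close>.\<close>

lemma monomial_psu_point:
  assumes "set_mset A \<subseteq> {..n} \<times> {..n}" "set_mset B \<subseteq> {..n} \<times> {..n}"
  shows "monomial (\<lambda>(j, k) x. x j k) A B (psu_point n z) =
    (\<Prod>j\<in>#image_mset fst A + image_mset snd B. z j) * cnj (\<Prod>j\<in>#image_mset snd A + image_mset fst B. z j)"
proof -
  have e: "(\<Prod>c\<in>#D. (\<lambda>(j, k) x. x j k) c (psu_point n z)) = (\<Prod>j\<in>#image_mset fst D. z j) * cnj (\<Prod>j\<in>#image_mset snd D. z j)"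
    if "set_mset D \<subseteq> {..n} \<times> {..n}" for D
    using that by (induction D) (auto simp: psu_point_def)
  show ?thesis unfolding monomial_def e[OF assms(1)] e[OF assms(2)] by simp
qed

text \<open>The conclusion cannot be \<open>A = B\<close>, because matrix entries on the orbit
  satisfy relations such as \<open>x j k * x k j = 1\<close>; only the induced characters of
  \<open>z\<close> are determined. Their multisets have equal size at most \<open>t\<close>, so
  \<open>t\<close> power sums decide, even with label 0 present.\<close>

lemma psu_grid_separates:
  assumes p: "prime p" "n < p" "t < p"
    and AB: "set_mset A \<subseteq> {..n} \<times> {..n}" "set_mset B \<subseteq> {..n} \<times> {..n}" "size A + size B \<le> t"
    and triv: "\<And>q. q \<in> psu_grid p t n \<Longrightarrow> monomial (\<lambda>(j, k) x. x j k) A B q = 1"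
  shows "image_mset fst A + image_mset snd B = image_mset snd A + image_mset fst B"
proof -
  define J K where "J = image_mset fst A + image_mset snd B" and "K = image_mset snd A + image_mset fst B"
  have JK: "set_mset J \<subseteq> {..n}" "set_mset K \<subseteq> {..n}" using AB by (auto simp: J_def K_def)
  have size: "size J = size K" "size J \<le> t" using AB(3) by (simp_all add: J_def K_def)
  have "image_mset (\<lambda>y. y mod int p) (image_mset int J) = image_mset (\<lambda>y. y mod int p) (image_mset int K)"
  proof (rule power_sums_determine_mset[OF p(1,3)])
    fix j assume "j \<in> {1..t}"
    then obtain l where l: "j = Suc l" "l < t" by (cases j) auto
    have "[power_sum (image_mset int J) (Suc l) = power_sum (image_mset int K) (Suc l)] (mod int p)"
    proof (rule power_sums_cong_if_trivial_on_grid[OF _ l(2)])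
      show "p > 1" by (rule prime_gt_1_nat[OF p(1)])
      fix \<xi> assume "\<xi> \<in> grid p t"
      then have "monomial (\<lambda>(j, k) x. x j k) A B (psu_point n (\<lambda>j. weight p Suc t \<xi> (int j))) = 1"
        by (intro triv) (simp add: psu_grid_def)
      then show "(\<Prod>x\<in>#image_mset int J. weight p Suc t \<xi> x) * cnj (\<Prod>x\<in>#image_mset int K. weight p Suc t \<xi> x) = 1"
        unfolding monomial_psu_point[OF AB(1,2)] J_def[symmetric] K_def[symmetric] by (simp add: image_mset.compositionality o_def)
    qed
    then show "[power_sum (image_mset int J) j = power_sum (image_mset int K) j] (mod int p)" by (simp add: l)
  qed (use size in simp_all)
  moreover have "image_mset (\<lambda>y. y mod int p) (image_mset int D) = image_mset int D" if "set_mset D \<subseteq> {..n}" for D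
    by (rule image_mset_mod_id) (use that p(2) in auto)
  ultimately have "image_mset int J = image_mset int K" using JK by simp
  then have "J = K" by (rule multiset.inj_map_strong[rotated]) simp
  then show ?thesis by (simp add: J_def K_def)
qed

lemma psu_design_grid:
  assumes p: "prime p" "n < p" "t < p"
  shows "psu_design n t (psu_grid p t n)"
  unfolding psu_design_def
proof (rule is_design_criterion[where u = "\<lambda>(j, k) x. x j k" and C = "{..n} \<times> {..n}"])
  let ?X = "orbit_of (psu_torus n) (psu_base n)"
  let ?F = "psu_grid p t n"
  have p0: "p > 0" using p(1) by (rule prime_gt_0_nat)
  show "is_haar (psu_torus n) (psu_base n) (haar_measure (psu_torus n) (psu_base n))" by (rule psu_haar)
  show "psu_coords n = (\<Union>c\<in>{..n} \<times> {..n}. {\<lambda>x. Re ((case c of (j, k) \<Rightarrow> \<lambda>x. x j k) x), \<lambda>x. Im ((case c of (j, k) \<Rightarrow> \<lambda>x. x j k) x)})"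
    unfolding psu_coords_def by fastforce
  show "(case c of (j, k) \<Rightarrow> \<lambda>x. x j k) \<in> borel_measurable (restrict_space borel ?X)" for c :: "nat \<times> nat"
    by (cases c, simp, rule measurable_restrict_space1)
       (rule measurable_compose[OF measurable_product_coordinates measurable_product_coordinates])
  show "cmod ((case c of (j, k) \<Rightarrow> \<lambda>x. x j k) x) = 1" if "c \<in> {..n} \<times> {..n}" "x \<in> ?X" for c and x :: "nat \<Rightarrow> nat \<Rightarrow> complex"
    using that by (auto simp: psu_orbit psu_point_def norm_mult)
  show "finite ?F" by (simp add: psu_grid_def finite_grid)
  show "?F \<noteq> {}" using grid_nonempty[OF p0] by (simp add: psu_grid_def)
  show FX: "?F \<subseteq> ?X" unfolding psu_grid_def psu_orbit by (auto intro!: exI)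
  show "\<exists>g\<in>psu_torus n. inj_on g ?F \<and> g ` ?F \<subseteq> ?F \<and>
      (\<forall>c\<in>{..n} \<times> {..n}. \<forall>x\<in>?X. (case c of (j, k) \<Rightarrow> \<lambda>x. x j k) (g x) = (case c of (j, k) \<Rightarrow> \<lambda>x. x j k) q * (case c of (j, k) \<Rightarrow> \<lambda>x. x j k) x)"
    if q: "q \<in> ?F" for q
  proof -
    obtain \<xi> where \<xi>: "\<xi> \<in> grid p t" "q = psu_point n (\<lambda>j. weight p Suc t \<xi> (int j))"
      using q by (auto simp: psu_grid_def)
    \<comment> \<open>The weights need not have product 1. Membership in the orbit supplies a
      \<open>z\<close> of determinant 1 that gives the same matrix.\<close>
    have "q \<in> ?X" using q FX by blast
    then obtain h where h: "h \<in> psu_torus n" "q = h (psu_base n)" unfolding orbit_of_def by blast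
    then obtain z where "h = psu_conj n z" unfolding psu_torus_def by blast
    with h have z: "psu_conj n z \<in> psu_torus n" "q = psu_conj n z (psu_base n)" by auto
    have gz: "psu_conj n z x j k = q j k * x j k" if "j \<le> n" "k \<le> n" for x j k
      using that by (simp add: z(2) psu_conj_def psu_base_def)
    have g: "psu_conj n z (psu_point n w) = psu_point n (\<lambda>j. weight p Suc t \<xi> (int j) * w j)" for w
    proof (intro ext)
      fix j k
      show "psu_conj n z (psu_point n w) j k = psu_point n (\<lambda>j. weight p Suc t \<xi> (int j) * w j) j k"
      proof (cases "j \<le> n \<and> k \<le> n")
        case True
        then show ?thesis by (simp add: gz \<xi>(2) psu_point_def)
      qed (auto simp: psu_conj_def psu_point_def)
    qed
    have "inj_on (psu_conj n z) ?F"
    proof (rule inj_onI)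
      fix x y assume xy: "x \<in> ?F" "y \<in> ?F" "psu_conj n z x = psu_conj n z y"
      show "x = y"
      proof (intro ext)
        fix j k
        show "x j k = y j k"
        proof (cases "j \<le> n \<and> k \<le> n")
          case True
          then have "q j k \<noteq> 0" by (auto simp: \<xi>(2) psu_point_def weight_def unit_root_def)
          moreover have "q j k * x j k = q j k * y j k" using True fun_cong[OF fun_cong[OF xy(3), of j], of k] by (simp add: gz)
          ultimately show ?thesis by simp
        next
          case False
          then show ?thesis using xy by (auto simp: psu_grid_def psu_point_def)
        qed
      qed
    qed
    moreover have "psu_conj n z ` ?F \<subseteq> ?F"
    proof safe
      fix x assume "x \<in> ?F"
      then obtain \<eta> where \<eta>: "x = psu_point n (\<lambda>j. weight p Suc t \<eta> (int j))" by (auto simp: psu_grid_def)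
      show "psu_conj n z x \<in> ?F"
        unfolding \<eta> g weight_grid_add[OF p0, symmetric] psu_grid_def using grid_add_in[OF p0] by blast
    qed
    ultimately show ?thesis using z(1) gz by (intro bexI[of _ "psu_conj n z"]) auto
  qed
  show "monomial (\<lambda>(j, k) x. x j k) A B x = 1"
    if "set_mset A \<subseteq> {..n} \<times> {..n}" "set_mset B \<subseteq> {..n} \<times> {..n}" "size A + size B \<le> t"
      "\<And>q. q \<in> ?F \<Longrightarrow> monomial (\<lambda>(j, k) x. x j k) A B q = 1" "x \<in> ?X" for A B x
  proof -
    from that(5) obtain z where z: "x = psu_point n z" "\<forall>i\<le>n. cmod (z i) = 1" by (auto simp: psu_orbit)
    have e: "image_mset fst A + image_mset snd B = image_mset snd A + image_mset fst B"
      by (rule psu_grid_separates[OF p that(1-4)])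
    show ?thesis unfolding z(1) monomial_psu_point[OF that(1,2)] e
      by (rule prod_mset_mult_cnj_self) (use that(1,2) z(2) in auto)
  qed
qed

text \<open>There are \<open>n + 1\<close> labels against polynomials of degree at most
  \<open>t <= n\<close>.\<close>

lemma card_psu_grid:
  assumes p: "prime p" "n < p" and t: "t \<le> n"
  shows "card (psu_grid p t n) = p ^ t"
proof -
  have "inj_on (\<lambda>\<xi>. psu_point n (\<lambda>j. weight p Suc t \<xi> (int j))) (grid p t)"
  proof (rule inj_onI)
    fix \<xi> \<eta> assume g: "\<xi> \<in> grid p t" "\<eta> \<in> grid p t"
      and eq: "psu_point n (\<lambda>j. weight p Suc t \<xi> (int j)) = psu_point n (\<lambda>j. weight p Suc t \<eta> (int j))"
    show "\<xi> = \<eta>"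
    proof (rule grid_eqI[OF p(1) _ _ _ _ _ g])
      show "inj_on Suc {..<t}" by simp
      show "finite {0..int n}" by simp
      show "Suc j < card {0..int n}" if "j < t" for j using that t by simp
      fix x assume x: "x \<in> {0..int n}"
      show "x = y" if "y \<in> {0..int n}" "int p dvd x - y" for y
      proof (rule ccontr)
        assume "x \<noteq> y"
        then have "int p \<le> \<bar>x - y\<bar>" using that by (intro zdvd_imp_le) auto
        then show False using x that p(2) by auto
      qed
      \<comment> \<open>All exponents are positive, so label 0 has weight 1 and column 0 of the
        matrix lists the weights themselves.\<close>
      show "weight p Suc t \<xi> x = weight p Suc t \<eta> x"
        using fun_cong[OF fun_cong[OF eq, of "nat x"], of 0] x by (simp add: psu_point_def weight_0 nat_le_iff)
    qed
  qed
  then show ?thesis by (simp add: psu_grid_def card_image card_grid)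
qed

section \<open>Asymptotics\<close>

lemma power_asymp_equiv:
  assumes "(\<lambda>n. real (q n) / f n) \<longlonglongrightarrow> 1"
    and "\<forall>\<^sub>F n in sequentially. c n = q n ^ t" and "\<forall>\<^sub>F n in sequentially. f n \<noteq> 0"
  shows "(\<lambda>n. real (c n)) \<sim>[at_top] (\<lambda>n. f n ^ t)"
proof (rule asymp_equivI')
  have "(\<lambda>n. (real (q n) / f n) ^ t) \<longlonglongrightarrow> 1 ^ t" by (intro tendsto_power assms)
  moreover have "\<forall>\<^sub>F n in sequentially. (real (q n) / f n) ^ t = real (c n) / f n ^ t"
    using assms(2) by eventually_elim (simp add: power_divide)
  ultimately show "(\<lambda>n. real (c n) / f n ^ t) \<longlonglongrightarrow> 1"
    using Lim_transform_eventually by fastforce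
qed

text \<open>The cutoff \<open>c\<close> keeps the prime above the degree bound for small
  \<open>n\<close> as well; it is inactive for large \<open>n\<close> and leaves the limit
  unchanged.\<close>

lemma next_prime_max_asymp:
  assumes k: "filterlim k at_top sequentially" and f: "(\<lambda>n. real (k n) / f n) \<longlonglongrightarrow> 1"
  shows "(\<lambda>n. real (next_prime (max (k n) c)) / f n) \<longlonglongrightarrow> 1"
proof -
  have "(\<lambda>n. real (next_prime (k n)) / real (k n)) \<longlonglongrightarrow> 1"
    by (rule filterlim_compose[OF next_prime_asymp k])
  from tendsto_mult[OF this f]
  have "(\<lambda>n. real (next_prime (k n)) / real (k n) * (real (k n) / f n)) \<longlonglongrightarrow> 1" by simp
  moreover have "\<forall>\<^sub>F n in sequentially. k n \<ge> max c 1"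
    using k unfolding filterlim_at_top by blast
  then have "\<forall>\<^sub>F n in sequentially. real (next_prime (k n)) / real (k n) * (real (k n) / f n) = real (next_prime (max (k n) c)) / f n"
  proof eventually_elim
    case (elim n)
    then have "max (k n) c = k n" "k n > 0" by auto
    then show ?case by simp
  qed
  ultimately show ?thesis by (rule Lim_transform_eventually)
qed

theorem theorem3p3:
  fixes t :: nat
  shows "(\<exists>H. (\<forall>n\<ge>1. so_design n (2 * t + 1) (H n)) \<and>
              (\<lambda>n. real (card (H n))) \<in> O(\<lambda>n. real n ^ t)) \<and>
         (\<exists>F G. (\<forall>n\<ge>1. so_design n (2 * t) (F n) \<and> so_design n (2 * t + 1) (G n) \<and>
                         card (G n) = 2 * card (F n)) \<and>
                (\<lambda>n. real (card (F n))) \<sim>[at_top] (\<lambda>n. (2 * real n) ^ t)) \<and>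
         (\<exists>E. (\<forall>n\<ge>1. psu_design n t (E n)) \<and>
              (\<lambda>n. real (card (E n))) \<sim>[at_top] (\<lambda>n. real n ^ t))"
proof -
  \<comment> \<open>\<open>next_prime\<close> may return its argument, so the \<open>+ 1\<close>
    produces the strict inequalities.\<close>
  define q r where "q = (\<lambda>n. next_prime (max (2 * n + 1) (2 * t + 1)))" and "r = (\<lambda>n. next_prime (max (n + 1) (t + 1)))"
  have q: "prime (q n)" "2 * n < q n" "2 * t < q n" and r: "prime (r n)" "n < r n" "t < r n" for n
    using next_prime[of "max (2 * n + 1) (2 * t + 1)"] next_prime[of "max (n + 1) (t + 1)"]
    by (auto simp: q_def r_def)
  define F G E where "F = (\<lambda>n. so_grid (q n) t n)" and "G = (\<lambda>n. so_grid_pm (q n) t n)" and "E = (\<lambda>n. psu_grid (r n) t n)"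
  have F: "so_design n (2 * t) (F n)" and G: "so_design n (2 * t + 1) (G n)" and E: "psu_design n t (E n)" for n
    unfolding F_def G_def E_def using q r by (intro so_design_grid so_design_grid_pm psu_design_grid; simp)+
  have cG: "card (G n) = 2 * card (F n)" if "n \<ge> 1" for n
    unfolding F_def G_def by (rule card_so_grid_pm[OF q(1,2) that])
  have "(\<lambda>n. real (card (F n))) \<sim>[at_top] (\<lambda>n. (2 * real n) ^ t)"
  proof (rule power_asymp_equiv)
    show "(\<lambda>n. real (q n) / (2 * real n)) \<longlonglongrightarrow> 1"
      unfolding q_def
    proof (rule next_prime_max_asymp)
      show "filterlim (\<lambda>n::nat. 2 * n + 1) at_top sequentially" by (rule filterlim_subseq) (simp add: strict_mono_def)
      show "(\<lambda>n. real (2 * n + 1) / (2 * real n)) \<longlonglongrightarrow> 1" by real_asymp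
    qed
    show "\<forall>\<^sub>F n in sequentially. card (F n) = q n ^ t"
      using eventually_ge_at_top[of t] by eventually_elim (simp add: F_def card_so_grid q)
    show "\<forall>\<^sub>F n in sequentially. 2 * real n \<noteq> 0"
      using eventually_gt_at_top[of 0] by eventually_elim simp
  qed
  note aF = this
  have aE: "(\<lambda>n. real (card (E n))) \<sim>[at_top] (\<lambda>n. real n ^ t)"
  proof (rule power_asymp_equiv)
    show "(\<lambda>n. real (r n) / real n) \<longlonglongrightarrow> 1"
      unfolding r_def
    proof (rule next_prime_max_asymp)
      show "filterlim (\<lambda>n::nat. n + 1) at_top sequentially" by (rule filterlim_subseq) (simp add: strict_mono_def)
      show "(\<lambda>n. real (n + 1) / real n) \<longlonglongrightarrow> 1" by real_asymp
    qed
    show "\<forall>\<^sub>F n in sequentially. card (E n) = r n ^ t"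
      using eventually_ge_at_top[of t] by eventually_elim (simp add: E_def card_psu_grid r)
    show "\<forall>\<^sub>F n in sequentially. real n \<noteq> 0"
      using eventually_gt_at_top[of 0] by eventually_elim simp
  qed
  have "(\<lambda>n. real (card (G n))) \<in> \<Theta>(\<lambda>n. 2 * real (card (F n)))"
    by (intro bigthetaI_cong) (use eventually_ge_at_top[of 1] in \<open>eventually_elim, simp add: cG\<close>)
  also have "(\<lambda>n. 2 * real (card (F n))) \<in> O(\<lambda>n. (2 * real n) ^ t)"
    using asymp_equiv_imp_bigo[OF aF] by simp
  also have "(\<lambda>n. (2 * real n) ^ t) \<in> O(\<lambda>n. real n ^ t)"
    by (simp add: power_mult_distrib)
  finally have bG: "(\<lambda>n. real (card (G n))) \<in> O(\<lambda>n. real n ^ t)" .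
  show ?thesis using F G E cG aF aE bG by blast
qed

end
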